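(* Let $(X_n)_{n\ge1}$ be a c.i.d. sequence of random variables on a probability space $(\Omega,\mathcal{A},P)$ with values in a measurable space $(E,\mathcal{E})$. Suppose $f$ and $f^2$ are in $\mathcal{H}$ and there exists an integer $m\ge0$ such that the real sequence $(f(X_{n+m})-V_f)_{n\ge1}$ is c.i.d. Then $$W_{n,f}=\frac{1}{\sqrt n}\bigl(f(X_1)+\cdots+f(X_n)-nV_f\bigr)$$ converges stably with representing measure $\mathcal{N}(0,V_{f^2}-(V_f)^2)$.
   Context: A sequence $(Y_n)_{n\ge1}$ of random variables with values in a measurable space is c.i.d. (conditionally identically distributed) if, with $\mathcal{G}^Y_0=\{\varnothing,\Omega\}$ and $\mathcal{G}^Y_n=\sigma(Y_1,\dots,Y_n)$, one has $E[g(Y_k)\mid\mathcal{G}^Y_n]=E[g(Y_{n+1})\mid\mathcal{G}^Y_n]$ a.s. for all $k>n\ge0$ and all bounded measurable real functions $g$ on the state space. $\mathcal{H}$ is the class of measurable $f:E\to\mathbb{R}$ with $E[|f(X_1)|]<\infty$. For $(X_n)_n$ c.i.d. and $f\in\mathcal{H}$, $V_f$ denotes (a version of) the limit of $(f(X_n))_n$ in $\sigma(L^1,L^\infty)$, i.e. the a.s. unique integrable random variable with $E[f(X_n)Z]\to E[V_fZ]$ for every bounded random variable $Z$; it always exists, and equals the limit a.s. and in $L^1$ of $E[f(X_{n+1})\mid\mathcal{G}^X_n]$. $\mathcal{N}(0,c)$ is the Gaussian law on $\mathbb{R}$ with mean $0$ and variance $c\ge0$, with $\mathcal{N}(0,0)=\delta_0$.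 For an a.s. nonnegative real random variable $L$, a sequence $(Z_n)_n$ of real random variables converges stably with representing measure $\mathcal{N}(0,L)$ if, for every $H\in\mathcal{A}$ with $P(H)>0$, $(Z_n)_n$ converges in distribution under $P(\cdot\mid H)$ to the law $\mu_H(\cdot)=\int\mathcal{N}(0,L(\omega))(\cdot)\,P(d\omega\mid H)$. *)

theory Defs
  imports "HOL-Probability.Probability"
begin

text \<open>
  Sequences are indexed by the integers \<open>n \<ge> 1\<close>: a sequence is a function on \<^typ>\<open>nat\<close> whose value
  at \<open>0\<close> is ignored.
\<close>

definition past_sigma :: "'a measure \<Rightarrow> 'b measure \<Rightarrow> (nat \<Rightarrow> 'a \<Rightarrow> 'b) \<Rightarrow> nat \<Rightarrow> 'a measure" where
  "past_sigma M N Y n =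
     sigma (space M) {Y i -` A \<inter> space M | i A. i \<in> {1..n} \<and> A \<in> sets N}"

definition cid :: "'a measure \<Rightarrow> 'b measure \<Rightarrow> (nat \<Rightarrow> 'a \<Rightarrow> 'b) \<Rightarrow> bool" where
  "cid M N Y \<longleftrightarrow>
     (\<forall>n\<ge>1. Y n \<in> measurable M N) \<and>
     (\<forall>g. g \<in> borel_measurable N \<and> bounded (g ` space N) \<longrightarrow>
        (\<forall>n k. n < k \<longrightarrow>
           (AE \<omega> in M.
              real_cond_exp M (past_sigma M N Y n) (\<lambda>\<omega>. g (Y k \<omega>)) \<omega> =
              real_cond_exp M (past_sigma M N Y n) (\<lambda>\<omega>. g (Y (n + 1) \<omega>)) \<omega>)))"

definition class_H :: "'a measure \<Rightarrow> 'b measure \<Rightarrow> (nat \<Rightarrow> 'a \<Rightarrow> 'b) \<Rightarrow> ('b \<Rightarrow> real) set" where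
  "class_H M N X = {f \<in> borel_measurable N. integrable M (\<lambda>\<omega>. f (X 1 \<omega>))}"

text \<open>
  The random variable \<open>V\<close> is a version of the limit of \<open>(Z\<^sub>n)\<close> in \<open>\<sigma>(L\<^sup>1, L\<^sup>\<infinity>)\<close>.  For \<open>f\<close> in
  \<^const>\<open>class_H\<close>, the versions of \<open>V\<^sub>f\<close> are the functions \<open>V\<close> with
  \<open>weak_L1_limit M (\<lambda>n \<omega>. f (X n \<omega>)) V\<close>.
\<close>

definition weak_L1_limit :: "'a measure \<Rightarrow> (nat \<Rightarrow> 'a \<Rightarrow> real) \<Rightarrow> ('a \<Rightarrow> real) \<Rightarrow> bool" where
  "weak_L1_limit M Z V \<longleftrightarrow>
     (\<forall>n\<ge>1. integrable M (Z n)) \<and> integrable M V \<and>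
     (\<forall>B \<in> borel_measurable M. bounded (B ` space M) \<longrightarrow>
        (\<lambda>n. \<integral>\<omega>. Z n \<omega> * B \<omega> \<partial>M) \<longlonglongrightarrow> (\<integral>\<omega>. V \<omega> * B \<omega> \<partial>M))"

text \<open>
  The parameter of \<open>normal_law\<close> is the variance, whereas \<^const>\<open>normal_density\<close> takes the standard
  deviation.  The value at a negative parameter is a dummy.
\<close>

definition normal_law :: "real \<Rightarrow> real measure" where
  "normal_law c =
     (if 0 < c then density lborel (\<lambda>x. ennreal (normal_density 0 (sqrt c) x)) else return borel 0)"

text \<open>
  The conditional probability \<open>P(\<cdot> | H)\<close> is \<open>uniform_measure M H\<close>, and the mixture \<open>\<mu>\<^sub>H\<close> is formed with
  the monadic bind; see \<open>emeasure_normal_mixture\<close> below for the integral formula.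
\<close>

definition stably_converges_normal ::
    "'a measure \<Rightarrow> (nat \<Rightarrow> 'a \<Rightarrow> real) \<Rightarrow> ('a \<Rightarrow> real) \<Rightarrow> bool" where
  "stably_converges_normal M Z L \<longleftrightarrow>
     (\<forall>n\<ge>1. Z n \<in> borel_measurable M) \<and>
     L \<in> borel_measurable M \<and> (AE \<omega> in M. 0 \<le> L \<omega>) \<and>
     (\<forall>H \<in> sets M. 0 < measure M H \<longrightarrow>
        weak_conv_m (\<lambda>n. distr (uniform_measure M H) borel (Z n))
          (uniform_measure M H \<bind> (\<lambda>\<omega>. normal_law (L \<omega>))))"

lemma prob_space_normal_law: "prob_space (normal_law c)"
  unfolding normal_law_def
  by (auto intro: prob_space_normal_density prob_space_return)

lemma sets_normal_law [simp, measurable_cong]: "sets (normal_law c) = sets borel"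
  by (simp add: normal_law_def)

lemma measurable_normal_law [measurable]: "normal_law \<in> measurable borel (subprob_algebra borel)"
proof (rule measurable_subprob_algebra)
  show "subprob_space (normal_law c)" for c
    by (rule prob_space_imp_subprob_space[OF prob_space_normal_law])
  show "sets (normal_law c) = sets borel" for c
    by simp
  fix A :: "real set" assume A [measurable]: "A \<in> sets borel"
  have "(\<lambda>c. emeasure (normal_law c) A) =
      (\<lambda>c. if 0 < c then \<integral>\<^sup>+x. ennreal (normal_density 0 (sqrt c) x) * indicator A x \<partial>lborel
           else indicator A 0)"
    by (auto simp: normal_law_def emeasure_density)
  also have "\<dots> \<in> borel_measurable borel"
    unfolding normal_density_def by measurable
  finally show "(\<lambda>c. emeasure (normal_law c) A) \<in> borel_measurable borel" .
qed

lemma emeasure_normal_mixture: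
  assumes "prob_space M" "L \<in> borel_measurable M" "A \<in> sets borel"
  shows "emeasure (uniform_measure M H \<bind> (\<lambda>\<omega>. normal_law (L \<omega>))) A =
    (\<integral>\<^sup>+\<omega>. emeasure (normal_law (L \<omega>)) A \<partial>uniform_measure M H)"
proof (rule emeasure_bind)
  show "space (uniform_measure M H) \<noteq> {}"
    using prob_space.not_empty[OF assms(1)] by simp
  show "(\<lambda>\<omega>. normal_law (L \<omega>)) \<in> measurable (uniform_measure M H) (subprob_algebra borel)"
    using measurable_compose[OF assms(2) measurable_normal_law]
    by (simp cong: measurable_cong_sets)
qed (rule assms(3))

end

theory Submission
  imports Defs
begin

text \<open>
  The increments \<open>Z\<^sub>n = f(X\<^sub>n\<^sub>+\<^sub>m) - V\<^sub>f\<close> are c.i.d. with weak limit \<open>0\<close>, so each has conditional mean \<open>0\<close>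
  given its past: they are martingale differences with a common law.  By McLeish's argument,
  \<open>exp(it S\<^sub>n/\<surd>n)\<close> is close to \<open>T\<^sub>n exp(-t\<^sup>2 Q\<^sub>n/2)\<close>, where \<open>T\<^sub>n = \<Prod>(1 + it Z\<^sub>k/\<surd>n)\<close> and \<open>Q\<^sub>n\<close> is the mean
  of the \<open>Z\<^sub>k\<^sup>2\<close>.  The martingale property makes the \<open>L\<^sup>2\<close>-bounded variables \<open>T\<^sub>n - 1\<close> asymptotically
  orthogonal, hence weakly null, even against events that are not measurable with respect to the past of
  the \<open>Z\<^sub>k\<close>; this is what makes the convergence stable.  Finally \<open>Q\<^sub>n\<close> tends in \<open>L\<^sup>1\<close> to the weak limit
  \<open>V\<^bsub>f^2\<^esub> - (V\<^sub>f)\<^sup>2\<close> of \<open>Z\<^sub>k\<^sup>2\<close>.  For a bounded function of a c.i.d. sequence this law of large numbers holds since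
  its predictions form a martingale bounded in \<open>L\<^sup>2\<close>; the general case follows by truncation.
\<close>

section \<open>Square-integrable functions\<close>

text \<open>The limit variance \<open>L\<close> need not be measurable with respect to the past of
  the increments, so exp(-t^2 L/2) cannot be pulled out of a conditional expectation. It is instead
  absorbed, together with the indicator of \<open>H\<close>, into a bounded test function, against
  which the product converges weakly. Having only second moments costs two cuts: the increments are
  stopped once their quadratic variation passes n times a constant, and \<open>H\<close> is first
  restricted to an event on which \<open>L\<close> is bounded, with the constant chosen above that
  bound, so that stopping there betrays a large error in the law of large numbers. The Taylor
  remainders are negligible in total because all increments share one square-integrable law. No
  strong limit of the averages is ever constructed: they stay close in L1 to a prediction made at a
  fixed time, and the weak limit, given beforehand, must then be close to the same prediction.
  Square integrability of \<open>V_f\<close>, on which the expansion of the squared increment rests,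
  is itself extracted from the weak limit. Passing from the shifted sums to the original ones alters
  at most 2m summands, an L1 error of order 1/sqrt n.\<close>

definition square_integrable :: "'a measure \<Rightarrow> ('a \<Rightarrow> real) \<Rightarrow> bool" where
  "square_integrable M f \<longleftrightarrow> f \<in> borel_measurable M \<and> integrable M (\<lambda>x. (f x)\<^sup>2)"

lemma square_integrable_mult:
  assumes "square_integrable M f" "square_integrable M g"
  shows "integrable M (\<lambda>x. f x * g x)"
proof -
  have [measurable]: "f \<in> borel_measurable M" "g \<in> borel_measurable M"
    and i: "integrable M (\<lambda>x. (f x)\<^sup>2 + (g x)\<^sup>2)"
    using assms by (auto simp: square_integrable_def)
  have "\<bar>a * b\<bar> \<le> a\<^sup>2 + b\<^sup>2" for a b :: real
    using sum_squares_bound[of "\<bar>a\<bar>" "\<bar>b\<bar>"] zero_le_mult_iff[of "\<bar>a\<bar>" "\<bar>b\<bar>"]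
    unfolding abs_mult power2_abs by linarith
  then show ?thesis
    by (intro Bochner_Integration.integrable_bound[OF i]) auto
qed

lemma (in finite_measure) integrable_of_square_integrable:
  "square_integrable M f \<Longrightarrow> integrable M f"
  unfolding square_integrable_def by (blast intro: square_integrable_imp_integrable)

lemma square_integrable_lincomb:
  assumes "square_integrable M f" "square_integrable M g"
  shows "square_integrable M (\<lambda>x. f x + c * g x)"
proof -
  have "integrable M (\<lambda>x. (f x)\<^sup>2 + 2 * c * (f x * g x) + c\<^sup>2 * (g x)\<^sup>2)"
    using assms square_integrable_mult[OF assms] unfolding square_integrable_def by simp
  also have "(\<lambda>x. (f x)\<^sup>2 + 2 * c * (f x * g x) + c\<^sup>2 * (g x)\<^sup>2) = (\<lambda>x. (f x + c * g x)\<^sup>2)"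
    by (auto simp: power2_eq_square algebra_simps)
  finally show ?thesis
    using assms by (auto simp: square_integrable_def)
qed

lemma square_integrable_diff:
  assumes "square_integrable M f" "square_integrable M g"
  shows "square_integrable M (\<lambda>x. f x - g x)"
  using square_integrable_lincomb[OF assms, of "-1"] by simp

lemma square_integrable_bounded_mult:
  assumes f: "square_integrable M f" and g: "g \<in> borel_measurable M" and b: "\<And>x. x \<in> space M \<Longrightarrow> \<bar>g x\<bar> \<le> c"
  shows "square_integrable M (\<lambda>x. f x * g x)"
proof -
  have [measurable]: "f \<in> borel_measurable M" "g \<in> borel_measurable M"
    and i: "integrable M (\<lambda>x. c\<^sup>2 * (f x)\<^sup>2)"
    using f g by (auto simp: square_integrable_def)
  have "integrable M (\<lambda>x. (f x * g x)\<^sup>2)"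
  proof (rule Bochner_Integration.integrable_bound[OF i])
    have "(f x * g x)\<^sup>2 \<le> c\<^sup>2 * (f x)\<^sup>2" if "x \<in> space M" for x
    proof -
      have "(g x)\<^sup>2 \<le> c\<^sup>2"
        using power_mono[OF b[OF that], of 2] by simp
      then show ?thesis
        using mult_right_mono[of "(g x)\<^sup>2" "c\<^sup>2" "(f x)\<^sup>2"] by (simp add: power_mult_distrib ac_simps)
    qed
    then show "AE x in M. norm ((f x * g x)\<^sup>2) \<le> norm (c\<^sup>2 * (f x)\<^sup>2)"
      by (auto intro!: AE_I2)
  qed simp
  then show ?thesis by (simp add: square_integrable_def)
qed

text \<open>The integral of (f + l g)^2 is a nonnegative quadratic polynomial in \<open>l\<close>,
  so its discriminant cannot be positive.\<close>

lemma Cauchy_Schwarz_integral: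
  assumes f: "square_integrable M f" and g: "square_integrable M g"
  shows "\<bar>\<integral>x. f x * g x \<partial>M\<bar> \<le> sqrt (\<integral>x. (f x)\<^sup>2 \<partial>M) * sqrt (\<integral>x. (g x)\<^sup>2 \<partial>M)"
proof -
  define a b c where "a = (\<integral>x. (f x)\<^sup>2 \<partial>M)" and "b = (\<integral>x. f x * g x \<partial>M)" and "c = (\<integral>x. (g x)\<^sup>2 \<partial>M)"
  have quad: "0 \<le> a + 2 * l * b + l\<^sup>2 * c" for l
  proof -
    have "0 \<le> (\<integral>x. (f x + l * g x)\<^sup>2 \<partial>M)" by simp
    also have "\<dots> = (\<integral>x. (f x)\<^sup>2 + 2 * l * (f x * g x) + l\<^sup>2 * (g x)\<^sup>2 \<partial>M)"
      by (rule Bochner_Integration.integral_cong) (auto simp: power2_eq_square algebra_simps)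
    also have "\<dots> = a + 2 * l * b + l\<^sup>2 * c"
      using assms square_integrable_mult[OF assms] by (simp add: square_integrable_def a_def b_def c_def)
    finally show ?thesis .
  qed
  have nn: "0 \<le> a" "0 \<le> c" by (auto simp: a_def c_def)
  have "b\<^sup>2 \<le> a * c"
  proof (cases "c = 0")
    case True
    have "b = 0"
    proof (rule ccontr)
      assume "b \<noteq> 0"
      \<comment> \<open>For \<open>c = 0\<close> the polynomial is affine in \<open>l\<close>, and
        this \<open>l\<close> gives it the value -1.\<close>
      with quad[of "-(a + 1) / (2 * b)"] True show False by (simp add: field_simps)
    qed
    then show ?thesis using nn by simp
  next
    case False
    with nn have "c > 0" by simp
    with quad[of "- b / c"] show ?thesis
      by (simp add: field_simps power2_eq_square)
  qed
  then have "\<bar>b\<bar> \<le> sqrt (a * c)"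
    by (metis real_sqrt_abs real_sqrt_le_mono)
  then show ?thesis by (simp add: real_sqrt_mult a_def b_def c_def)
qed

text \<open>The best approximation of \<open>\<xi>\<close> by test functions \<open>V\<close> with \<open>\<integral> U\<^sub>n V \<longrightarrow> 0\<close> leaves a residual that
  is almost orthogonal to every \<open>U\<^sub>n\<close>, since the \<open>U\<^sub>n\<close> are themselves such test functions.\<close>

lemma asymptotically_orthogonal_weakly_null:
  fixes U :: "nat \<Rightarrow> 'a \<Rightarrow> real"
  assumes U: "\<And>n. square_integrable M (U n)" and B: "\<And>n. (\<integral>x. (U n x)\<^sup>2 \<partial>M) \<le> B"
    and orth: "\<And>m. (\<lambda>n. \<integral>x. U n x * U m x \<partial>M) \<longlonglongrightarrow> 0"
    and \<xi>: "square_integrable M \<xi>"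
  shows "(\<lambda>n. \<integral>x. U n x * \<xi> x \<partial>M) \<longlonglongrightarrow> 0"
proof (rule LIMSEQ_I)
  fix r :: real assume r: "0 < r"
  define C where "C = max B 1"
  have C: "0 < C" "\<And>n. (\<integral>x. (U n x)\<^sup>2 \<partial>M) \<le> C"
    using B by (auto simp: C_def le_max_iff_disj)
  define W where "W = {V. square_integrable M V \<and> (\<lambda>n. \<integral>x. U n x * V x \<partial>M) \<longlonglongrightarrow> 0}"
  define D where "D V = (\<integral>x. (\<xi> x - V x)\<^sup>2 \<partial>M)" for V
  define d where "d = (INF V\<in>W. D V)"
  have W0: "(\<lambda>x. 0) \<in> W" by (simp add: W_def square_integrable_def)
  have bdd: "bdd_below (D ` W)" by (rule bdd_belowI[of _ 0]) (auto simp: D_def)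
  \<comment> \<open>The infimum \<open>d\<close> need not be attained. A minimiser up to this slack
    suffices: with p the inner product of \<open>U m\<close> and the residual, a step of length p /
    C along \<open>U m\<close> lowers \<open>D\<close> by at least p^2 / C, so p^2 is at most (r /
    2)^2. The bound \<open>B\<close> may be 0, hence \<open>C\<close>.\<close>
  have "(r / 2)\<^sup>2 / C > 0" using r C by simp
  then have "\<exists>V\<in>W. D V < d + (r / 2)\<^sup>2 / C"
    using cINF_less_iff[OF _ bdd, of "d + (r / 2)\<^sup>2 / C"] W0 by (auto simp: d_def)
  then obtain V where V: "V \<in> W" and DV: "D V < d + (r / 2)\<^sup>2 / C" by auto
  have sV: "square_integrable M V" and VU: "(\<lambda>n. \<integral>x. U n x * V x \<partial>M) \<longlonglongrightarrow> 0"
    using V by (auto simp: W_def)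
  have sD: "square_integrable M (\<lambda>x. \<xi> x - V x)" by (rule square_integrable_diff[OF \<xi> sV])
  have small: "\<bar>\<integral>x. U m x * (\<xi> x - V x) \<partial>M\<bar> \<le> r / 2" for m
  proof -
    define p where "p = (\<integral>x. U m x * (\<xi> x - V x) \<partial>M)"
    have "(\<lambda>x. V x + l * U m x) \<in> W" for l
    proof -
      have "(\<integral>x. U n x * (V x + l * U m x) \<partial>M) = (\<integral>x. U n x * V x \<partial>M) + l * (\<integral>x. U n x * U m x \<partial>M)" for n
        using square_integrable_mult[OF U[of n] sV] square_integrable_mult[OF U[of n] U[of m]]
        by (simp add: algebra_simps)
      moreover have "(\<lambda>n. (\<integral>x. U n x * V x \<partial>M) + l * (\<integral>x. U n x * U m x \<partial>M)) \<longlonglongrightarrow> 0 + l * 0"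
        by (intro tendsto_intros VU orth)
      ultimately show ?thesis
        using square_integrable_lincomb[OF sV U] by (auto simp: W_def)
    qed
    then have "d \<le> D (\<lambda>x. V x + l * U m x)" for l
      unfolding d_def by (intro cINF_lower bdd)
    also have "D (\<lambda>x. V x + l * U m x) = D V - 2 * l * p + l\<^sup>2 * (\<integral>x. (U m x)\<^sup>2 \<partial>M)" for l
    proof -
      have "D (\<lambda>x. V x + l * U m x) =
          (\<integral>x. (\<xi> x - V x)\<^sup>2 - 2 * l * (U m x * (\<xi> x - V x)) + l\<^sup>2 * (U m x)\<^sup>2 \<partial>M)"
        unfolding D_def by (rule Bochner_Integration.integral_cong) (auto simp: power2_eq_square algebra_simps)
      then show ?thesis
        using sD U[of m] square_integrable_mult[OF U[of m] sD] by (simp add: square_integrable_def D_def p_def)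
    qed
    also have "\<dots> l \<le> D V - 2 * l * p + l\<^sup>2 * C" for l
      using C by (simp add: mult_left_mono)
    finally have "0 \<le> (r / 2)\<^sup>2 / C - 2 * l * p + l\<^sup>2 * C" for l
      using DV by (smt (verit))
    from this[of "p / C"] C have "p\<^sup>2 \<le> (r / 2)\<^sup>2"
      by (simp add: field_simps power2_eq_square)
    then show ?thesis using r by (simp add: p_def abs_le_square_iff[symmetric])
  qed
  from LIMSEQ_D[OF VU, of "r / 2"] r obtain N
    where N: "\<And>n. n \<ge> N \<Longrightarrow> \<bar>\<integral>x. U n x * V x \<partial>M\<bar> < r / 2" by auto
  have "norm ((\<integral>x. U n x * \<xi> x \<partial>M) - 0) < r" if "n \<ge> N" for n
  proof -
    have "(\<integral>x. U n x * \<xi> x \<partial>M) = (\<integral>x. U n x * V x \<partial>M) + (\<integral>x. U n x * (\<xi> x - V x) \<partial>M)"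
      using square_integrable_mult[OF U[of n] sV] square_integrable_mult[OF U[of n] sD]
      by (subst Bochner_Integration.integral_add[symmetric]) (auto simp: algebra_simps)
    then show ?thesis using small[of n] N[OF that] by simp
  qed
  then show "\<exists>N. \<forall>n\<ge>N. norm ((\<integral>x. U n x * \<xi> x \<partial>M) - 0) < r" by blast
qed

section \<open>Second-order expansion of the complex exponential\<close>

lemma cmod_damped_factor_le_1:
  fixes x :: real
  shows "cmod ((1 + \<i> * x) * exp (- x\<^sup>2 / 2)) \<le> 1"
proof -
  have "1 + x\<^sup>2 \<le> exp (x\<^sup>2)" by (rule exp_ge_add_one_self)
  also have "\<dots> = (exp (x\<^sup>2 / 2))\<^sup>2" by (simp add: power2_eq_square flip: exp_add)
  finally have "sqrt (1 + x\<^sup>2) \<le> exp (x\<^sup>2 / 2)" by (simp add: real_le_lsqrt)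
  moreover have "cmod (1 + \<i> * x) = sqrt (1 + x\<^sup>2)" by (simp add: cmod_def)
  ultimately show ?thesis
    unfolding norm_mult norm_of_real by (simp add: exp_minus field_simps)
qed

text \<open>Near 0 the remainder is of third order; for |x| > 1 both terms lie in the unit disk and
  2 is bound enough. The minimum with 1 keeps the bound quadratic, so it is integrable for
  increments with second moments only.\<close>

lemma iexp_remainder_bound:
  fixes x :: real
  shows "cmod (iexp x - (1 + \<i> * x) * exp (- x\<^sup>2 / 2)) \<le> 2 * (x\<^sup>2 * min \<bar>x\<bar> 1)"
proof (cases "\<bar>x\<bar> \<le> 1")
  case True
  define y where "y = x\<^sup>2 / 2"
  define e where "e = exp (- y) - 1 + y"
  have y: "0 \<le> y" "y \<le> 1 / 2" using True by (auto simp: y_def abs_square_le_1)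
  have x3: "x\<^sup>2 * x\<^sup>2 \<le> \<bar>x\<bar> ^ 3"
  proof -
    have "x\<^sup>2 * x\<^sup>2 = \<bar>x\<bar> ^ 3 * \<bar>x\<bar>"
      by (simp add: power2_eq_square power3_eq_cube flip: abs_mult)
    also have "\<dots> \<le> \<bar>x\<bar> ^ 3 * 1" by (intro mult_left_mono True) simp
    finally show ?thesis by simp
  qed
  have "0 \<le> e" using exp_ge_add_one_self[of "- y"] by (simp add: e_def)
  moreover have "e \<le> y\<^sup>2"
  proof -
    have "exp (- y) * (1 + y) \<le> exp (- y) * exp y" by (intro mult_left_mono exp_ge_add_one_self) simp
    then have "exp (- y) \<le> 1 / (1 + y)" using y by (simp add: field_simps exp_minus)
    also have "\<dots> \<le> 1 - y + y\<^sup>2" using y by (simp add: field_simps power2_eq_square power3_eq_cube)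
    finally show ?thesis by (simp add: e_def)
  qed
  ultimately have e: "\<bar>e\<bar> \<le> \<bar>x\<bar> ^ 3 / 4"
    using x3 by (simp add: y_def power2_eq_square field_simps)
  \<comment> \<open>With y = x^2 / 2 and exp(-y) = 1 - y + e, the product (1 + ix)(1 - y) is the
    second Taylor polynomial of exp(ix) minus i x^3 / 2. This leaves a Taylor remainder, the cubic
    term and the term with \<open>e\<close>.\<close>
  have "iexp x - (1 + \<i> * x) * exp (- x\<^sup>2 / 2)
      = (iexp x - (\<Sum>k\<le>2. (\<i> * x) ^ k / fact k)) + \<i> * (x ^ 3 / 2) - (1 + \<i> * x) * e"
    by (simp add: e_def y_def numeral_2_eq_2 power2_eq_square power3_eq_cube field_simps)
  also have "cmod \<dots> \<le> \<bar>x\<bar> ^ 3 / 6 + \<bar>x\<bar> ^ 3 / 2 + 2 * (\<bar>x\<bar> ^ 3 / 4)"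
  proof -
    have "cmod (iexp x - (\<Sum>k\<le>2. (\<i> * x) ^ k / fact k)) \<le> \<bar>x\<bar> ^ 3 / 6"
      using iexp_approx1[of x 2] by (simp add: eval_nat_numeral)
    moreover have "cmod (\<i> * complex_of_real (x ^ 3 / 2)) \<le> \<bar>x\<bar> ^ 3 / 2"
      by (simp add: norm_mult norm_power norm_divide)
    moreover have "cmod ((1 + \<i> * x) * e) \<le> 2 * (\<bar>x\<bar> ^ 3 / 4)"
    proof -
      have "cmod (1 + \<i> * x) \<le> 2"
        using norm_triangle_ineq[of 1 "\<i> * x"] True by (simp add: norm_mult)
      then show ?thesis
        unfolding norm_mult using e by (intro mult_mono) auto
    qed
    ultimately show ?thesis
      by (rule order_trans[OF norm_triangle_ineq4 add_mono[OF order_trans[OF norm_triangle_ineq add_mono]]])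
  qed
  also have "\<dots> \<le> 2 * \<bar>x\<bar> ^ 3" by simp
  finally show ?thesis using True by (simp add: power2_eq_square power3_eq_cube)
next
  case False
  then have x: "1 \<le> \<bar>x\<bar>" by simp
  have "cmod (iexp x - (1 + \<i> * x) * exp (- x\<^sup>2 / 2)) \<le> 1 + 1"
    using cmod_damped_factor_le_1[of x]
    by (intro order_trans[OF norm_triangle_ineq4] add_mono) auto
  also have "\<dots> \<le> 2 * x\<^sup>2" using power_mono[OF x, of 2] by simp
  finally show ?thesis using x by simp
qed

section \<open>McLeish's product for stopped martingale differences\<close>

text \<open>Indices start at 0: \<open>F k\<close> is the information available before
  \<open>z k\<close>, with \<open>z j\<close> adapted for j < k. The martingale property
  \<open>centered\<close> is put in integrated form, for every \<open>F k\<close>-measurable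
  multiplier, bounded or not, whose product with \<open>z k\<close> is integrable.\<close>

locale martingale_differences = prob_space M for M :: "'a measure" +
  fixes F :: "nat \<Rightarrow> 'a measure" and z :: "nat \<Rightarrow> 'a \<Rightarrow> real"
  assumes subalg: "\<And>k. subalgebra M (F k)"
    and filtration: "\<And>k l. k \<le> l \<Longrightarrow> subalgebra (F l) (F k)"
    and adapted: "\<And>j k. j < k \<Longrightarrow> z j \<in> borel_measurable (F k)"
    and sq: "\<And>k. square_integrable M (z k)"
    and same_law: "\<And>k. distr M borel (z k) = distr M borel (z 0)"
    and centered: "\<And>k B. B \<in> borel_measurable (F k) \<Longrightarrow> integrable M (\<lambda>\<omega>. B \<omega> * z k \<omega>) \<Longrightarrow>
      (\<integral>\<omega>. B \<omega> * z k \<omega> \<partial>M) = 0"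
begin

lemma z_measurable [measurable]: "z k \<in> borel_measurable M"
  using sq by (simp add: square_integrable_def)

lemma integrable_z2 [simp]: "integrable M (\<lambda>\<omega>. (z k \<omega>)\<^sup>2)"
  using sq by (simp add: square_integrable_def)

lemma expectation_z_transfer:
  assumes "g \<in> borel_measurable borel"
  shows "(\<integral>\<omega>. g (z k \<omega>) \<partial>M) = (\<integral>\<omega>. (g (z 0 \<omega>) :: real) \<partial>M)"
  using integral_distr[OF z_measurable assms] same_law by metis

definition qv :: "nat \<Rightarrow> 'a \<Rightarrow> real" where
  "qv k \<omega> = (\<Sum>j<k. (z j \<omega>)\<^sup>2)"

lemma qv_nonneg: "0 \<le> qv k \<omega>"
  by (simp add: qv_def sum_nonneg)

lemma qv_mono: "j \<le> k \<Longrightarrow> qv j \<omega> \<le> qv k \<omega>"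
  unfolding qv_def by (rule sum_mono2) auto

lemma qv_measurable [measurable]: "qv k \<in> borel_measurable M"
  unfolding qv_def by measurable

lemma qv_adapted: "j \<le> k \<Longrightarrow> qv j \<in> borel_measurable (F k)"
  unfolding qv_def[abs_def] by (intro borel_measurable_sum borel_measurable_power adapted) auto

lemma integrable_qv [simp]: "integrable M (qv k)"
  unfolding qv_def[abs_def] by simp

lemma expectation_qv: "expectation (qv k) = real k * (\<integral>\<omega>. (z 0 \<omega>)\<^sup>2 \<partial>M)"
proof -
  have "(\<integral>\<omega>. (z j \<omega>)\<^sup>2 \<partial>M) = (\<integral>\<omega>. (z 0 \<omega>)\<^sup>2 \<partial>M)" for j
    by (rule expectation_z_transfer) simp
  then have "(\<Sum>j<k. \<integral>\<omega>. (z j \<omega>)\<^sup>2 \<partial>M) = (\<Sum>j<k. \<integral>\<omega>. (z 0 \<omega>)\<^sup>2 \<partial>M)"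
    by (intro sum.cong refl)
  then show ?thesis by (simp add: qv_def[abs_def])
qed

text \<open>The increments are switched off once the quadratic variation exceeds \<open>n * C\<close>: this keeps McLeish's
  product bounded in \<open>L\<^sup>2\<close>.\<close>

definition stopped :: "real \<Rightarrow> real \<Rightarrow> nat \<Rightarrow> nat \<Rightarrow> 'a \<Rightarrow> real" where
  "stopped t C n k \<omega> = (if qv k \<omega> \<le> real n * C then t / sqrt (real n) * z k \<omega> else 0)"

definition mcleish :: "real \<Rightarrow> real \<Rightarrow> nat \<Rightarrow> nat \<Rightarrow> 'a \<Rightarrow> complex" where
  "mcleish t C n k \<omega> = (\<Prod>j<k. 1 + \<i> * stopped t C n j \<omega>)"

lemma stopped_adapted: "j < k \<Longrightarrow> stopped t C n j \<in> borel_measurable (F k)"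
proof -
  assume "j < k"
  then have [measurable]: "qv j \<in> borel_measurable (F k)" "z j \<in> borel_measurable (F k)"
    by (auto intro: qv_adapted adapted)
  show ?thesis unfolding stopped_def[abs_def] by measurable
qed

lemma mcleish_adapted: "mcleish t C n k \<in> borel_measurable (F k)"
  unfolding mcleish_def[abs_def]
proof (rule borel_measurable_prod)
  fix j assume "j \<in> {..<k}"
  then have [measurable]: "stopped t C n j \<in> borel_measurable (F k)" by (auto intro: stopped_adapted)
  show "(\<lambda>\<omega>. 1 + \<i> * stopped t C n j \<omega>) \<in> borel_measurable (F k)" by measurable
qed

lemma stopped_measurable [measurable]: "stopped t C n k \<in> borel_measurable M"
  unfolding stopped_def[abs_def] by measurable

lemma mcleish_measurable [measurable]: "mcleish t C n k \<in> borel_measurable M"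
  using mcleish_adapted subalg by (rule measurable_from_subalg[rotated])

lemma cmod_mcleish_power2: "(cmod (mcleish t C n k \<omega>))\<^sup>2 = (\<Prod>j<k. 1 + (stopped t C n j \<omega>)\<^sup>2)"
proof -
  have "(cmod (1 + \<i> * complex_of_real x))\<^sup>2 = 1 + x\<^sup>2" for x by (simp add: cmod_def)
  then show ?thesis by (simp add: mcleish_def prod_norm[symmetric] prod_power_distrib)
qed

lemma stopped_power2_le: "(stopped t C n k \<omega>)\<^sup>2 \<le> t\<^sup>2 / real n * (z k \<omega>)\<^sup>2"
  by (simp add: stopped_def power_mult_distrib power_divide)

lemma cmod_mcleish_le_exp:
  assumes "0 \<le> C" "qv k \<omega> \<le> real n * C"
  shows "(cmod (mcleish t C n k \<omega>))\<^sup>2 \<le> exp (t\<^sup>2 * C)"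
\<comment> \<open>For \<open>n = 0\<close> division by zero makes \<open>t / sqrt 0 = 0\<close>, so
  every factor of the product is 1.\<close>
proof (cases "n = 0")
  case True
  then show ?thesis
    using assms(1) by (simp add: mcleish_def stopped_def cong: if_cong)
next
  case False
  have "(cmod (mcleish t C n k \<omega>))\<^sup>2 \<le> (\<Prod>j<k. exp (t\<^sup>2 / real n * (z j \<omega>)\<^sup>2))"
    unfolding cmod_mcleish_power2
    using stopped_power2_le
    by (intro prod_mono conjI) (auto intro: order_trans[OF exp_ge_add_one_self])
  also have "\<dots> = exp (t\<^sup>2 / real n * qv k \<omega>)"
    by (simp add: exp_sum[symmetric] qv_def sum_distrib_left)
  also have "\<dots> \<le> exp (t\<^sup>2 / real n * (real n * C))"
    unfolding exp_le_cancel_iff by (intro mult_left_mono assms) auto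
  finally show ?thesis using False by simp
qed

text \<open>\<open>stopped\<close> tests the quadratic variation before the current increment, so
  that the switch is known at that time; hence one increment may overshoot the threshold. The
  factors before it contribute at most exp(t^2 C), later ones equal 1, and the overshooting factor
  alone accounts for the term linear in \<open>qv\<close>, which is integrable.\<close>

lemma cmod_mcleish_power2_le:
  assumes "0 \<le> C"
  shows "(cmod (mcleish t C n k \<omega>))\<^sup>2 \<le> exp (t\<^sup>2 * C) * (1 + t\<^sup>2 * (qv k \<omega> / real n))"
proof (induction k)
  case 0
  show ?case using assms by (simp add: mcleish_def qv_def)
next
  case (Suc k)
  have eq: "(cmod (mcleish t C n (Suc k) \<omega>))\<^sup>2 = (cmod (mcleish t C n k \<omega>))\<^sup>2 * (1 + (stopped t C n k \<omega>)\<^sup>2)"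
    by (simp add: cmod_mcleish_power2)
  have qs: "qv (Suc k) \<omega> = qv k \<omega> + (z k \<omega>)\<^sup>2" by (simp add: qv_def)
  show ?case
  proof (cases "qv k \<omega> \<le> real n * C")
    case True
    have "(stopped t C n k \<omega>)\<^sup>2 \<le> t\<^sup>2 * (qv (Suc k) \<omega> / real n)"
      by (rule order_trans[OF stopped_power2_le])
        (auto simp: qs algebra_simps add_divide_distrib qv_nonneg)
    then show ?thesis
      unfolding eq using cmod_mcleish_le_exp[OF assms True] by (intro mult_mono) auto
  next
    case False
    then have "stopped t C n k \<omega> = 0" by (simp add: stopped_def)
    then have "(cmod (mcleish t C n (Suc k) \<omega>))\<^sup>2 \<le> exp (t\<^sup>2 * C) * (1 + t\<^sup>2 * (qv k \<omega> / real n))"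
      using Suc by (simp add: eq)
    also have "\<dots> \<le> exp (t\<^sup>2 * C) * (1 + t\<^sup>2 * (qv (Suc k) \<omega> / real n))"
      by (intro mult_left_mono add_left_mono divide_right_mono) (auto simp: qs)
    finally show ?thesis .
  qed
qed

lemma square_integrable_mcleish:
  assumes "0 \<le> C"
  shows "square_integrable M (\<lambda>\<omega>. Re (mcleish t C n k \<omega>))" "square_integrable M (\<lambda>\<omega>. Im (mcleish t C n k \<omega>))"
    "integrable M (\<lambda>\<omega>. (cmod (mcleish t C n k \<omega>))\<^sup>2)"
proof -
  have i: "integrable M (\<lambda>\<omega>. exp (t\<^sup>2 * C) * (1 + t\<^sup>2 * (qv k \<omega> / real n)))" by simp
  show n: "integrable M (\<lambda>\<omega>. (cmod (mcleish t C n k \<omega>))\<^sup>2)"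
    using cmod_mcleish_power2_le[OF assms] qv_nonneg
    by (intro Bochner_Integration.integrable_bound[OF i]) auto
  have "integrable M (\<lambda>\<omega>. (Re (mcleish t C n k \<omega>))\<^sup>2)" "integrable M (\<lambda>\<omega>. (Im (mcleish t C n k \<omega>))\<^sup>2)"
    by (rule Bochner_Integration.integrable_bound[OF n]; simp add: cmod_power2)+
  then show "square_integrable M (\<lambda>\<omega>. Re (mcleish t C n k \<omega>))" "square_integrable M (\<lambda>\<omega>. Im (mcleish t C n k \<omega>))"
    by (simp_all add: square_integrable_def)
qed

lemma expectation_mcleish_le:
  assumes "0 \<le> C"
  shows "(\<integral>\<omega>. (cmod (mcleish t C n n \<omega>))\<^sup>2 \<partial>M) \<le> exp (t\<^sup>2 * C) * (1 + t\<^sup>2 * (\<integral>\<omega>. (z 0 \<omega>)\<^sup>2 \<partial>M))"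
proof -
  have "(\<integral>\<omega>. (cmod (mcleish t C n n \<omega>))\<^sup>2 \<partial>M) \<le> (\<integral>\<omega>. exp (t\<^sup>2 * C) * (1 + t\<^sup>2 * (qv n \<omega> / real n)) \<partial>M)"
    using cmod_mcleish_power2_le[OF assms] square_integrable_mcleish(3)[OF assms]
    by (intro integral_mono) auto
  also have "\<dots> = exp (t\<^sup>2 * C) * (1 + t\<^sup>2 * (expectation (qv n) / real n))"
    by (simp add: prob_space)
  also have "\<dots> \<le> exp (t\<^sup>2 * C) * (1 + t\<^sup>2 * (\<integral>\<omega>. (z 0 \<omega>)\<^sup>2 \<partial>M))"
    by (intro mult_left_mono add_left_mono) (auto simp: expectation_qv)
  finally show ?thesis .
qed

text \<open>\<open>R\<close> will be a real or imaginary part of the product, which is bounded only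
  while the threshold holds. Elsewhere the stopped increment vanishes, so \<open>R\<close> may be
  replaced by its cut-off \<open>R'\<close>; then V R' is square integrable and
  \<open>centered\<close> applies.\<close>

lemma stopped_orthogonal:
  assumes V: "square_integrable M V" "V \<in> borel_measurable (F k)"
    and R: "R \<in> borel_measurable (F k)" "\<And>\<omega>. qv k \<omega> \<le> real n * C \<Longrightarrow> \<bar>R \<omega>\<bar> \<le> c"
  shows "integrable M (\<lambda>\<omega>. V \<omega> * (R \<omega> * stopped t C n k \<omega>))" "(\<integral>\<omega>. V \<omega> * (R \<omega> * stopped t C n k \<omega>) \<partial>M) = 0"
proof -
  define R' where "R' \<omega> = (if qv k \<omega> \<le> real n * C then R \<omega> else 0)" for \<omega>
  have [measurable]: "R \<in> borel_measurable (F k)" "qv k \<in> borel_measurable (F k)" "V \<in> borel_measurable (F k)"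
    using V R by (auto intro: qv_adapted)
  have R'F [measurable]: "R' \<in> borel_measurable (F k)" unfolding R'_def by measurable
  then have R'M: "R' \<in> borel_measurable M" by (rule measurable_from_subalg[OF subalg])
  have eq: "V \<omega> * (R \<omega> * stopped t C n k \<omega>) = (t / sqrt (real n) * (V \<omega> * R' \<omega>)) * z k \<omega>" for \<omega>
    by (simp add: R'_def stopped_def)
  have "\<bar>R' \<omega>\<bar> \<le> max c 0" for \<omega> using R(2)[of \<omega>] by (auto simp: R'_def)
  then have "square_integrable M (\<lambda>\<omega>. V \<omega> * R' \<omega>)"
    by (intro square_integrable_bounded_mult[OF V(1) R'M])
  from square_integrable_mult[OF this sq[of k]]
  have "integrable M (\<lambda>\<omega>. t / sqrt (real n) * ((V \<omega> * R' \<omega>) * z k \<omega>))" by (rule integrable_mult_right)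
  then show i: "integrable M (\<lambda>\<omega>. V \<omega> * (R \<omega> * stopped t C n k \<omega>))"
    unfolding eq by (simp add: mult.assoc)
  show "(\<integral>\<omega>. V \<omega> * (R \<omega> * stopped t C n k \<omega>) \<partial>M) = 0"
    using i unfolding eq by (intro centered) auto
qed

lemma abs_Re_Im_mcleish_le:
  assumes "0 \<le> C" "qv k \<omega> \<le> real n * C"
  shows "\<bar>Re (mcleish t C n k \<omega>)\<bar> \<le> sqrt (exp (t\<^sup>2 * C))" "\<bar>Im (mcleish t C n k \<omega>)\<bar> \<le> sqrt (exp (t\<^sup>2 * C))"
  using real_le_rsqrt[OF cmod_mcleish_le_exp[OF assms, of t]] abs_Re_le_cmod[of "mcleish t C n k \<omega>"]
    abs_Im_le_cmod[of "mcleish t C n k \<omega>"] by linarith+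

text \<open>The factor 1 + i s, with s the stopped increment at \<open>k\<close>, changes the real
  part by -Im s and the imaginary part by Re s, taken of the product so far. Both changes are
  orthogonal to \<open>V\<close> by \<open>stopped_orthogonal\<close>, since \<open>V\<close>
  remains measurable at time \<open>k\<close>.\<close>

lemma mcleish_martingale:
  assumes C: "0 \<le> C" and V: "square_integrable M V" "V \<in> borel_measurable (F m)" and "m \<le> k"
  shows "(\<integral>\<omega>. V \<omega> * Re (mcleish t C n k \<omega>) \<partial>M) = (\<integral>\<omega>. V \<omega> * Re (mcleish t C n m \<omega>) \<partial>M) \<and>
    (\<integral>\<omega>. V \<omega> * Im (mcleish t C n k \<omega>) \<partial>M) = (\<integral>\<omega>. V \<omega> * Im (mcleish t C n m \<omega>) \<partial>M)"
  using \<open>m \<le> k\<close>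
proof (induction k rule: dec_induct)
  case (step k)
  note si = square_integrable_mcleish[OF C, of t n k]
  have VF: "V \<in> borel_measurable (F k)"
    using filtration[OF step.hyps(1)] V(2) by (rule measurable_from_subalg)
  have [measurable]: "mcleish t C n k \<in> borel_measurable (F k)" by (rule mcleish_adapted)
  have ReIm: "(\<lambda>\<omega>. Re (mcleish t C n k \<omega>)) \<in> borel_measurable (F k)"
    "(\<lambda>\<omega>. Im (mcleish t C n k \<omega>)) \<in> borel_measurable (F k)" by measurable
  have S: "mcleish t C n (Suc k) \<omega> = mcleish t C n k \<omega> * (1 + \<i> * stopped t C n k \<omega>)" for \<omega>
    by (simp add: mcleish_def)
  note oR = stopped_orthogonal[OF V(1) VF ReIm(1) abs_Re_Im_mcleish_le(1)[OF C], where t=t]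
  note oI = stopped_orthogonal[OF V(1) VF ReIm(2) abs_Re_Im_mcleish_le(2)[OF C], where t=t]
  have "(\<integral>\<omega>. V \<omega> * Re (mcleish t C n (Suc k) \<omega>) \<partial>M) =
      (\<integral>\<omega>. V \<omega> * Re (mcleish t C n k \<omega>) - V \<omega> * (Im (mcleish t C n k \<omega>) * stopped t C n k \<omega>) \<partial>M)"
    by (simp add: S algebra_simps)
  moreover have "(\<integral>\<omega>. V \<omega> * Im (mcleish t C n (Suc k) \<omega>) \<partial>M) =
      (\<integral>\<omega>. V \<omega> * Im (mcleish t C n k \<omega>) + V \<omega> * (Re (mcleish t C n k \<omega>) * stopped t C n k \<omega>) \<partial>M)"
    by (simp add: S algebra_simps)
  ultimately show ?case
    using step.IH square_integrable_mult[OF V(1) si(1)] square_integrable_mult[OF V(1) si(2)] oR oI by simp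
qed auto

lemma mcleish_tendsto_1:
  "(\<lambda>n. mcleish t C n m \<omega>) \<longlonglongrightarrow> 1"
proof -
  have "(\<lambda>n. stopped t C n j \<omega>) \<longlonglongrightarrow> 0" for j
  proof (rule Lim_null_comparison)
    show "\<forall>\<^sub>F n in sequentially. norm (stopped t C n j \<omega>) \<le> \<bar>t * z j \<omega>\<bar> * inverse (sqrt (real n))"
      by (auto simp: stopped_def abs_mult divide_inverse)
    show "(\<lambda>n. \<bar>t * z j \<omega>\<bar> * inverse (sqrt (real n))) \<longlonglongrightarrow> 0"
      by (intro tendsto_mult_right_zero tendsto_inverse_0_at_top
          filterlim_compose[OF sqrt_at_top filterlim_real_sequentially])
  qed
  then have "(\<lambda>n. \<Prod>j<m. 1 + \<i> * stopped t C n j \<omega>) \<longlonglongrightarrow> (\<Prod>j<m. 1 + \<i> * complex_of_real 0)"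
    by (intro tendsto_prod tendsto_intros)
  then show ?thesis by (simp add: mcleish_def)
qed

text \<open>The number \<open>m\<close> of factors is fixed while the normalisation \<open>n\<close>
  grows, so each factor tends to 1. A single dominating function exists because qv m / n is at most
  qv m, also for \<open>n = 0\<close>, where the quotient is 0. Together with
  \<open>mcleish_martingale\<close> this determines the limit of the full product against
  \<open>F m\<close>-measurable test functions.\<close>

lemma mcleish_adapted_limit:
  assumes C: "0 \<le> C" and V: "square_integrable M V"
  shows "(\<lambda>n. \<integral>\<omega>. V \<omega> * Re (mcleish t C n m \<omega>) \<partial>M) \<longlonglongrightarrow> (\<integral>\<omega>. V \<omega> \<partial>M)"
    and "(\<lambda>n. \<integral>\<omega>. V \<omega> * Im (mcleish t C n m \<omega>) \<partial>M) \<longlonglongrightarrow> 0"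
proof -
  have [measurable]: "V \<in> borel_measurable M" and V2: "integrable M (\<lambda>\<omega>. (V \<omega>)\<^sup>2)"
    using V by (auto simp: square_integrable_def)
  define w where "w \<omega> = (V \<omega>)\<^sup>2 + exp (t\<^sup>2 * C) * (1 + t\<^sup>2 * qv m \<omega>)" for \<omega>
  have w: "integrable M w" using V2 by (simp add: w_def[abs_def])
  have dom: "\<bar>V \<omega> * y\<bar> \<le> w \<omega>" if "\<bar>y\<bar> \<le> cmod (mcleish t C n m \<omega>)" for n y \<omega>
  proof -
    have "\<bar>V \<omega> * y\<bar> \<le> (V \<omega>)\<^sup>2 + y\<^sup>2"
      using sum_squares_bound[of "\<bar>V \<omega>\<bar>" "\<bar>y\<bar>"] zero_le_mult_iff[of "\<bar>V \<omega>\<bar>" "\<bar>y\<bar>"]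
      unfolding abs_mult power2_abs by linarith
    also have "y\<^sup>2 \<le> (cmod (mcleish t C n m \<omega>))\<^sup>2"
      using power_mono[OF that, of 2] by simp
    also have "\<dots> \<le> exp (t\<^sup>2 * C) * (1 + t\<^sup>2 * (qv m \<omega> / real n))"
      by (rule cmod_mcleish_power2_le[OF C])
    also have "\<dots> \<le> exp (t\<^sup>2 * C) * (1 + t\<^sup>2 * qv m \<omega>)"
    proof (intro mult_left_mono add_left_mono)
      show "qv m \<omega> / real n \<le> qv m \<omega>"
        using qv_nonneg[of m \<omega>] mult_right_mono[of 1 "real n" "qv m \<omega>"] by (cases "n = 0") (auto simp: field_simps)
    qed auto
    finally show ?thesis by (simp add: w_def)
  qed
  have "(\<lambda>n. \<integral>\<omega>. V \<omega> * Re (mcleish t C n m \<omega>) \<partial>M) \<longlonglongrightarrow> (\<integral>\<omega>. V \<omega> * Re 1 \<partial>M)"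
  proof (rule integral_dominated_convergence[OF _ _ w])
    show "AE \<omega> in M. (\<lambda>n. V \<omega> * Re (mcleish t C n m \<omega>)) \<longlonglongrightarrow> V \<omega> * Re 1"
      by (intro AE_I2 tendsto_intros mcleish_tendsto_1)
    show "AE \<omega> in M. norm (V \<omega> * Re (mcleish t C n m \<omega>)) \<le> w \<omega>" for n
      unfolding real_norm_def by (intro AE_I2 dom[OF abs_Re_le_cmod])
  qed (simp_all add: w)
  moreover have "(\<lambda>n. \<integral>\<omega>. V \<omega> * Im (mcleish t C n m \<omega>) \<partial>M) \<longlonglongrightarrow> (\<integral>\<omega>. V \<omega> * Im 1 \<partial>M)"
  proof (rule integral_dominated_convergence[OF _ _ w])
    show "AE \<omega> in M. (\<lambda>n. V \<omega> * Im (mcleish t C n m \<omega>)) \<longlonglongrightarrow> V \<omega> * Im 1"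
      by (intro AE_I2 tendsto_intros mcleish_tendsto_1)
    show "AE \<omega> in M. norm (V \<omega> * Im (mcleish t C n m \<omega>)) \<le> w \<omega>" for n
      unfolding real_norm_def by (intro AE_I2 dom[OF abs_Im_le_cmod])
  qed (simp_all add: w)
  ultimately show "(\<lambda>n. \<integral>\<omega>. V \<omega> * Re (mcleish t C n m \<omega>) \<partial>M) \<longlonglongrightarrow> (\<integral>\<omega>. V \<omega> \<partial>M)"
    and "(\<lambda>n. \<integral>\<omega>. V \<omega> * Im (mcleish t C n m \<omega>) \<partial>M) \<longlonglongrightarrow> 0" by simp_all
qed

text \<open>The variables Re T_m - 1 and Im T_m are themselves square integrable and
  \<open>F m\<close>-measurable, so they are admissible test functions \<open>V\<close>. This
  provides the asymptotic orthogonality within each of the two sequences and releases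
  \<open>\<xi>\<close> from every adaptedness condition.\<close>

lemma mcleish_weak_limit_aux:
  assumes C: "0 \<le> C" and \<xi>: "square_integrable M \<xi>"
  shows "(\<lambda>n. \<integral>\<omega>. (Re (mcleish t C n n \<omega>) - 1) * \<xi> \<omega> \<partial>M) \<longlonglongrightarrow> 0"
    and "(\<lambda>n. \<integral>\<omega>. Im (mcleish t C n n \<omega>) * \<xi> \<omega> \<partial>M) \<longlonglongrightarrow> 0"
proof -
  note si = square_integrable_mcleish[OF C]
  have one: "square_integrable M (\<lambda>\<omega>. 1)" by (simp add: square_integrable_def)
  have siR: "square_integrable M (\<lambda>\<omega>. Re (mcleish t C n n \<omega>) - 1)" for n
    by (rule square_integrable_diff[OF si(1) one])
  define B where "B = exp (t\<^sup>2 * C) * (1 + t\<^sup>2 * (\<integral>\<omega>. (z 0 \<omega>)\<^sup>2 \<partial>M))"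
  have adR: "(\<lambda>\<omega>. Re (mcleish t C m m \<omega>) - 1) \<in> borel_measurable (F m)"
    and adI: "(\<lambda>\<omega>. Im (mcleish t C m m \<omega>)) \<in> borel_measurable (F m)" for m
    using mcleish_adapted[of t C m m] by measurable
  have orthR: "(\<lambda>n. \<integral>\<omega>. (Re (mcleish t C n n \<omega>) - 1) * V \<omega> \<partial>M) \<longlonglongrightarrow> 0"
    and orthI: "(\<lambda>n. \<integral>\<omega>. Im (mcleish t C n n \<omega>) * V \<omega> \<partial>M) \<longlonglongrightarrow> 0"
    if V: "square_integrable M V" "V \<in> borel_measurable (F m)" for V m
  proof -
    have "\<forall>\<^sub>F n in sequentially. (\<integral>\<omega>. V \<omega> * Re (mcleish t C n m \<omega>) \<partial>M) - (\<integral>\<omega>. V \<omega> \<partial>M) =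
        (\<integral>\<omega>. (Re (mcleish t C n n \<omega>) - 1) * V \<omega> \<partial>M)"
      using eventually_ge_at_top[of m]
    proof eventually_elim
      case (elim n)
      have "(\<integral>\<omega>. (Re (mcleish t C n n \<omega>) - 1) * V \<omega> \<partial>M) = (\<integral>\<omega>. V \<omega> * Re (mcleish t C n n \<omega>) - V \<omega> * 1 \<partial>M)"
        by (simp add: algebra_simps)
      also have "\<dots> = (\<integral>\<omega>. V \<omega> * Re (mcleish t C n n \<omega>) \<partial>M) - (\<integral>\<omega>. V \<omega> \<partial>M)"
        using square_integrable_mult[OF V(1) si(1)] square_integrable_mult[OF V(1) one] by simp
      finally show ?case using mcleish_martingale[OF C V elim] by simp
    qed
    moreover have "(\<lambda>n. (\<integral>\<omega>. V \<omega> * Re (mcleish t C n m \<omega>) \<partial>M) - (\<integral>\<omega>. V \<omega> \<partial>M)) \<longlonglongrightarrow> 0"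
      using tendsto_diff[OF mcleish_adapted_limit(1)[OF C V(1)] tendsto_const[of "\<integral>\<omega>. V \<omega> \<partial>M"]] by simp
    ultimately show "(\<lambda>n. \<integral>\<omega>. (Re (mcleish t C n n \<omega>) - 1) * V \<omega> \<partial>M) \<longlonglongrightarrow> 0"
      by (rule Lim_transform_eventually[rotated])
    have "\<forall>\<^sub>F n in sequentially. (\<integral>\<omega>. V \<omega> * Im (mcleish t C n m \<omega>) \<partial>M) =
        (\<integral>\<omega>. Im (mcleish t C n n \<omega>) * V \<omega> \<partial>M)"
      using eventually_ge_at_top[of m]
    proof eventually_elim
      case (elim n)
      show ?case using mcleish_martingale[OF C V elim] by (simp add: mult.commute)
    qed
    with mcleish_adapted_limit(2)[OF C V(1)]
    show "(\<lambda>n. \<integral>\<omega>. Im (mcleish t C n n \<omega>) * V \<omega> \<partial>M) \<longlonglongrightarrow> 0"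
      by (rule Lim_transform_eventually)
  qed
  have bound: "(\<integral>\<omega>. g \<omega> \<partial>M) \<le> 2 * B + 2" if "integrable M g" "\<And>\<omega>. g \<omega> \<le> 2 * (cmod (mcleish t C n n \<omega>))\<^sup>2 + 2" for g n
  proof -
    have "(\<integral>\<omega>. g \<omega> \<partial>M) \<le> (\<integral>\<omega>. 2 * (cmod (mcleish t C n n \<omega>))\<^sup>2 + 2 \<partial>M)"
      using that si(3) by (intro integral_mono) auto
    also have "\<dots> \<le> 2 * B + 2"
      using si(3)[of t n n] expectation_mcleish_le[OF C, of t n] by (simp add: prob_space B_def)
    finally show ?thesis .
  qed
  have BR: "(\<integral>\<omega>. (Re (mcleish t C n n \<omega>) - 1)\<^sup>2 \<partial>M) \<le> 2 * B + 2" for n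
  proof (rule bound)
    show "integrable M (\<lambda>\<omega>. (Re (mcleish t C n n \<omega>) - 1)\<^sup>2)"
      using siR by (simp add: square_integrable_def)
    have "(a - 1)\<^sup>2 \<le> 2 * a\<^sup>2 + 2" for a :: real
      using zero_le_power2[of "a + 1"] by (simp add: power2_eq_square algebra_simps)
    also have "2 * (Re c)\<^sup>2 + 2 \<le> 2 * (cmod c)\<^sup>2 + 2" for c by (simp add: cmod_power2)
    finally show "(Re (mcleish t C n n \<omega>) - 1)\<^sup>2 \<le> 2 * (cmod (mcleish t C n n \<omega>))\<^sup>2 + 2" for \<omega> .
  qed
  have BI: "(\<integral>\<omega>. (Im (mcleish t C n n \<omega>))\<^sup>2 \<partial>M) \<le> 2 * B + 2" for n
    by (rule bound[of _ n]) (use si(2) in \<open>auto simp: square_integrable_def cmod_power2\<close>)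
  show "(\<lambda>n. \<integral>\<omega>. (Re (mcleish t C n n \<omega>) - 1) * \<xi> \<omega> \<partial>M) \<longlonglongrightarrow> 0"
    by (rule asymptotically_orthogonal_weakly_null[OF siR BR _ \<xi>]) (rule orthR[OF siR adR])
  show "(\<lambda>n. \<integral>\<omega>. Im (mcleish t C n n \<omega>) * \<xi> \<omega> \<partial>M) \<longlonglongrightarrow> 0"
    by (rule asymptotically_orthogonal_weakly_null[OF si(2) BI _ \<xi>]) (rule orthI[OF si(2) adI])
qed

lemma integrable_mcleish_mult:
  assumes C: "0 \<le> C" and \<xi>: "square_integrable M \<xi>"
  shows "integrable M (\<lambda>\<omega>. \<xi> \<omega> * mcleish t C n k \<omega>)"
proof -
  note si = square_integrable_mcleish[OF C, of t n k]
  have "integrable M (\<lambda>\<omega>. complex_of_real (\<xi> \<omega> * Re (mcleish t C n k \<omega>)) + \<i> * complex_of_real (\<xi> \<omega> * Im (mcleish t C n k \<omega>)))"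
    using square_integrable_mult[OF \<xi> si(1)] square_integrable_mult[OF \<xi> si(2)]
    by (intro Bochner_Integration.integrable_add integrable_mult_right integrable_of_real)
  also have "(\<lambda>\<omega>. complex_of_real (\<xi> \<omega> * Re (mcleish t C n k \<omega>)) + \<i> * complex_of_real (\<xi> \<omega> * Im (mcleish t C n k \<omega>))) =
      (\<lambda>\<omega>. \<xi> \<omega> * mcleish t C n k \<omega>)"
    by (auto simp: complex_eq_iff)
  finally show ?thesis .
qed

lemma mcleish_weak_limit:
  assumes C: "0 \<le> C" and \<xi>: "square_integrable M \<xi>"
  shows "(\<lambda>n. \<integral>\<omega>. \<xi> \<omega> * mcleish t C n n \<omega> \<partial>M) \<longlonglongrightarrow> of_real (\<integral>\<omega>. \<xi> \<omega> \<partial>M)"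
proof -
  have i\<xi>: "integrable M \<xi>"
    by (rule integrable_of_square_integrable[OF \<xi>])
  have "Re (\<integral>\<omega>. \<xi> \<omega> * mcleish t C n n \<omega> \<partial>M) = (\<integral>\<omega>. (Re (mcleish t C n n \<omega>) - 1) * \<xi> \<omega> \<partial>M) + (\<integral>\<omega>. \<xi> \<omega> \<partial>M)" for n
    using i\<xi> square_integrable_mult[OF \<xi> square_integrable_mcleish(1)[OF C, of t n n]]
    by (subst integral_Re[symmetric]) (auto simp: integrable_mcleish_mult[OF assms] algebra_simps)
  moreover have "Im (\<integral>\<omega>. \<xi> \<omega> * mcleish t C n n \<omega> \<partial>M) = (\<integral>\<omega>. Im (mcleish t C n n \<omega>) * \<xi> \<omega> \<partial>M)" for n
    by (subst integral_Im[symmetric]) (auto simp: integrable_mcleish_mult[OF assms] algebra_simps)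
  ultimately show ?thesis
    using tendsto_add[OF mcleish_weak_limit_aux(1)[OF assms, of t] tendsto_const[of "\<integral>\<omega>. \<xi> \<omega> \<partial>M"]]
      mcleish_weak_limit_aux(2)[OF assms, of t]
    by (simp add: tendsto_complex_iff)
qed

text \<open>A smooth form of the Lindeberg condition. As all increments have the law of
  \<open>z 0\<close>, this one integral controls every remainder in the expansion of the
  exponential.\<close>

lemma lindeberg:
  "(\<lambda>n. \<integral>\<omega>. (z 0 \<omega>)\<^sup>2 * min \<bar>t / sqrt (real n) * z 0 \<omega>\<bar> 1 \<partial>M) \<longlonglongrightarrow> 0"
proof -
  have "(\<lambda>n. \<integral>\<omega>. (z 0 \<omega>)\<^sup>2 * min \<bar>t / sqrt (real n) * z 0 \<omega>\<bar> 1 \<partial>M) \<longlonglongrightarrow> (\<integral>\<omega>. (z 0 \<omega>)\<^sup>2 * min \<bar>0 * z 0 \<omega>\<bar> 1 \<partial>M)"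
  proof (rule integral_dominated_convergence[OF _ _ integrable_z2[of 0]])
    have "(\<lambda>n. t * inverse (sqrt (real n))) \<longlonglongrightarrow> 0"
      by (intro tendsto_mult_right_zero tendsto_inverse_0_at_top
          filterlim_compose[OF sqrt_at_top filterlim_real_sequentially])
    then have *: "(\<lambda>n. t / sqrt (real n)) \<longlonglongrightarrow> 0" by (simp add: divide_inverse)
    show "AE \<omega> in M. (\<lambda>n. (z 0 \<omega>)\<^sup>2 * min \<bar>t / sqrt (real n) * z 0 \<omega>\<bar> 1) \<longlonglongrightarrow> (z 0 \<omega>)\<^sup>2 * min \<bar>0 * z 0 \<omega>\<bar> 1"
      by (intro AE_I2 tendsto_intros *)
    show "AE \<omega> in M. norm ((z 0 \<omega>)\<^sup>2 * min \<bar>t / sqrt (real n) * z 0 \<omega>\<bar> 1) \<le> (z 0 \<omega>)\<^sup>2" for n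
      by (intro AE_I2) (simp add: abs_mult mult_left_le)
  qed auto
  then show ?thesis by simp
qed

end

section \<open>Replacing the quadratic variation by its limit\<close>

lemma abs_exp_minus_diff_le:
  fixes u v :: real
  assumes "0 \<le> u" "0 \<le> v"
  shows "\<bar>exp (- u) - exp (- v)\<bar> \<le> \<bar>u - v\<bar>"
proof -
  have *: "exp (- a) - exp (- b) \<le> b - a" if "0 \<le> a" "a \<le> b" for a b :: real
  proof -
    have "exp (- a) - exp (- b) = exp (- a) * (1 - exp (- (b - a)))"
      by (simp add: algebra_simps flip: exp_add)
    also have "\<dots> \<le> 1 * (1 - exp (- (b - a)))"
      using that by (intro mult_right_mono) auto
    also have "\<dots> \<le> b - a" proof -
      have "1 + (a - b) \<le> exp (a - b)" by (rule exp_ge_add_one_self)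
      then show ?thesis by (simp only: minus_diff_eq mult_1)
    qed
    finally show ?thesis .
  qed
  show ?thesis
    using *[of u v] *[of v u] assms by (cases "u \<le> v") (auto simp: abs_if)
qed

context martingale_differences begin

context
  fixes t c :: real and L :: "'a \<Rightarrow> real"
  assumes L_measurable [measurable]: "L \<in> borel_measurable M" and L_nonneg: "\<And>\<omega>. 0 \<le> L \<omega>" and c_nonneg: "0 \<le> c"
begin

definition deviation :: "nat \<Rightarrow> 'a \<Rightarrow> real" where
  "deviation n \<omega> = \<bar>exp (- ((\<Sum>k<n. (stopped t (c + 1) n k \<omega>)\<^sup>2) / 2)) - exp (- (t\<^sup>2 * L \<omega> / 2))\<bar>"

lemma deviation_measurable [measurable]: "deviation n \<in> borel_measurable M"
  unfolding deviation_def[abs_def] by measurable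

lemma deviation_le_1: "deviation n \<omega> \<le> 1" "0 \<le> deviation n \<omega>"
proof -
  have "\<bar>exp (- a) - exp (- b)\<bar> \<le> 1" if "0 \<le> a" "0 \<le> b" for a b :: real
  proof -
    have "0 < exp (- a)" "exp (- a) \<le> 1" "0 < exp (- b)" "exp (- b) \<le> 1" using that by auto
    then show ?thesis by linarith
  qed
  then show "deviation n \<omega> \<le> 1"
    unfolding deviation_def using L_nonneg by (simp add: sum_nonneg)
qed (simp add: deviation_def)

text \<open>If the threshold is respected up to time \<open>n\<close>, stopping changes nothing and
  exp(-u) is 1-Lipschitz for u \<ge> 0. Otherwise qv n / n exceeds \<open>c + 1\<close>, hence L +
  1, and the discrepancy is at least 1, which absorbs the trivial bounds 1 and 2. This gap of 1 is
  the reason for the threshold \<open>c + 1\<close>.\<close>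

lemma deviation_le:
  assumes "L \<omega> \<le> c" "1 \<le> n"
  shows "deviation n \<omega> \<le> (1 + t\<^sup>2) * \<bar>qv n \<omega> / real n - L \<omega>\<bar>"
    and "cmod (iexp (t / sqrt (real n) * (\<Sum>k<n. z k \<omega>)) - iexp (\<Sum>k<n. stopped t (c + 1) n k \<omega>)) \<le>
      2 * \<bar>qv n \<omega> / real n - L \<omega>\<bar>"
proof -
  define D where "D = \<bar>qv n \<omega> / real n - L \<omega>\<bar>"
  have "deviation n \<omega> \<le> (1 + t\<^sup>2) * D \<and> cmod (iexp (t / sqrt (real n) * (\<Sum>k<n. z k \<omega>)) - iexp (\<Sum>k<n. stopped t (c + 1) n k \<omega>)) \<le> 2 * D"
  proof (cases "qv n \<omega> \<le> real n * (c + 1)")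
    case True
    have st: "stopped t (c + 1) n k \<omega> = t / sqrt (real n) * z k \<omega>" if "k < n" for k
      using qv_mono[of k n \<omega>] that True by (simp add: stopped_def)
    have "(\<Sum>k<n. (stopped t (c + 1) n k \<omega>)\<^sup>2) = (\<Sum>k<n. t\<^sup>2 / real n * (z k \<omega>)\<^sup>2)"
      by (intro sum.cong refl) (simp add: st power_mult_distrib power_divide)
    also have "\<dots> = t\<^sup>2 * (qv n \<omega> / real n)"
      by (simp add: qv_def sum_distrib_left sum_divide_distrib)
    finally have "deviation n \<omega> = \<bar>exp (- (t\<^sup>2 * (qv n \<omega> / real n) / 2)) - exp (- (t\<^sup>2 * L \<omega> / 2))\<bar>"
      by (simp add: deviation_def)
    also have "\<dots> \<le> \<bar>t\<^sup>2 * (qv n \<omega> / real n) / 2 - t\<^sup>2 * L \<omega> / 2\<bar>"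
      by (intro abs_exp_minus_diff_le) (auto simp: qv_nonneg L_nonneg)
    also have "\<dots> = t\<^sup>2 / 2 * D"
    proof -
      have "t\<^sup>2 * a / 2 - t\<^sup>2 * b / 2 = t\<^sup>2 / 2 * (a - b)" for a b by (simp add: algebra_simps)
      then show ?thesis by (simp only: D_def abs_mult) simp
    qed
    also have "\<dots> \<le> (1 + t\<^sup>2) * D"
      by (intro mult_right_mono) (auto simp: D_def)
    finally have "deviation n \<omega> \<le> (1 + t\<^sup>2) * D" .
    moreover have "(\<Sum>k<n. stopped t (c + 1) n k \<omega>) = t / sqrt (real n) * (\<Sum>k<n. z k \<omega>)"
      unfolding sum_distrib_left by (intro sum.cong refl) (simp add: st)
    ultimately show ?thesis by (simp add: D_def)
  next
    case False
    then have "qv n \<omega> / real n > c + 1" using assms(2) by (simp add: field_simps)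
    then have D: "1 \<le> D" using assms(1) by (simp add: D_def)
    have "deviation n \<omega> \<le> 1" by (rule deviation_le_1)
    also have "\<dots> \<le> (1 + t\<^sup>2) * D" using mult_mono[of 1 "1 + t\<^sup>2" 1 D] D by simp
    finally have 1: "deviation n \<omega> \<le> (1 + t\<^sup>2) * D" .
    have "cmod (iexp (t / sqrt (real n) * (\<Sum>k<n. z k \<omega>)) - iexp (\<Sum>k<n. stopped t (c + 1) n k \<omega>)) \<le> 1 + 1"
      by (intro order_trans[OF norm_triangle_ineq4] add_mono) auto
    also have "\<dots> \<le> 2 * D" using D by simp
    finally show ?thesis using 1 by simp
  qed
  then show "deviation n \<omega> \<le> (1 + t\<^sup>2) * \<bar>qv n \<omega> / real n - L \<omega>\<bar>"
    and "cmod (iexp (t / sqrt (real n) * (\<Sum>k<n. z k \<omega>)) - iexp (\<Sum>k<n. stopped t (c + 1) n k \<omega>)) \<le>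
      2 * \<bar>qv n \<omega> / real n - L \<omega>\<bar>"
    by (simp_all add: D_def)
qed

text \<open>The three terms are the costs of stopping, of replacing each exp(ix) by (1 + ix)
  exp(-x^2/2), and of replacing the stopped quadratic variation by t^2 L in the damping
  factor.\<close>

lemma iexp_mcleish_le:
  assumes "L \<omega> \<le> c" "1 \<le> n"
  shows "cmod (iexp (t / sqrt (real n) * (\<Sum>k<n. z k \<omega>)) - exp (- (t\<^sup>2 * L \<omega> / 2)) * mcleish t (c + 1) n n \<omega>) \<le>
    2 * \<bar>qv n \<omega> / real n - L \<omega>\<bar> + (\<Sum>k<n. 2 * t\<^sup>2 / real n * ((z k \<omega>)\<^sup>2 * min \<bar>t / sqrt (real n) * z k \<omega>\<bar> 1))
      + cmod (mcleish t (c + 1) n n \<omega>) * deviation n \<omega>"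
proof -
  let ?x = "\<lambda>k. stopped t (c + 1) n k \<omega>"
  let ?T = "mcleish t (c + 1) n n \<omega>" and ?Q = "\<Sum>k<n. (?x k)\<^sup>2"
  have prod1: "iexp (\<Sum>k<n. ?x k) = (\<Prod>k<n. iexp (?x k))"
    by (simp add: exp_sum sum_distrib_left)
  have "exp (- (?Q / 2)) = exp (\<Sum>k<n. - (?x k)\<^sup>2 / 2)"
    by (simp add: sum_negf sum_divide_distrib)
  also have "\<dots> = (\<Prod>k<n. exp (- (?x k)\<^sup>2 / 2))"
    by (rule exp_sum) simp
  finally have prod2: "?T * exp (- (?Q / 2)) = (\<Prod>k<n. (1 + \<i> * ?x k) * exp (- (?x k)\<^sup>2 / 2))"
    by (simp only: mcleish_def prod.distrib of_real_prod)
  \<comment> \<open>Factors in the closed unit disk make the difference of two products at most the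
    sum of the differences of the factors. Distributing the damping over the factors of
    \<open>?T\<close> is what puts them there.\<close>
  have "cmod (iexp (\<Sum>k<n. ?x k) - ?T * exp (- (?Q / 2))) \<le>
      (\<Sum>k<n. cmod (iexp (?x k) - (1 + \<i> * ?x k) * exp (- (?x k)\<^sup>2 / 2)))"
    unfolding prod1 prod2 by (intro norm_prod_diff cmod_damped_factor_le_1) simp
  also have "\<dots> \<le> (\<Sum>k<n. 2 * t\<^sup>2 / real n * ((z k \<omega>)\<^sup>2 * min \<bar>t / sqrt (real n) * z k \<omega>\<bar> 1))"
  proof (intro sum_mono order_trans[OF iexp_remainder_bound])
    fix k
    have "(?x k)\<^sup>2 * min \<bar>?x k\<bar> 1 \<le> (t\<^sup>2 / real n * (z k \<omega>)\<^sup>2) * min \<bar>t / sqrt (real n) * z k \<omega>\<bar> 1"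
      by (intro mult_mono stopped_power2_le) (auto simp: stopped_def)
    then show "2 * ((?x k)\<^sup>2 * min \<bar>?x k\<bar> 1) \<le> 2 * t\<^sup>2 / real n * ((z k \<omega>)\<^sup>2 * min \<bar>t / sqrt (real n) * z k \<omega>\<bar> 1)"
      by (simp add: mult.assoc)
  qed
  finally have b: "cmod (iexp (\<Sum>k<n. ?x k) - ?T * exp (- (?Q / 2))) \<le> \<dots>" .
  have "?T * exp (- (?Q / 2)) - exp (- (t\<^sup>2 * L \<omega> / 2)) * ?T = ?T * of_real (exp (- (?Q / 2)) - exp (- (t\<^sup>2 * L \<omega> / 2)))"
    by (simp add: algebra_simps)
  then have d: "cmod (?T * exp (- (?Q / 2)) - exp (- (t\<^sup>2 * L \<omega> / 2)) * ?T) = cmod ?T * deviation n \<omega>"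
    by (simp only: norm_mult norm_of_real deviation_def)
  show ?thesis
    using norm_diff_triangle_le[OF norm_diff_triangle_le[OF deviation_le(2)[OF assms] b] eq_refl[OF d]] .
qed

text \<open>Up to an L1 error the exponential equals \<open>\<xi>\<close> times McLeish's product,
  and \<open>\<xi>\<close> is bounded, so \<open>mcleish_weak_limit\<close> gives the limit. The
  product is bounded only in L2, so its error term is treated by Cauchy-Schwarz.\<close>

lemma stable_limit_of_bounded_variance:
  assumes H: "H \<in> sets M" "\<And>\<omega>. \<omega> \<in> H \<Longrightarrow> L \<omega> \<le> c" and L: "integrable M L"
    and lln: "(\<lambda>n. \<integral>\<omega>. \<bar>qv n \<omega> / real n - L \<omega>\<bar> \<partial>M) \<longlonglongrightarrow> 0"
  shows "(\<lambda>n. \<integral>\<omega>. indicator H \<omega> * iexp (t / sqrt (real n) * (\<Sum>k<n. z k \<omega>)) \<partial>M) \<longlonglongrightarrow>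
    complex_of_real (\<integral>\<omega>. indicator H \<omega> * exp (- (t\<^sup>2 * L \<omega> / 2)) \<partial>M)"
proof -
  define \<xi> :: "'a \<Rightarrow> real" where "\<xi> \<omega> = indicator H \<omega> * exp (- (t\<^sup>2 * L \<omega> / 2))" for \<omega>
  define T where "T n = mcleish t (c + 1) n n" for n
  define e where "e n \<omega> = indicator H \<omega> * iexp (t / sqrt (real n) * (\<Sum>k<n. z k \<omega>))" for n \<omega>
  define dev where "dev n \<omega> = indicator H \<omega> * deviation n \<omega>" for n \<omega>
  define \<delta> where "\<delta> n = (\<integral>\<omega>. \<bar>qv n \<omega> / real n - L \<omega>\<bar> \<partial>M)" for n
  define lam where "lam n = (\<integral>\<omega>. (z 0 \<omega>)\<^sup>2 * min \<bar>t / sqrt (real n) * z 0 \<omega>\<bar> 1 \<partial>M)" for n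
  define B where "B = exp (t\<^sup>2 * (c + 1)) * (1 + t\<^sup>2 * (\<integral>\<omega>. (z 0 \<omega>)\<^sup>2 \<partial>M))"
  have [measurable]: "H \<in> sets M" by fact
  have C: "0 \<le> c + 1" using c_nonneg by simp
  have [measurable]: "\<xi> \<in> borel_measurable M" "e n \<in> borel_measurable M" "dev n \<in> borel_measurable M" "T n \<in> borel_measurable M" for n
    unfolding \<xi>_def[abs_def] e_def[abs_def] dev_def[abs_def] T_def by measurable
  have "\<bar>\<xi> \<omega>\<bar> \<le> 1" for \<omega> using L_nonneg[of \<omega>] by (auto simp: \<xi>_def indicator_def)
  then have sq\<xi>: "square_integrable M \<xi>"
    using integrable_const_bound[of "\<lambda>\<omega>. (\<xi> \<omega>)\<^sup>2" 1] by (auto simp: square_integrable_def abs_square_le_1)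
  have sqT: "square_integrable M (\<lambda>\<omega>. cmod (T n \<omega>))" for n
    using square_integrable_mcleish(3)[OF C] by (auto simp: square_integrable_def T_def)
  have dev01: "0 \<le> dev n \<omega>" "dev n \<omega> \<le> 1" for n \<omega>
    using deviation_le_1[of n \<omega>] by (auto simp: dev_def indicator_def)
  \<comment> \<open>Since \<open>dev\<close> lies in [0, 1], its L2 norm is controlled by its L1
    norm; convergence of the quadratic variation in L1 is then enough for the Cauchy-Schwarz
    estimate.\<close>
  have dev2: "(dev n \<omega>)\<^sup>2 \<le> dev n \<omega>" for n \<omega>
    using dev01[of n \<omega>] by (simp add: power2_eq_square mult_left_le)
  have sqdev: "square_integrable M (dev n)" for n
    using dev01 integrable_const_bound[of "\<lambda>\<omega>. (dev n \<omega>)\<^sup>2" 1] by (auto simp: square_integrable_def abs_square_le_1)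
  have iA: "integrable M (\<lambda>\<omega>. \<bar>qv n \<omega> / real n - L \<omega>\<bar>)" for n
    using L by simp
  have iz: "integrable M (\<lambda>\<omega>. (z k \<omega>)\<^sup>2 * min \<bar>t / sqrt (real n) * z k \<omega>\<bar> 1)" for k n
    by (rule Bochner_Integration.integrable_bound[OF integrable_z2[of k]]) (auto simp: abs_mult mult_left_le)
  have ie: "integrable M (e n)" for n
  proof (rule integrable_const_bound[of _ 1])
    show "AE \<omega> in M. cmod (e n \<omega>) \<le> 1" by (auto simp: e_def norm_mult indicator_def)
  qed simp
  have i\<xi>T: "integrable M (\<lambda>\<omega>. \<xi> \<omega> * T n \<omega>)" for n
    unfolding T_def by (rule integrable_mcleish_mult[OF C sq\<xi>])
  have pw: "cmod (e n \<omega> - \<xi> \<omega> * T n \<omega>) \<le> 2 * \<bar>qv n \<omega> / real n - L \<omega>\<bar> +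
      (\<Sum>k<n. 2 * t\<^sup>2 / real n * ((z k \<omega>)\<^sup>2 * min \<bar>t / sqrt (real n) * z k \<omega>\<bar> 1)) + cmod (T n \<omega>) * dev n \<omega>"
    if "1 \<le> n" for n \<omega>
  proof (cases "\<omega> \<in> H")
    case True
    then show ?thesis
      using iexp_mcleish_le[OF H(2)[OF True] that] by (simp add: e_def \<xi>_def T_def dev_def)
  next
    case False
    have "0 \<le> (\<Sum>k<n. 2 * t\<^sup>2 / real n * ((z k \<omega>)\<^sup>2 * min \<bar>t / sqrt (real n) * z k \<omega>\<bar> 1))"
      by (intro sum_nonneg mult_nonneg_nonneg divide_nonneg_nonneg) auto
    then show ?thesis using False by (simp add: e_def \<xi>_def dev_def)
  qed
  have main: "cmod ((\<integral>\<omega>. e n \<omega> \<partial>M) - (\<integral>\<omega>. \<xi> \<omega> * T n \<omega> \<partial>M)) \<le> 2 * \<delta> n + 2 * t\<^sup>2 * lam n + sqrt B * sqrt ((1 + t\<^sup>2) * \<delta> n)"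
    if n: "1 \<le> n" for n
  proof -
    have iTd: "integrable M (\<lambda>\<omega>. cmod (T n \<omega>) * dev n \<omega>)" by (rule square_integrable_mult[OF sqT sqdev])
    have "cmod ((\<integral>\<omega>. e n \<omega> \<partial>M) - (\<integral>\<omega>. \<xi> \<omega> * T n \<omega> \<partial>M)) = cmod (\<integral>\<omega>. e n \<omega> - \<xi> \<omega> * T n \<omega> \<partial>M)"
      by (simp add: Bochner_Integration.integral_diff[OF ie i\<xi>T])
    also have "\<dots> \<le> (\<integral>\<omega>. cmod (e n \<omega> - \<xi> \<omega> * T n \<omega>) \<partial>M)" by (rule integral_norm_bound)
    also have "\<dots> \<le> (\<integral>\<omega>. 2 * \<bar>qv n \<omega> / real n - L \<omega>\<bar> +
      (\<Sum>k<n. 2 * t\<^sup>2 / real n * ((z k \<omega>)\<^sup>2 * min \<bar>t / sqrt (real n) * z k \<omega>\<bar> 1)) + cmod (T n \<omega>) * dev n \<omega> \<partial>M)"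
      using iA iz iTd ie i\<xi>T pw[OF n] by (intro integral_mono) auto
    also have "\<dots> = 2 * \<delta> n + (\<Sum>k<n. 2 * t\<^sup>2 / real n * (\<integral>\<omega>. (z k \<omega>)\<^sup>2 * min \<bar>t / sqrt (real n) * z k \<omega>\<bar> 1 \<partial>M))
        + (\<integral>\<omega>. cmod (T n \<omega>) * dev n \<omega> \<partial>M)"
      using iA iz iTd by (simp add: \<delta>_def)
    also have "(\<lambda>k. \<integral>\<omega>. (z k \<omega>)\<^sup>2 * min \<bar>t / sqrt (real n) * z k \<omega>\<bar> 1 \<partial>M) = (\<lambda>k. lam n)"
      unfolding lam_def by (intro ext expectation_z_transfer) measurable
    also have "(\<integral>\<omega>. cmod (T n \<omega>) * dev n \<omega> \<partial>M) \<le> sqrt B * sqrt ((1 + t\<^sup>2) * \<delta> n)"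
    proof -
      have "(\<integral>\<omega>. (dev n \<omega>)\<^sup>2 \<partial>M) \<le> (\<integral>\<omega>. (1 + t\<^sup>2) * \<bar>qv n \<omega> / real n - L \<omega>\<bar> \<partial>M)"
      proof (rule integral_mono)
        show "integrable M (\<lambda>\<omega>. (dev n \<omega>)\<^sup>2)" using sqdev by (simp add: square_integrable_def)
        have "dev n \<omega> \<le> (1 + t\<^sup>2) * \<bar>qv n \<omega> / real n - L \<omega>\<bar>" for \<omega>
          using deviation_le(1)[OF H(2) n, of \<omega>] by (simp add: dev_def indicator_def)
        then show "(dev n \<omega>)\<^sup>2 \<le> (1 + t\<^sup>2) * \<bar>qv n \<omega> / real n - L \<omega>\<bar>" for \<omega>
          using dev2 order_trans by blast
      qed (use iA in simp)
      then have "(\<integral>\<omega>. (dev n \<omega>)\<^sup>2 \<partial>M) \<le> (1 + t\<^sup>2) * \<delta> n" using iA by (simp add: \<delta>_def)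
      moreover have "(\<integral>\<omega>. (cmod (T n \<omega>))\<^sup>2 \<partial>M) \<le> B"
        unfolding T_def B_def by (rule expectation_mcleish_le[OF C])
      ultimately have "sqrt (\<integral>\<omega>. (cmod (T n \<omega>))\<^sup>2 \<partial>M) * sqrt (\<integral>\<omega>. (dev n \<omega>)\<^sup>2 \<partial>M) \<le> sqrt B * sqrt ((1 + t\<^sup>2) * \<delta> n)"
        by (intro mult_mono real_sqrt_le_mono) (auto simp: B_def)
      then show ?thesis using Cauchy_Schwarz_integral[OF sqT[of n] sqdev[of n]] by linarith
    qed
    finally show ?thesis using n by (simp add: mult.assoc)
  qed
  have \<delta>: "\<delta> \<longlonglongrightarrow> 0" using lln by (simp add: \<delta>_def[abs_def])
  have lam: "lam \<longlonglongrightarrow> 0" using lindeberg by (simp add: lam_def[abs_def])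
  have "(\<lambda>n. 2 * \<delta> n + 2 * t\<^sup>2 * lam n + sqrt B * sqrt ((1 + t\<^sup>2) * \<delta> n)) \<longlonglongrightarrow> 2 * 0 + 2 * t\<^sup>2 * 0 + sqrt B * sqrt ((1 + t\<^sup>2) * 0)"
    by (intro tendsto_intros \<delta> lam)
  then have lim: "(\<lambda>n. 2 * \<delta> n + 2 * t\<^sup>2 * lam n + sqrt B * sqrt ((1 + t\<^sup>2) * \<delta> n)) \<longlonglongrightarrow> 0" by simp
  have "(\<lambda>n. (\<integral>\<omega>. e n \<omega> \<partial>M) - (\<integral>\<omega>. \<xi> \<omega> * T n \<omega> \<partial>M)) \<longlonglongrightarrow> 0"
    by (rule Lim_null_comparison[OF eventually_mono[OF eventually_ge_at_top[of 1] main] lim])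
  from tendsto_add[OF this mcleish_weak_limit[OF C sq\<xi>, of t, folded T_def]]
  show ?thesis by (simp add: e_def \<xi>_def)
qed

end

text \<open>On \<open>H - K\<close> the variance is at most \<open>c\<close> and the previous limit
  applies. Removing \<open>K\<close> changes either integral by at most its probability, whatever
  \<open>n\<close> is.\<close>

theorem stable_central_limit:
  assumes H: "H \<in> sets M" and L: "integrable M L" "\<And>\<omega>. 0 \<le> L \<omega>"
    and lln: "(\<lambda>n. \<integral>\<omega>. \<bar>(\<Sum>k<n. (z k \<omega>)\<^sup>2) / real n - L \<omega>\<bar> \<partial>M) \<longlonglongrightarrow> 0"
  shows "(\<lambda>n. \<integral>\<omega>. indicator H \<omega> * iexp (t / sqrt (real n) * (\<Sum>k<n. z k \<omega>)) \<partial>M) \<longlonglongrightarrow>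
    complex_of_real (\<integral>\<omega>. indicator H \<omega> * exp (- (t\<^sup>2 * L \<omega> / 2)) \<partial>M)"
proof (rule LIMSEQ_I)
  fix r :: real assume r: "0 < r"
  have [measurable]: "H \<in> sets M" "L \<in> borel_measurable M" using H L by auto
  \<comment> \<open>By Markov's inequality L > c then has probability at most r / 4; the added 1
    keeps \<open>c\<close> positive. The two removals of \<open>K\<close> and the limit on
    \<open>H - K\<close> share \<open>r\<close> as r/4 + r/4 + r/2.\<close>
  define c where "c = 4 * (expectation L + 1) / r"
  have EL: "0 \<le> expectation L" using L by simp
  have c: "0 < c" using EL r by (simp add: c_def)
  define K where "K = {\<omega> \<in> space M. c < L \<omega>}"
  have [measurable]: "K \<in> sets M" unfolding K_def by measurable
  have "measure M K \<le> measure M {\<omega> \<in> space M. c \<le> L \<omega>}"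
    by (intro finite_measure_mono) (auto simp: K_def)
  also have "\<dots> \<le> expectation L / c"
    by (rule integral_Markov_inequality_measure[of _ _ "{}"]) (use L c in auto)
  also have "\<dots> \<le> r / 4"
    using EL r by (simp add: c_def field_simps)
  finally have PK: "measure M K \<le> r / 4" .
  have lln': "(\<lambda>n. \<integral>\<omega>. \<bar>qv n \<omega> / real n - L \<omega>\<bar> \<partial>M) \<longlonglongrightarrow> 0"
    using lln by (simp add: qv_def)
  let ?e = "\<lambda>n \<omega>. iexp (t / sqrt (real n) * (\<Sum>k<n. z k \<omega>))" and ?g = "\<lambda>\<omega>. exp (- (t\<^sup>2 * L \<omega> / 2))"
  have "(\<lambda>n. \<integral>\<omega>. indicator (H - K) \<omega> * ?e n \<omega> \<partial>M) \<longlonglongrightarrow>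
    complex_of_real (\<integral>\<omega>. indicator (H - K) \<omega> * ?g \<omega> \<partial>M)"
    using c H sets.sets_into_space[OF H] L lln'
    by (intro stable_limit_of_bounded_variance[of L c]) (auto simp: K_def not_less)
  from LIMSEQ_D[OF this, of "r / 2"] r obtain N where
    N: "\<And>n. n \<ge> N \<Longrightarrow> cmod ((\<integral>\<omega>. indicator (H - K) \<omega> * ?e n \<omega> \<partial>M) -
      complex_of_real (\<integral>\<omega>. indicator (H - K) \<omega> * ?g \<omega> \<partial>M)) < r / 2" by auto
  have g1: "norm (?g \<omega>) \<le> 1" for \<omega> using L(2)[of \<omega>] by simp
  have split: "cmod ((\<integral>\<omega>. indicator H \<omega> * h \<omega> \<partial>M) - (\<integral>\<omega>. indicator (H - K) \<omega> * h \<omega> \<partial>M)) \<le> measure M K"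
    if [measurable]: "h \<in> borel_measurable M" and h: "\<And>\<omega>. cmod (h \<omega>) \<le> 1" for h
  proof -
    have i: "integrable M (\<lambda>\<omega>. indicator A \<omega> * h \<omega>)" if [measurable]: "A \<in> sets M" for A
      by (rule integrable_const_bound[of _ 1]) (use h in \<open>auto simp: norm_mult indicator_def\<close>)
    have "cmod ((\<integral>\<omega>. indicator H \<omega> * h \<omega> \<partial>M) - (\<integral>\<omega>. indicator (H - K) \<omega> * h \<omega> \<partial>M)) =
        cmod (\<integral>\<omega>. indicator H \<omega> * h \<omega> - indicator (H - K) \<omega> * h \<omega> \<partial>M)"
      using i by simp
    also have "\<dots> \<le> (\<integral>\<omega>. cmod (indicator H \<omega> * h \<omega> - indicator (H - K) \<omega> * h \<omega>) \<partial>M)"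
      by (rule integral_norm_bound)
    also have "\<dots> \<le> (\<integral>\<omega>. indicator K \<omega> \<partial>M)"
    proof (rule integral_mono)
      show "integrable M (\<lambda>\<omega>. cmod (indicator H \<omega> * h \<omega> - indicator (H - K) \<omega> * h \<omega>))"
        by (intro integrable_norm Bochner_Integration.integrable_diff i) measurable
      show "cmod (indicator H \<omega> * h \<omega> - indicator (H - K) \<omega> * h \<omega>) \<le> indicator K \<omega>" for \<omega>
        using h[of \<omega>] by (auto simp: indicator_def)
    qed (auto intro!: integrable_real_indicator simp: less_top[symmetric])
    finally show ?thesis by simp
  qed
  have "norm ((\<integral>\<omega>. indicator H \<omega> * ?e n \<omega> \<partial>M) - complex_of_real (\<integral>\<omega>. indicator H \<omega> * ?g \<omega> \<partial>M)) < r"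
    if "n \<ge> N" for n
  proof -
    have 1: "cmod ((\<integral>\<omega>. indicator H \<omega> * ?e n \<omega> \<partial>M) - (\<integral>\<omega>. indicator (H - K) \<omega> * ?e n \<omega> \<partial>M)) \<le> r / 4"
      by (rule order_trans[OF split PK]) auto
    have 2: "cmod ((\<integral>\<omega>. indicator H \<omega> * complex_of_real (?g \<omega>) \<partial>M) - (\<integral>\<omega>. indicator (H - K) \<omega> * complex_of_real (?g \<omega>) \<partial>M)) \<le> r / 4"
      by (rule order_trans[OF split PK]) (use g1 in auto)
    have "(\<integral>\<omega>. indicator A \<omega> * complex_of_real (?g \<omega>) \<partial>M) = complex_of_real (\<integral>\<omega>. indicator A \<omega> * ?g \<omega> \<partial>M)" for A
      unfolding integral_complex_of_real[symmetric]
      by (intro Bochner_Integration.integral_cong) (auto simp: indicator_def)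
    then have 2: "cmod (complex_of_real (\<integral>\<omega>. indicator H \<omega> * ?g \<omega> \<partial>M) - complex_of_real (\<integral>\<omega>. indicator (H - K) \<omega> * ?g \<omega> \<partial>M)) \<le> r / 4"
      using 2 by simp
    have tri: "cmod (a - b) < r" if "cmod (a - a') \<le> r / 4" "cmod (b - b') \<le> r / 4" "cmod (a' - b') < r / 2" for a b a' b'
      using that norm_triangle_ineq[of "a - a'" "a' - b'"] norm_triangle_ineq4[of "a - b'" "b - b'"] by simp
    show ?thesis by (rule tri[OF 1 2 N[OF that]])
  qed
  then show "\<exists>N. \<forall>n\<ge>N. norm ((\<integral>\<omega>. indicator H \<omega> * ?e n \<omega> \<partial>M) - complex_of_real (\<integral>\<omega>. indicator H \<omega> * ?g \<omega> \<partial>M)) < r"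
    by blast
qed

end

section \<open>A law of large numbers\<close>

lemma cesaro_mean:
  fixes a :: "nat \<Rightarrow> real"
  assumes "a \<longlonglongrightarrow> l"
  shows "(\<lambda>n. (\<Sum>k<n. a k) / real n) \<longlonglongrightarrow> l"
proof (rule LIMSEQ_I)
  fix r :: real assume r: "0 < r"
  obtain N where N: "\<And>k. k \<ge> N \<Longrightarrow> \<bar>a k - l\<bar> < r / 2"
    using LIMSEQ_D[OF assms, of "r / 2"] r by auto
  define S where "S = (\<Sum>k<N. \<bar>a k - l\<bar>)"
  obtain N' where N': "2 * S / r < real N'" using reals_Archimedean2 by blast
  have S0: "0 \<le> S" by (simp add: S_def sum_nonneg)
  have "norm ((\<Sum>k<n. a k) / real n - l) < r" if n: "n \<ge> max N (max N' 1)" for n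
  proof -
    have n0: "0 < real n" using n by simp
    have "(\<Sum>k<n. a k) / real n - l = (\<Sum>k<n. a k - l) / real n"
      using n0 by (simp add: sum_subtractf field_simps)
    also have "\<bar>\<dots>\<bar> \<le> (\<Sum>k<n. \<bar>a k - l\<bar>) / real n"
      using n0 by (simp add: divide_right_mono)
    also have "(\<Sum>k<n. \<bar>a k - l\<bar>) = S + (\<Sum>k=N..<n. \<bar>a k - l\<bar>)"
      unfolding S_def lessThan_atLeast0 using n by (intro sum.atLeastLessThan_concat[symmetric]) auto
    also have "\<dots> \<le> S + (\<Sum>k=N..<n. r / 2)"
      using N by (intro add_left_mono sum_mono) (auto intro: less_imp_le)
    also have "\<dots> \<le> S + real n * (r / 2)" using r by (simp add: mult_right_mono)
    also have "\<dots> < r * real n"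
    proof -
      have "2 * S / r < real n" using N' n by (simp add: max_def split: if_splits)
      then show ?thesis using r by (simp add: field_simps)
    qed
    finally show ?thesis using n0 by (simp add: divide_right_mono field_simps)
  qed
  then show "\<exists>N. \<forall>n\<ge>N. norm ((\<Sum>k<n. a k) / real n - l) < r" by blast
qed

text \<open>As before, \<open>F j\<close> precedes \<open>y j\<close>. The c.i.d. property is
  recorded through integrable \<open>F j\<close>-measurable multipliers: seen from time
  \<open>j\<close>, all later values have the same conditional mean as \<open>y j\<close>.\<close>

locale bounded_cid_process = prob_space M for M :: "'a measure" +
  fixes F :: "nat \<Rightarrow> 'a measure" and y :: "nat \<Rightarrow> 'a \<Rightarrow> real" and K :: real
  assumes subalg: "\<And>k. subalgebra M (F k)"
    and filtration: "\<And>k l. k \<le> l \<Longrightarrow> subalgebra (F l) (F k)"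
    and adapted: "\<And>j k. j < k \<Longrightarrow> y j \<in> borel_measurable (F k)"
    and bounded: "\<And>k \<omega>. \<omega> \<in> space M \<Longrightarrow> \<bar>y k \<omega>\<bar> \<le> K"
    and cid: "\<And>j k B. B \<in> borel_measurable (F j) \<Longrightarrow> integrable M B \<Longrightarrow> j \<le> k \<Longrightarrow>
      (\<integral>\<omega>. B \<omega> * y k \<omega> \<partial>M) = (\<integral>\<omega>. B \<omega> * y j \<omega> \<partial>M)"
begin

lemma y_measurable [measurable]: "y k \<in> borel_measurable M"
  by (rule measurable_from_subalg[OF subalg adapted[OF lessI]])

lemma K_nonneg: "0 \<le> K"
  using bounded[of _ 0] not_empty by fastforce

text \<open>Clipping changes the conditional expectation only on a null set. It makes the bound by
  \<open>K\<close> hold at every point while preserving measurability with respect to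
  \<open>F j\<close>.\<close>

definition pred :: "nat \<Rightarrow> 'a \<Rightarrow> real" where
  "pred j \<omega> = max (- K) (min K (real_cond_exp M (F j) (y j) \<omega>))"

lemma pred_adapted [measurable]: "pred j \<in> borel_measurable (F j)"
  unfolding pred_def[abs_def] by measurable

lemma pred_adapted': "j \<le> k \<Longrightarrow> pred j \<in> borel_measurable (F k)"
  using filtration pred_adapted by (rule measurable_from_subalg)

lemma pred_measurable [measurable]: "pred j \<in> borel_measurable M"
  by (rule measurable_from_subalg[OF subalg pred_adapted])

lemma abs_pred_le: "\<bar>pred j \<omega>\<bar> \<le> K"
  using K_nonneg by (auto simp: pred_def)

lemma integrable_bounded [simp]:
  assumes "g \<in> borel_measurable M" "\<And>\<omega>. \<omega> \<in> space M \<Longrightarrow> \<bar>g \<omega>\<bar> \<le> (c::real)"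
  shows "integrable M g"
  using assms by (intro integrable_const_bound[of _ c]) auto

lemma integrable_y: "integrable M (y k)"
  by (rule integrable_bounded[of _ K]) (auto intro: bounded)

lemma integrable_pred: "integrable M (pred k)"
  by (rule integrable_bounded[of _ K]) (auto intro: abs_pred_le)

text \<open>One variable \<open>pred j\<close> serves every horizon \<open>k\<close>, because
  \<open>cid\<close> reduces \<open>y k\<close> to \<open>y j\<close> before the conditional
  expectation is taken.\<close>

lemma expectation_pred:
  assumes B: "B \<in> borel_measurable (F j)" "integrable M B" and "j \<le> k"
  shows "(\<integral>\<omega>. B \<omega> * y k \<omega> \<partial>M) = (\<integral>\<omega>. B \<omega> * pred j \<omega> \<partial>M)"
proof -
  interpret finite_measure_subalgebra M "F j" by unfold_locales (rule subalg)
  have [measurable]: "B \<in> borel_measurable M" using B by auto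
  have "integrable M (\<lambda>\<omega>. B \<omega> * K)" using B by simp
  then have i: "integrable M (\<lambda>\<omega>. B \<omega> * y j \<omega>)"
  proof (rule Bochner_Integration.integrable_bound)
    show "AE \<omega> in M. norm (B \<omega> * y j \<omega>) \<le> norm (B \<omega> * K)"
      using bounded[of _ j] K_nonneg by (auto simp: abs_mult intro!: AE_I2 mult_left_mono)
  qed simp
  have "AE \<omega> in M. real_cond_exp M (F j) (y j) \<omega> \<le> K" "AE \<omega> in M. - K \<le> real_cond_exp M (F j) (y j) \<omega>"
    using bounded[of _ j] by (intro real_cond_exp_le_c real_cond_exp_ge_c integrable_y AE_I2; force simp: abs_le_iff)+
  then have ae: "AE \<omega> in M. B \<omega> * pred j \<omega> = B \<omega> * real_cond_exp M (F j) (y j) \<omega>"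
    by eventually_elim (simp add: pred_def)
  have "(\<integral>\<omega>. B \<omega> * y k \<omega> \<partial>M) = (\<integral>\<omega>. B \<omega> * y j \<omega> \<partial>M)"
    by (rule cid[OF B \<open>j \<le> k\<close>])
  also have "\<dots> = (\<integral>\<omega>. B \<omega> * real_cond_exp M (F j) (y j) \<omega> \<partial>M)"
    by (rule real_cond_exp_intg(2)[symmetric, OF i B(1)]) simp
  also have "\<dots> = (\<integral>\<omega>. B \<omega> * pred j \<omega> \<partial>M)"
    by (rule integral_cong_AE[symmetric]) (use ae in auto)
  finally show ?thesis .
qed

lemma integrable_bounded_mult:
  fixes g h :: "'a \<Rightarrow> real"
  assumes "g \<in> borel_measurable M" "\<And>\<omega>. \<omega> \<in> space M \<Longrightarrow> \<bar>g \<omega>\<bar> \<le> a"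
    and "h \<in> borel_measurable M" "\<And>\<omega>. \<omega> \<in> space M \<Longrightarrow> \<bar>h \<omega>\<bar> \<le> b"
  shows "integrable M (\<lambda>\<omega>. g \<omega> * h \<omega>)"
proof (rule integrable_bounded)
  show "\<bar>g \<omega> * h \<omega>\<bar> \<le> a * b" if "\<omega> \<in> space M" for \<omega>
    unfolding abs_mult using assms(2,4)[OF that] abs_ge_zero[of "g \<omega>"] by (intro mult_mono) linarith+
qed (use assms in measurable)

text \<open>Orthogonality of martingale increments. The cross term is evaluated through
  \<open>y j\<close>: \<open>pred j\<close> and \<open>pred i\<close> both predict it, and
  \<open>pred i\<close> is an admissible multiplier at both times.\<close>

lemma pred_increment:
  assumes "i \<le> j"
  shows "(\<integral>\<omega>. (pred j \<omega> - pred i \<omega>)\<^sup>2 \<partial>M) = (\<integral>\<omega>. (pred j \<omega>)\<^sup>2 \<partial>M) - (\<integral>\<omega>. (pred i \<omega>)\<^sup>2 \<partial>M)"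
proof -
  have "(\<integral>\<omega>. pred i \<omega> * pred j \<omega> \<partial>M) = (\<integral>\<omega>. pred i \<omega> * y j \<omega> \<partial>M)"
    by (rule expectation_pred[symmetric, OF pred_adapted'[OF assms] integrable_pred order_refl])
  also have "\<dots> = (\<integral>\<omega>. pred i \<omega> * pred i \<omega> \<partial>M)"
    by (rule expectation_pred[OF pred_adapted integrable_pred assms])
  finally have cross: "(\<integral>\<omega>. pred i \<omega> * pred j \<omega> \<partial>M) = (\<integral>\<omega>. (pred i \<omega>)\<^sup>2 \<partial>M)"
    by (simp add: power2_eq_square)
  have int: "integrable M (\<lambda>\<omega>. pred i \<omega> * pred j \<omega>)" for i j
    by (rule integrable_bounded_mult[of _ K _ K]) (auto intro: abs_pred_le)
  have "(\<integral>\<omega>. (pred j \<omega> - pred i \<omega>)\<^sup>2 \<partial>M) = (\<integral>\<omega>. (pred j \<omega>)\<^sup>2 - 2 * (pred i \<omega> * pred j \<omega>) + (pred i \<omega>)\<^sup>2 \<partial>M)"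
    by (simp add: power2_eq_square algebra_simps)
  also have "\<dots> = (\<integral>\<omega>. (pred j \<omega>)\<^sup>2 \<partial>M) - (\<integral>\<omega>. (pred i \<omega>)\<^sup>2 \<partial>M)"
    using int[of i i] int[of j j] int[of i j] cross by (simp add: power2_eq_square)
  finally show ?thesis .
qed

text \<open>By \<open>pred_increment\<close> the second moments increase; they are bounded by K^2,
  so they converge, and the squared increment after \<open>n0\<close> is at most what is still
  missing at \<open>n0\<close>.\<close>

lemma pred_increments_small:
  assumes "0 < d"
  obtains n0 where "\<And>k. n0 \<le> k \<Longrightarrow> (\<integral>\<omega>. (pred k \<omega> - pred n0 \<omega>)\<^sup>2 \<partial>M) < d"
proof -
  define b where "b j = (\<integral>\<omega>. (pred j \<omega>)\<^sup>2 \<partial>M)" for j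
  have "incseq b"
  proof (rule incseq_SucI)
    show "b j \<le> b (Suc j)" for j
    proof -
      have "0 \<le> (\<integral>\<omega>. (pred (Suc j) \<omega> - pred j \<omega>)\<^sup>2 \<partial>M)" by simp
      then show ?thesis using pred_increment[of j "Suc j"] by (simp add: b_def)
    qed
  qed
  moreover have "b j \<le> K\<^sup>2" for j
  proof -
    have "b j \<le> (\<integral>\<omega>. K\<^sup>2 \<partial>M)"
      unfolding b_def using integrable_bounded_mult[of "pred j" K "pred j" K] abs_pred_le[of j] K_nonneg
      by (intro integral_mono) (auto simp: power2_eq_square abs_le_square_iff[symmetric, unfolded power2_eq_square])
    then show ?thesis by (simp add: prob_space)
  qed
  ultimately obtain l where l: "b \<longlonglongrightarrow> l" "\<And>j. b j \<le> l"
    using incseq_convergent[of b "K\<^sup>2"] by blast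
  from LIMSEQ_D[OF l(1) assms] obtain n0 where "\<bar>b n0 - l\<bar> < d" by auto
  then have "(\<integral>\<omega>. (pred k \<omega> - pred n0 \<omega>)\<^sup>2 \<partial>M) < d" if "n0 \<le> k" for k
    using pred_increment[OF that] l(2)[of k] by (simp add: b_def)
  then show ?thesis by (rule that)
qed

text \<open>A second moment computation for the deviations \<open>w k\<close> of \<open>y k\<close>
  from \<open>pred n0\<close>. Covariances at distinct late times are small because, seen from time
  \<open>Suc k\<close>, the later value may be replaced by \<open>pred (Suc k)\<close>, which is
  close to \<open>pred n0\<close> in L2. The diagonal and the pairs with an early time number only
  O(n).\<close>

lemma averages_near_prediction:
  assumes "0 < e"
  shows "\<exists>n0. \<forall>\<^sub>F n in sequentially. (\<integral>\<omega>. \<bar>(\<Sum>k<n. y k \<omega>) / real n - pred n0 \<omega>\<bar> \<partial>M) \<le> e"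
proof -
  define K1 where "K1 = K + 1"
  \<comment> \<open>Chosen so that 2 K1 sqrt d = e^2 / 2, the covariance allowed below;
    \<open>K1 = K + 1\<close> guards against division by 0.\<close>
  define d where "d = (e\<^sup>2 / (4 * K1))\<^sup>2"
  have K1: "0 < K1" "K \<le> K1" using K_nonneg by (auto simp: K1_def)
  have d: "0 < d" and sd: "sqrt d = e\<^sup>2 / (4 * K1)" using K1 assms by (auto simp: d_def)
  obtain n0 where n0: "\<And>k. n0 \<le> k \<Longrightarrow> (\<integral>\<omega>. (pred k \<omega> - pred n0 \<omega>)\<^sup>2 \<partial>M) < d"
    using pred_increments_small[OF d] by blast
  define w where "w k \<omega> = y k \<omega> - pred n0 \<omega>" for k \<omega>
  have w_meas [measurable]: "w k \<in> borel_measurable M" for k unfolding w_def[abs_def] by measurable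
  have w_le: "\<bar>w k \<omega>\<bar> \<le> 2 * K1" if "\<omega> \<in> space M" for k \<omega>
    using bounded[OF that, of k] abs_pred_le[of n0 \<omega>] K1 unfolding w_def by linarith
  have iw: "integrable M (\<lambda>\<omega>. w k \<omega> * w l \<omega>)" for k l
    by (rule integrable_bounded_mult[of _ "2 * K1" _ "2 * K1"]) (auto intro: w_le)
  have sqw: "square_integrable M (w k)" for k
    using iw[of k k] by (simp add: square_integrable_def power2_eq_square)
  have sqp: "square_integrable M (\<lambda>\<omega>. pred k \<omega> - pred n0 \<omega>)" for k
  proof -
    have "square_integrable M (pred j)" for j
      using integrable_bounded_mult[of "pred j" K "pred j" K] abs_pred_le[of j]
      by (simp add: square_integrable_def power2_eq_square)
    then show ?thesis by (intro square_integrable_diff)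
  qed
  have w2: "(\<integral>\<omega>. w k \<omega> * w l \<omega> \<partial>M) \<le> 4 * K1\<^sup>2" for k l
  proof -
    have "(\<integral>\<omega>. w k \<omega> * w l \<omega> \<partial>M) \<le> (\<integral>\<omega>. 4 * K1\<^sup>2 \<partial>M)"
    proof (rule integral_mono[OF iw])
      fix \<omega> assume "\<omega> \<in> space M"
      then have "\<bar>w k \<omega> * w l \<omega>\<bar> \<le> (2 * K1) * (2 * K1)"
        unfolding abs_mult using K1 by (intro mult_mono w_le) auto
      then show "w k \<omega> * w l \<omega> \<le> 4 * K1\<^sup>2" by (simp add: power2_eq_square abs_le_iff)
    qed simp
    then show ?thesis by (simp add: prob_space)
  qed
  \<comment> \<open>The condition \<open>k < l\<close> makes time \<open>Suc k\<close> early enough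
    to predict \<open>y l\<close>, and \<open>n0 \<le> k\<close> makes \<open>w k\<close> measurable
    there.\<close>
  have cov: "(\<integral>\<omega>. w k \<omega> * w l \<omega> \<partial>M) \<le> e\<^sup>2 / 2" if "n0 \<le> k" "k < l" for k l
  proof -
    have [measurable]: "y k \<in> borel_measurable (F (Suc k))" "pred n0 \<in> borel_measurable (F (Suc k))"
      using that by (auto intro: adapted pred_adapted')
    have wF: "w k \<in> borel_measurable (F (Suc k))" unfolding w_def[abs_def] by measurable
    have "integrable M (w k)" by (rule integrable_bounded[OF w_meas w_le])
    then have "(\<integral>\<omega>. w k \<omega> * y l \<omega> \<partial>M) = (\<integral>\<omega>. w k \<omega> * pred (Suc k) \<omega> \<partial>M)"
      using that by (intro expectation_pred wF) auto
    moreover have iy: "integrable M (\<lambda>\<omega>. w k \<omega> * y l \<omega>)"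
      by (rule integrable_bounded_mult[of _ "2 * K1" _ K]) (auto intro: w_le bounded)
    moreover have ip: "integrable M (\<lambda>\<omega>. w k \<omega> * pred j \<omega>)" for j
      by (rule integrable_bounded_mult[of _ "2 * K1" _ K]) (auto intro: w_le abs_pred_le)
    ultimately have "(\<integral>\<omega>. w k \<omega> * w l \<omega> \<partial>M) = (\<integral>\<omega>. w k \<omega> * (pred (Suc k) \<omega> - pred n0 \<omega>) \<partial>M)"
      unfolding w_def[of l] by (simp add: right_diff_distrib)
    also have "\<dots> \<le> sqrt (\<integral>\<omega>. (w k \<omega>)\<^sup>2 \<partial>M) * sqrt (\<integral>\<omega>. (pred (Suc k) \<omega> - pred n0 \<omega>)\<^sup>2 \<partial>M)"
      using Cauchy_Schwarz_integral[OF sqw[of k] sqp[of "Suc k"]] by linarith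
    also have "\<dots> \<le> sqrt ((2 * K1)\<^sup>2) * sqrt d"
      using w2[of k k] less_imp_le[OF n0[of "Suc k"]] that K1
      by (intro mult_mono real_sqrt_le_mono) (auto simp: power2_eq_square)
    also have "\<dots> = e\<^sup>2 / 2"
    proof -
      have "sqrt ((2 * K1)\<^sup>2) = 2 * K1" using K1 by (subst real_sqrt_abs) simp
      then show ?thesis using K1 by (simp only: sd) (simp add: field_simps)
    qed
    finally show ?thesis .
  qed
  have cov': "(\<integral>\<omega>. w k \<omega> * w l \<omega> \<partial>M) \<le> e\<^sup>2 / 2 + 4 * K1\<^sup>2 * (of_bool (k = l) + of_bool (k < n0) + of_bool (l < n0))" for k l
  proof -
    consider "k = l \<or> k < n0 \<or> l < n0" | "n0 \<le> k" "k < l" | "n0 \<le> l" "l < k" by linarith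
    then show ?thesis
    proof cases
      case 1
      have "4 * K1\<^sup>2 * 1 \<le> 4 * K1\<^sup>2 * (of_bool (k = l) + of_bool (k < n0) + of_bool (l < n0))"
        using 1 by (intro mult_left_mono) auto
      then show ?thesis using w2[of k l] zero_le_power2[of e] by linarith
    next
      case 2
      then show ?thesis using cov[OF 2] by simp
    next
      case 3
      then show ?thesis using cov[OF 3] by (simp add: mult.commute)
    qed
  qed
  have second_moment: "(\<integral>\<omega>. (\<Sum>k<n. w k \<omega>)\<^sup>2 \<partial>M) \<le> (real n)\<^sup>2 * (e\<^sup>2 / 2) + 4 * K1\<^sup>2 * ((1 + 2 * real n0) * real n)" for n
  proof -
    have "(\<integral>\<omega>. (\<Sum>k<n. w k \<omega>)\<^sup>2 \<partial>M) = (\<Sum>k<n. \<Sum>l<n. \<integral>\<omega>. w k \<omega> * w l \<omega> \<partial>M)"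
      by (simp add: power2_eq_square sum_product iw)
    also have "\<dots> \<le> (\<Sum>k<n. \<Sum>l<n. e\<^sup>2 / 2 + 4 * K1\<^sup>2 * (of_bool (k = l) + of_bool (k < n0) + of_bool (l < n0)))"
      by (intro sum_mono cov')
    also have "\<dots> = (real n)\<^sup>2 * (e\<^sup>2 / 2) + 4 * K1\<^sup>2 *
        ((\<Sum>k<n. \<Sum>l<n. of_bool (k = l)) + (\<Sum>k<n. \<Sum>l<n. of_bool (k < n0)) + (\<Sum>k<n. \<Sum>l<n. of_bool (l < n0)))"
      by (simp add: sum.distrib sum_distrib_left[symmetric] power2_eq_square)
    also have "\<dots> \<le> (real n)\<^sup>2 * (e\<^sup>2 / 2) + 4 * K1\<^sup>2 * ((1 + 2 * real n0) * real n)"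
    proof -
      have 1: "(\<Sum>k<n. \<Sum>l<n. of_bool (k = l)) = real n"
        by (simp add: of_bool_def)
      have 2: "(\<Sum>l<n. of_bool (l < n0)) \<le> real n0"
      proof -
        have "(\<Sum>l<n. of_bool (l < n0)) = real (card ({..<n} \<inter> {..<n0}))"
          by (simp add: of_bool_def sum.If_cases lessThan_def[symmetric] Int_def)
        also have "\<dots> \<le> real (card {..<n0})" by (intro of_nat_mono card_mono) auto
        finally show ?thesis by simp
      qed
      have "(\<Sum>k<n. \<Sum>l<n. of_bool (k < n0)) = real n * (\<Sum>k<n. of_bool (k < n0))"
        by (simp add: sum_distrib_left)
      then have 3: "(\<Sum>k<n. \<Sum>l<n. of_bool (k < n0)) \<le> real n * real n0"
        using mult_left_mono[OF 2, of "real n"] by (simp add: mult.commute)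
      have 4: "(\<Sum>k<n. \<Sum>l<n. of_bool (l < n0)) \<le> real n * real n0"
        using mult_left_mono[OF 2, of "real n"] by simp
      show ?thesis
        using 1 3 4 by (intro add_left_mono mult_left_mono) (auto simp: algebra_simps)
    qed
    finally show ?thesis .
  qed
  \<comment> \<open>Beyond \<open>n1\<close> the exceptional pairs contribute at most e^2 n^2 / 2,
    as much as the allowance for the other pairs, so the second moment of the sum is at most (e
    n)^2.\<close>
  obtain n1 where n1: "8 * K1\<^sup>2 * (1 + 2 * real n0) / e\<^sup>2 < real n1" using reals_Archimedean2 by blast
  have "(\<integral>\<omega>. \<bar>(\<Sum>k<n. y k \<omega>) / real n - pred n0 \<omega>\<bar> \<partial>M) \<le> e" if n: "n \<ge> max n1 1" for n
  proof -
    define A where "A \<omega> = (\<Sum>k<n. w k \<omega>)" for \<omega>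
    have n': "0 < real n" "real n1 \<le> real n" using n by auto
    have iA: "integrable M (\<lambda>\<omega>. (A \<omega>)\<^sup>2)"
      by (simp add: A_def power2_eq_square sum_product iw)
    have [measurable]: "A \<in> borel_measurable M" unfolding A_def[abs_def] by measurable
    have sqA: "square_integrable M (\<lambda>\<omega>. \<bar>A \<omega>\<bar>)" using iA by (simp add: square_integrable_def)
    have sq1: "square_integrable M (\<lambda>\<omega>. 1)" by (simp add: square_integrable_def)
    have "(\<integral>\<omega>. \<bar>A \<omega>\<bar> * 1 \<partial>M) \<le> sqrt (\<integral>\<omega>. \<bar>A \<omega>\<bar>\<^sup>2 \<partial>M) * sqrt (\<integral>\<omega>. 1\<^sup>2 \<partial>M)"
      using Cauchy_Schwarz_integral[OF sqA sq1] by linarith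
    then have "(\<integral>\<omega>. \<bar>A \<omega>\<bar> \<partial>M) \<le> sqrt (\<integral>\<omega>. (A \<omega>)\<^sup>2 \<partial>M)" by (simp add: prob_space)
    also have "\<dots> \<le> sqrt ((e * real n)\<^sup>2)"
    proof (rule real_sqrt_le_mono)
      have "8 * K1\<^sup>2 * (1 + 2 * real n0) < e\<^sup>2 * real n1"
        using n1 assms by (simp add: field_simps)
      also have "\<dots> \<le> e\<^sup>2 * real n" using n' by (intro mult_left_mono) auto
      finally have "(8 * K1\<^sup>2 * (1 + 2 * real n0)) * real n \<le> (e\<^sup>2 * real n) * real n"
        using n' by (intro mult_right_mono) auto
      then show "(\<integral>\<omega>. (A \<omega>)\<^sup>2 \<partial>M) \<le> (e * real n)\<^sup>2"
        using second_moment[of n] unfolding A_def by (simp add: power2_eq_square algebra_simps)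
    qed
    also have "\<dots> = e * real n" using assms by simp
    finally have "(\<integral>\<omega>. \<bar>A \<omega>\<bar> \<partial>M) / real n \<le> e" using n' by (simp add: field_simps)
    moreover have "\<bar>(\<Sum>k<n. y k \<omega>) / real n - pred n0 \<omega>\<bar> = \<bar>A \<omega>\<bar> / real n" for \<omega>
    proof -
      have "(\<Sum>k<n. y k \<omega>) / real n - pred n0 \<omega> = A \<omega> / real n"
        using n' by (simp add: A_def w_def sum_subtractf field_simps)
      then show ?thesis by simp
    qed
    ultimately show ?thesis by simp
  qed
  then show ?thesis using eventually_sequentially by blast
qed

end

section \<open>Conditionally identically distributed sequences\<close>

lemma space_past_sigma [simp]: "space (past_sigma M N Y n) = space M"
  by (simp add: past_sigma_def space_measure_of_conv)

lemma sets_past_sigma: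
  "sets (past_sigma M N Y n) = sigma_sets (space M) {Y i -` A \<inter> space M | i A. i \<in> {1..n} \<and> A \<in> sets N}"
  unfolding past_sigma_def by (rule sets_measure_of) auto

lemma subalgebra_past_sigma:
  assumes "\<And>n. 1 \<le> n \<Longrightarrow> Y n \<in> measurable M N"
  shows "subalgebra M (past_sigma M N Y n)"
proof -
  have "sigma_sets (space M) {Y i -` A \<inter> space M | i A. i \<in> {1..n} \<and> A \<in> sets N} \<subseteq> sets M"
    using assms by (intro sets.sigma_sets_subset) (auto intro: measurable_sets)
  then show ?thesis by (simp add: subalgebra_def sets_past_sigma)
qed

lemma past_sigma_mono:
  assumes "k \<le> l"
  shows "subalgebra (past_sigma M N Y l) (past_sigma M N Y k)"
proof -
  have "{Y i -` A \<inter> space M | i A. i \<in> {1..k} \<and> A \<in> sets N} \<subseteq> {Y i -` A \<inter> space M | i A. i \<in> {1..l} \<and> A \<in> sets N}"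
    using assms by fastforce
  then show ?thesis by (simp add: subalgebra_def sets_past_sigma sigma_sets_mono')
qed

lemma measurable_past_sigma:
  assumes "Y i \<in> measurable M N" "1 \<le> i" "i \<le> n"
  shows "Y i \<in> measurable (past_sigma M N Y n) N"
proof (rule measurableI)
  show "Y i \<omega> \<in> space N" if "\<omega> \<in> space (past_sigma M N Y n)" for \<omega>
    using that measurable_space[OF assms(1)] by simp
  show "Y i -` A \<inter> space (past_sigma M N Y n) \<in> sets (past_sigma M N Y n)" if "A \<in> sets N" for A
    using that assms(2,3) unfolding sets_past_sigma by (auto intro!: sigma_sets.Basic)
qed

lemma abs_clip_le:
  fixes c x :: real
  assumes "0 \<le> c"
  shows "\<bar>max (- c) (min c x)\<bar> \<le> c" "\<bar>max (- c) (min c x)\<bar> \<le> \<bar>x\<bar>" "\<bar>x - max (- c) (min c x)\<bar> \<le> \<bar>x\<bar>"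
  using assms by (auto simp: max_def min_def abs_if)

lemma clip_tendsto:
  fixes x :: real
  shows "(\<lambda>n. max (- real n) (min (real n) x)) \<longlonglongrightarrow> x"
proof -
  obtain n0 :: nat where "\<bar>x\<bar> < real n0" using reals_Archimedean2 by blast
  then have "\<forall>n\<ge>n0. max (- real n) (min (real n) x) = x" by auto
  then show ?thesis
    by (intro tendsto_eventually) (auto simp: eventually_sequentially)
qed

locale cid_process = prob_space M for M :: "'a measure" +
  fixes N :: "'b measure" and Y :: "nat \<Rightarrow> 'a \<Rightarrow> 'b"
  assumes cid: "cid M N Y"
begin

abbreviation "G \<equiv> past_sigma M N Y"

lemma Y_measurable: "1 \<le> n \<Longrightarrow> Y n \<in> measurable M N"
  using cid by (simp add: cid_def)

lemma subalgebra_G: "subalgebra M (G n)"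
  by (rule subalgebra_past_sigma) (rule Y_measurable)

lemma integral_bounded_cid:
  fixes g :: "'b \<Rightarrow> real"
  assumes g: "g \<in> borel_measurable N" "\<And>x. x \<in> space N \<Longrightarrow> \<bar>g x\<bar> \<le> c"
    and B: "B \<in> borel_measurable (G n)" "integrable M B" and "n < k"
  shows "(\<integral>\<omega>. B \<omega> * g (Y k \<omega>) \<partial>M) = (\<integral>\<omega>. B \<omega> * g (Y (Suc n) \<omega>) \<partial>M)"
proof -
  interpret finite_measure_subalgebra M "G n" by unfold_locales (rule subalgebra_G)
  have bd: "bounded (g ` space N)" using g(2) by (auto simp: bounded_iff intro!: exI[of _ c])
  have [measurable]: "B \<in> borel_measurable M" using B by auto
  have gY: "(\<lambda>\<omega>. g (Y j \<omega>)) \<in> borel_measurable M" if "1 \<le> j" for j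
    using measurable_compose[OF Y_measurable[OF that] g(1)] .
  have i: "integrable M (\<lambda>\<omega>. B \<omega> * g (Y j \<omega>))" if "1 \<le> j" for j
  proof (rule Bochner_Integration.integrable_bound)
    show "integrable M (\<lambda>\<omega>. B \<omega> * c)" using B by simp
    show "AE \<omega> in M. norm (B \<omega> * g (Y j \<omega>)) \<le> norm (B \<omega> * c)"
      using g(2) measurable_space[OF Y_measurable[OF that]]
      by (auto simp: abs_mult intro!: AE_I2 mult_left_mono intro: order_trans[OF _ abs_ge_self])
  qed (use gY[OF that] in measurable)
  have "AE \<omega> in M. real_cond_exp M (G n) (\<lambda>\<omega>. g (Y k \<omega>)) \<omega> = real_cond_exp M (G n) (\<lambda>\<omega>. g (Y (Suc n) \<omega>)) \<omega>"
    using cid g(1) bd \<open>n < k\<close> unfolding cid_def by (metis Suc_eq_plus1)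
  then have "(\<integral>\<omega>. B \<omega> * real_cond_exp M (G n) (\<lambda>\<omega>. g (Y k \<omega>)) \<omega> \<partial>M) =
      (\<integral>\<omega>. B \<omega> * real_cond_exp M (G n) (\<lambda>\<omega>. g (Y (Suc n) \<omega>)) \<omega> \<partial>M)"
    by (intro integral_cong_AE) auto
  then show ?thesis
    using real_cond_exp_intg(2)[OF i B(1) gY] \<open>n < k\<close> by simp
qed

lemma same_law:
  assumes "1 \<le> k"
  shows "distr M N (Y k) = distr M N (Y 1)"
proof (rule measure_eqI)
  fix A assume "A \<in> sets (distr M N (Y k))"
  then have A: "A \<in> sets N" by simp
  \<comment> \<open>The case \<open>n = 0\<close> of the c.i.d. property: the past is trivial and
    the multiplier is the constant 1.\<close>
  have "(\<integral>\<omega>. 1 * indicator A (Y k \<omega>) \<partial>M) = (\<integral>\<omega>. 1 * (indicator A (Y (Suc 0) \<omega>) :: real) \<partial>M)"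
    using assms A by (intro integral_bounded_cid[of _ 1]) (auto simp: indicator_def)
  moreover have "(\<integral>\<omega>. (indicator A (Y j \<omega>) :: real) \<partial>M) = measure (distr M N (Y j)) A" if "1 \<le> j" for j
  proof -
    have "(\<integral>\<omega>. (indicator A (Y j \<omega>) :: real) \<partial>M) = (\<integral>x. indicator A x \<partial>distr M N (Y j))"
      using A by (intro integral_distr[symmetric] Y_measurable that) auto
    then show ?thesis using A by simp
  qed
  ultimately have "measure (distr M N (Y k)) A = measure (distr M N (Y 1)) A"
    using assms by simp
  moreover have "finite_measure (distr M N (Y j))" if "1 \<le> j" for j
    by (rule finite_measure_distr[OF Y_measurable[OF that]])
  ultimately show "emeasure (distr M N (Y k)) A = emeasure (distr M N (Y 1)) A"
    using assms by (simp add: finite_measure.emeasure_eq_measure)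
qed simp

lemma same_law_integral:
  fixes g :: "'b \<Rightarrow> real"
  assumes g: "g \<in> borel_measurable N" and k: "1 \<le> k"
  shows "(\<integral>\<omega>. g (Y k \<omega>) \<partial>M) = (\<integral>\<omega>. g (Y 1 \<omega>) \<partial>M)"
    and "integrable M (\<lambda>\<omega>. g (Y k \<omega>)) \<longleftrightarrow> integrable M (\<lambda>\<omega>. g (Y 1 \<omega>))"
  using integral_distr[OF Y_measurable g, of k] integral_distr[OF Y_measurable g, of 1]
    integrable_distr_eq[OF Y_measurable g, of k] integrable_distr_eq[OF Y_measurable g, of 1]
    same_law[OF k] k by auto

text \<open>Compared with \<open>integral_bounded_cid\<close> the roles are exchanged: the
  multiplier is bounded and \<open>g\<close> only integrable. Clipping \<open>g\<close> reduces to
  the bounded case, and the equality of laws makes the dominating functions integrable.\<close>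

lemma integral_cid:
  fixes g :: "'b \<Rightarrow> real" and b :: real
  assumes g: "g \<in> borel_measurable N" "integrable M (\<lambda>\<omega>. g (Y 1 \<omega>))"
    and B: "B \<in> borel_measurable (G n)" "\<And>\<omega>. \<bar>B \<omega>\<bar> \<le> b" and "n < k"
  shows "(\<integral>\<omega>. B \<omega> * g (Y k \<omega>) \<partial>M) = (\<integral>\<omega>. B \<omega> * g (Y (Suc n) \<omega>) \<partial>M)"
proof -
  have BM [measurable]: "B \<in> borel_measurable M" by (rule measurable_from_subalg[OF subalgebra_G B(1)])
  have iB: "integrable M B" using B(2) by (intro integrable_const_bound[of _ b]) auto
  let ?c = "\<lambda>i x. max (- real i) (min (real i) (g x))"
  have lim: "(\<lambda>i. \<integral>\<omega>. B \<omega> * ?c i (Y j \<omega>) \<partial>M) \<longlonglongrightarrow> (\<integral>\<omega>. B \<omega> * g (Y j \<omega>) \<partial>M)" if "1 \<le> j" for j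
  proof (rule integral_dominated_convergence)
    show "integrable M (\<lambda>\<omega>. b * \<bar>g (Y j \<omega>)\<bar>)"
      using g same_law_integral(2)[OF g(1) that] by simp
    show "AE \<omega> in M. (\<lambda>i. B \<omega> * ?c i (Y j \<omega>)) \<longlonglongrightarrow> B \<omega> * g (Y j \<omega>)"
      by (intro AE_I2 tendsto_intros clip_tendsto)
    show "AE \<omega> in M. norm (B \<omega> * ?c i (Y j \<omega>)) \<le> b * \<bar>g (Y j \<omega>)\<bar>" for i
      unfolding real_norm_def abs_mult using B(2) abs_clip_le(2)
      by (intro AE_I2 mult_mono) (auto intro: order_trans[OF abs_ge_zero])
  qed (use measurable_compose[OF Y_measurable[OF that] g(1)] in measurable)
  have "(\<integral>\<omega>. B \<omega> * ?c i (Y k \<omega>) \<partial>M) = (\<integral>\<omega>. B \<omega> * ?c i (Y (Suc n) \<omega>) \<partial>M)" for i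
    using \<open>n < k\<close> g(1) abs_clip_le(1) by (intro integral_bounded_cid[of _ "real i"] B iB) auto
  then show ?thesis
    using LIMSEQ_unique[OF lim[of k]] lim[of "Suc n"] \<open>n < k\<close> by simp
qed

text \<open>The shift reconciles the two indexings: the past at time \<open>k\<close> is generated
  by Y_1, ..., Y_k, and the next value is Y_(k+1).\<close>

lemma bounded_cid_process_of_bounded:
  assumes h: "h \<in> borel_measurable N" "\<And>x. x \<in> space N \<Longrightarrow> \<bar>h x\<bar> \<le> K"
  shows "bounded_cid_process M G (\<lambda>k \<omega>. h (Y (Suc k) \<omega>)) K"
proof
  show "subalgebra M (G k)" for k by (rule subalgebra_G)
  show "subalgebra (G l) (G k)" if "k \<le> l" for k l by (rule past_sigma_mono[OF that])
  show "(\<lambda>\<omega>. h (Y (Suc j) \<omega>)) \<in> borel_measurable (G k)" if "j < k" for j k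
    by (rule measurable_compose[OF measurable_past_sigma h(1)]) (use that in \<open>auto intro: Y_measurable\<close>)
  show "\<bar>h (Y (Suc k) \<omega>)\<bar> \<le> K" if "\<omega> \<in> space M" for k \<omega>
    using measurable_space[OF Y_measurable that, of "Suc k"] h(2) by simp
  show "(\<integral>\<omega>. B \<omega> * h (Y (Suc k) \<omega>) \<partial>M) = (\<integral>\<omega>. B \<omega> * h (Y (Suc j) \<omega>) \<partial>M)"
    if "B \<in> borel_measurable (G j)" "integrable M B" "j \<le> k" for j k B
    using that by (intro integral_bounded_cid[OF h]) auto
qed

text \<open>Clipping at a high level costs at most e / 2 in L1 for every average alike, because all
  terms have the law of \<open>Y 1\<close>. The witness \<open>g\<close> is a prediction for the
  clipped function and may depend on \<open>e\<close>.\<close>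

lemma averages_near_integrable:
  assumes h: "h \<in> borel_measurable N" "integrable M (\<lambda>\<omega>. h (Y 1 \<omega>))" and e: "0 < e"
  shows "\<exists>g. integrable M g \<and>
    (\<forall>\<^sub>F n in sequentially. (\<integral>\<omega>. \<bar>(\<Sum>k<n. h (Y (Suc k) \<omega>)) / real n - g \<omega>\<bar> \<partial>M) \<le> e)"
proof -
  let ?c = "\<lambda>i x. max (- real i) (min (real i) (h x))"
  have hY [measurable]: "(\<lambda>\<omega>. h (Y (Suc j) \<omega>)) \<in> borel_measurable M" for j
    using measurable_compose[OF Y_measurable h(1)] by simp
  have hi [simp]: "integrable M (\<lambda>\<omega>. h (Y (Suc j) \<omega>))" for j
    using same_law_integral(2)[OF h(1), of "Suc j"] h(2) by simp
  have ci [simp]: "integrable M (\<lambda>\<omega>. ?c i (Y (Suc j) \<omega>))" for i j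
    by (rule Bochner_Integration.integrable_bound[OF hi[of j]]) (auto intro!: AE_I2 abs_clip_le)
  have "(\<lambda>i. \<integral>\<omega>. \<bar>h (Y 1 \<omega>) - ?c i (Y 1 \<omega>)\<bar> \<partial>M) \<longlonglongrightarrow> (\<integral>\<omega>. \<bar>h (Y 1 \<omega>) - h (Y 1 \<omega>)\<bar> \<partial>M)"
  proof (rule integral_dominated_convergence[where w="\<lambda>\<omega>. \<bar>h (Y 1 \<omega>)\<bar>"])
    show "AE \<omega> in M. (\<lambda>i. \<bar>h (Y 1 \<omega>) - ?c i (Y 1 \<omega>)\<bar>) \<longlonglongrightarrow> \<bar>h (Y 1 \<omega>) - h (Y 1 \<omega>)\<bar>"
      by (intro AE_I2 tendsto_intros clip_tendsto)
    show "AE \<omega> in M. norm \<bar>h (Y 1 \<omega>) - ?c i (Y 1 \<omega>)\<bar> \<le> \<bar>h (Y 1 \<omega>)\<bar>" for i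
      by (auto intro!: AE_I2 abs_clip_le)
  qed (use h hY[of 0] in auto)
  then have "(\<lambda>i. \<integral>\<omega>. \<bar>h (Y 1 \<omega>) - ?c i (Y 1 \<omega>)\<bar> \<partial>M) \<longlonglongrightarrow> 0" by simp
  from LIMSEQ_D[OF this, of "e / 2"] e obtain i where
    i: "(\<integral>\<omega>. \<bar>h (Y 1 \<omega>) - ?c i (Y 1 \<omega>)\<bar> \<partial>M) < e / 2" by auto
  have cm: "(\<lambda>x. ?c i x) \<in> borel_measurable N" using h(1) by measurable
  interpret b: bounded_cid_process M G "\<lambda>k \<omega>. ?c i (Y (Suc k) \<omega>)" "real i"
    by (rule bounded_cid_process_of_bounded[OF cm abs_clip_le(1)]) simp
  obtain n0 where n0: "\<forall>\<^sub>F n in sequentially.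
      (\<integral>\<omega>. \<bar>(\<Sum>k<n. ?c i (Y (Suc k) \<omega>)) / real n - b.pred n0 \<omega>\<bar> \<partial>M) \<le> e / 2"
    using b.averages_near_prediction[of "e / 2"] e by auto
  have [simp]: "integrable M (b.pred n0)" by (rule b.integrable_pred)
  show ?thesis
  proof (intro exI[of _ "b.pred n0"] conjI)
    show "\<forall>\<^sub>F n in sequentially. (\<integral>\<omega>. \<bar>(\<Sum>k<n. h (Y (Suc k) \<omega>)) / real n - b.pred n0 \<omega>\<bar> \<partial>M) \<le> e"
      using n0 eventually_gt_at_top[of 0]
    proof eventually_elim
      case (elim n)
      let ?H = "\<lambda>\<omega>. (\<Sum>k<n. \<bar>h (Y (Suc k) \<omega>) - ?c i (Y (Suc k) \<omega>)\<bar>) / real n"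
      let ?C = "\<lambda>\<omega>. \<bar>(\<Sum>k<n. ?c i (Y (Suc k) \<omega>)) / real n - b.pred n0 \<omega>\<bar>"
      have "(\<integral>\<omega>. \<bar>(\<Sum>k<n. h (Y (Suc k) \<omega>)) / real n - b.pred n0 \<omega>\<bar> \<partial>M) \<le> (\<integral>\<omega>. ?H \<omega> + ?C \<omega> \<partial>M)"
      proof (rule integral_mono)
        fix \<omega>
        have "\<bar>(\<Sum>k<n. h (Y (Suc k) \<omega>)) / real n - (\<Sum>k<n. ?c i (Y (Suc k) \<omega>)) / real n\<bar> =
            \<bar>\<Sum>k<n. h (Y (Suc k) \<omega>) - ?c i (Y (Suc k) \<omega>)\<bar> / real n"
          by (simp add: sum_subtractf diff_divide_distrib[symmetric])
        also have "\<dots> \<le> ?H \<omega>" by (intro divide_right_mono sum_abs) simp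
        finally show "\<bar>(\<Sum>k<n. h (Y (Suc k) \<omega>)) / real n - b.pred n0 \<omega>\<bar> \<le> ?H \<omega> + ?C \<omega>" by linarith
      qed auto
      also have "\<dots> = (\<Sum>k<n. \<integral>\<omega>. \<bar>h (Y (Suc k) \<omega>) - ?c i (Y (Suc k) \<omega>)\<bar> \<partial>M) / real n + (\<integral>\<omega>. ?C \<omega> \<partial>M)"
        by simp
      also have "(\<Sum>k<n. \<integral>\<omega>. \<bar>h (Y (Suc k) \<omega>) - ?c i (Y (Suc k) \<omega>)\<bar> \<partial>M) =
          (\<Sum>k<n. \<integral>\<omega>. \<bar>h (Y 1 \<omega>) - ?c i (Y 1 \<omega>)\<bar> \<partial>M)"
        using h(1) cm by (intro sum.cong refl same_law_integral(1)[of "\<lambda>x. \<bar>h x - ?c i x\<bar>"]) auto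
      also have "\<dots> / real n \<le> e / 2" using i elim by simp
      finally show ?case using elim by simp
    qed
  qed simp
qed

text \<open>The averages are eventually close to some \<open>g\<close> in L1, and they converge
  weakly to \<open>V\<close>. As the L1 norm is lower semicontinuous under weak convergence,
  \<open>V\<close> is equally close to \<open>g\<close>, hence to the averages.\<close>

theorem L1_law_of_large_numbers:
  assumes h: "h \<in> borel_measurable N" "integrable M (\<lambda>\<omega>. h (Y 1 \<omega>))"
    and V: "weak_L1_limit M (\<lambda>n \<omega>. h (Y n \<omega>)) V"
  shows "(\<lambda>n. \<integral>\<omega>. \<bar>(\<Sum>k<n. h (Y (Suc k) \<omega>)) / real n - V \<omega>\<bar> \<partial>M) \<longlonglongrightarrow> 0"
proof (rule LIMSEQ_I)
  fix r :: real assume r: "0 < r"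
  define D where "D n \<omega> = (\<Sum>k<n. h (Y (Suc k) \<omega>)) / real n" for n \<omega>
  have iV [simp]: "integrable M V" using V by (simp add: weak_L1_limit_def)
  have ih [simp]: "integrable M (\<lambda>\<omega>. h (Y (Suc k) \<omega>))" for k
    using V by (auto simp: weak_L1_limit_def)
  have iD [simp]: "integrable M (D n)" for n by (simp add: D_def[abs_def])
  obtain g where ig [simp]: "integrable M g" and g: "\<forall>\<^sub>F n in sequentially. (\<integral>\<omega>. \<bar>D n \<omega> - g \<omega>\<bar> \<partial>M) \<le> r / 3"
    using averages_near_integrable[OF h, of "r / 3"] r by (auto simp: D_def)
  have [measurable]: "V \<in> borel_measurable M" "g \<in> borel_measurable M"
    by (intro borel_measurable_integrable iV ig)+
  \<comment> \<open>The bounded test function that attains the L1 norm of V - g.\<close>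
  define B where "B \<omega> = sgn (V \<omega> - g \<omega>)" for \<omega>
  have [measurable]: "B \<in> borel_measurable M" unfolding B_def[abs_def] by measurable
  have B1: "\<bar>B \<omega>\<bar> \<le> 1" for \<omega> by (simp add: B_def abs_sgn_eq)
  have iB: "integrable M (\<lambda>\<omega>. q \<omega> * B \<omega>)" if "integrable M q" for q :: "'a \<Rightarrow> real"
    using that B1 by (intro Bochner_Integration.integrable_bound[OF that]) (auto simp: abs_mult mult_left_le)
  have "bounded (B ` space M)" using B1 by (auto simp: bounded_iff)
  then have "(\<lambda>n. \<integral>\<omega>. h (Y n \<omega>) * B \<omega> \<partial>M) \<longlonglongrightarrow> (\<integral>\<omega>. V \<omega> * B \<omega> \<partial>M)"
    using V by (simp add: weak_L1_limit_def)
  then have "(\<lambda>n. \<integral>\<omega>. h (Y (Suc n) \<omega>) * B \<omega> \<partial>M) \<longlonglongrightarrow> (\<integral>\<omega>. V \<omega> * B \<omega> \<partial>M)"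
    by (rule LIMSEQ_Suc)
  from cesaro_mean[OF this] have "(\<lambda>n. \<integral>\<omega>. D n \<omega> * B \<omega> \<partial>M) \<longlonglongrightarrow> (\<integral>\<omega>. V \<omega> * B \<omega> \<partial>M)"
    by (simp add: D_def sum_distrib_right iB[OF ih])
  then have lim: "(\<lambda>n. (\<integral>\<omega>. D n \<omega> * B \<omega> \<partial>M) - (\<integral>\<omega>. g \<omega> * B \<omega> \<partial>M)) \<longlonglongrightarrow>
      (\<integral>\<omega>. V \<omega> * B \<omega> \<partial>M) - (\<integral>\<omega>. g \<omega> * B \<omega> \<partial>M)"
    by (intro tendsto_intros)
  have "(\<integral>\<omega>. V \<omega> * B \<omega> \<partial>M) - (\<integral>\<omega>. g \<omega> * B \<omega> \<partial>M) \<le> r / 3"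
  proof (rule tendsto_upperbound[OF lim _ sequentially_bot])
    show "\<forall>\<^sub>F n in sequentially. (\<integral>\<omega>. D n \<omega> * B \<omega> \<partial>M) - (\<integral>\<omega>. g \<omega> * B \<omega> \<partial>M) \<le> r / 3"
      using g
    proof eventually_elim
      case (elim n)
      have "(\<integral>\<omega>. D n \<omega> * B \<omega> \<partial>M) - (\<integral>\<omega>. g \<omega> * B \<omega> \<partial>M) = (\<integral>\<omega>. (D n \<omega> - g \<omega>) * B \<omega> \<partial>M)"
        by (simp add: iB left_diff_distrib)
      also have "\<dots> \<le> (\<integral>\<omega>. \<bar>D n \<omega> - g \<omega>\<bar> \<partial>M)"
      proof (rule integral_mono)
        show "(D n \<omega> - g \<omega>) * B \<omega> \<le> \<bar>D n \<omega> - g \<omega>\<bar>" for \<omega>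
          using mult_left_le[of "\<bar>B \<omega>\<bar>" "\<bar>D n \<omega> - g \<omega>\<bar>"] B1[of \<omega>] abs_ge_self[of "(D n \<omega> - g \<omega>) * B \<omega>"]
          by (simp add: abs_mult)
      qed (auto intro: iB)
      finally show ?case using elim by simp
    qed
  qed
  also have "(\<integral>\<omega>. V \<omega> * B \<omega> \<partial>M) - (\<integral>\<omega>. g \<omega> * B \<omega> \<partial>M) = (\<integral>\<omega>. (V \<omega> - g \<omega>) * B \<omega> \<partial>M)"
    by (simp add: iB left_diff_distrib)
  also have "\<dots> = (\<integral>\<omega>. \<bar>V \<omega> - g \<omega>\<bar> \<partial>M)"
    by (simp add: B_def abs_sgn[symmetric])
  finally have Vg: "(\<integral>\<omega>. \<bar>V \<omega> - g \<omega>\<bar> \<partial>M) \<le> r / 3" .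
  have "\<forall>\<^sub>F n in sequentially. norm ((\<integral>\<omega>. \<bar>D n \<omega> - V \<omega>\<bar> \<partial>M) - 0) < r"
    using g
  proof eventually_elim
    case (elim n)
    have "(\<integral>\<omega>. \<bar>D n \<omega> - V \<omega>\<bar> \<partial>M) \<le> (\<integral>\<omega>. \<bar>D n \<omega> - g \<omega>\<bar> + \<bar>V \<omega> - g \<omega>\<bar> \<partial>M)"
      by (intro integral_mono) auto
    also have "\<dots> \<le> r / 3 + r / 3" using elim Vg by simp
    also have "\<dots> < r" using r by simp
    finally show ?case by simp
  qed
  then show "\<exists>no. \<forall>n\<ge>no. norm ((\<integral>\<omega>. \<bar>(\<Sum>k<n. h (Y (Suc k) \<omega>)) / real n - V \<omega>\<bar> \<partial>M) - 0) < r"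
    by (simp add: eventually_sequentially D_def)
qed

end

section \<open>The central limit theorem for centred c.i.d. sequences\<close>

text \<open>The weak limit is tested against truncations of itself, which bounds their second
  moments by \<open>c\<close>; monotone convergence removes the truncation.\<close>

lemma (in prob_space) square_integrable_weak_limit:
  assumes Z: "\<And>n. 1 \<le> n \<Longrightarrow> square_integrable M (Z n)" "\<And>n. 1 \<le> n \<Longrightarrow> (\<integral>\<omega>. (Z n \<omega>)\<^sup>2 \<partial>M) \<le> c"
    and V: "weak_L1_limit M Z V"
  shows "square_integrable M V"
proof -
  have [simp]: "integrable M V" using V by (simp add: weak_L1_limit_def)
  then have [measurable]: "V \<in> borel_measurable M" by (rule borel_measurable_integrable)
  \<comment> \<open>Cut to 0 rather than clipped, so that V times B equals B^2.\<close>
  define B where "B i \<omega> = (if \<bar>V \<omega>\<bar> \<le> real i then V \<omega> else 0)" for i :: nat and \<omega>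
  have Bm [measurable]: "B i \<in> borel_measurable M" for i unfolding B_def[abs_def] by measurable
  have B_le: "\<bar>B i \<omega>\<bar> \<le> real i" for i \<omega> by (simp add: B_def)
  have iB2: "integrable M (\<lambda>\<omega>. (B i \<omega>)\<^sup>2)" for i
    by (rule integrable_const_bound[of _ "(real i)\<^sup>2"]) (auto intro!: AE_I2 power2_le_iff_abs_le[THEN iffD2] B_le)
  have sqB: "square_integrable M (B i)" for i using iB2 by (simp add: square_integrable_def)
  have B2: "(\<integral>\<omega>. (B i \<omega>)\<^sup>2 \<partial>M) \<le> c" for i
  proof -
    have "bounded (B i ` space M)" using B_le by (auto simp: bounded_iff intro!: exI[of _ "real i"])
    then have "(\<lambda>n. \<integral>\<omega>. Z n \<omega> * B i \<omega> \<partial>M) \<longlonglongrightarrow> (\<integral>\<omega>. V \<omega> * B i \<omega> \<partial>M)"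
      using V by (simp add: weak_L1_limit_def)
    also have "(\<integral>\<omega>. V \<omega> * B i \<omega> \<partial>M) = (\<integral>\<omega>. (B i \<omega>)\<^sup>2 \<partial>M)"
      by (rule Bochner_Integration.integral_cong) (auto simp: B_def power2_eq_square)
    \<comment> \<open>From 2 Z B \<le> Z^2 + B^2. The second moment of \<open>B\<close> on the
      right, finite by truncation, is absorbed on the left.\<close>
    finally have "(\<integral>\<omega>. (B i \<omega>)\<^sup>2 \<partial>M) \<le> (c + (\<integral>\<omega>. (B i \<omega>)\<^sup>2 \<partial>M)) / 2"
    proof (rule LIMSEQ_le_const2, intro exI[of _ 1] allI impI)
      fix n :: nat assume n: "1 \<le> n"
      have "(\<integral>\<omega>. Z n \<omega> * B i \<omega> \<partial>M) \<le> (\<integral>\<omega>. ((Z n \<omega>)\<^sup>2 + (B i \<omega>)\<^sup>2) / 2 \<partial>M)"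
      proof (rule integral_mono[OF square_integrable_mult[OF Z(1)[OF n] sqB]])
        show "integrable M (\<lambda>\<omega>. ((Z n \<omega>)\<^sup>2 + (B i \<omega>)\<^sup>2) / 2)"
          using Z(1)[OF n] iB2 by (simp add: square_integrable_def)
        show "Z n \<omega> * B i \<omega> \<le> ((Z n \<omega>)\<^sup>2 + (B i \<omega>)\<^sup>2) / 2" for \<omega>
          using sum_squares_bound[of "Z n \<omega>" "B i \<omega>"] by simp
      qed
      also have "\<dots> = ((\<integral>\<omega>. (Z n \<omega>)\<^sup>2 \<partial>M) + (\<integral>\<omega>. (B i \<omega>)\<^sup>2 \<partial>M)) / 2"
        using Z(1)[OF n] iB2 by (simp add: square_integrable_def)
      also have "\<dots> \<le> (c + (\<integral>\<omega>. (B i \<omega>)\<^sup>2 \<partial>M)) / 2" using Z(2)[OF n] by simp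
      finally show "(\<integral>\<omega>. Z n \<omega> * B i \<omega> \<partial>M) \<le> (c + (\<integral>\<omega>. (B i \<omega>)\<^sup>2 \<partial>M)) / 2" .
    qed
    then show ?thesis by simp
  qed
  have mono: "mono (\<lambda>i. (B i \<omega>)\<^sup>2)" for \<omega>
    by (intro monoI) (auto simp: B_def)
  have lim: "(\<lambda>i. (B i \<omega>)\<^sup>2) \<longlonglongrightarrow> (V \<omega>)\<^sup>2" for \<omega>
  proof -
    obtain i0 :: nat where "\<bar>V \<omega>\<bar> < real i0" using reals_Archimedean2 by blast
    then have "\<forall>i\<ge>i0. (B i \<omega>)\<^sup>2 = (V \<omega>)\<^sup>2" by (auto simp: B_def)
    then show ?thesis by (intro tendsto_eventually) (auto simp: eventually_sequentially)
  qed
  have "incseq (\<lambda>i. \<integral>\<omega>. (B i \<omega>)\<^sup>2 \<partial>M)"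
    using mono iB2 by (intro incseq_SucI integral_mono) (auto simp: mono_def)
  then obtain x where "(\<lambda>i. \<integral>\<omega>. (B i \<omega>)\<^sup>2 \<partial>M) \<longlonglongrightarrow> x"
    using incseq_convergent B2 by blast
  then have "integrable M (\<lambda>\<omega>. (V \<omega>)\<^sup>2)"
    by (rule integrable_monotone_convergence[OF iB2 AE_I2[OF mono] AE_I2[OF lim]]) simp
  then show ?thesis by (simp add: square_integrable_def)
qed

text \<open>Bounded multipliers are dense in L2 by clipping, and the L2 bound on Z_n - V makes the
  error uniform in \<open>n\<close>. This serves the cross term in the square of f(X_n) - V_f, whose
  multiplier involves \<open>V_f\<close> and may be unbounded.\<close>

lemma (in prob_space) weak_L1_limit_square_integrable_multiplier:
  assumes Z: "\<And>n. 1 \<le> n \<Longrightarrow> square_integrable M (Z n)" "\<And>n. 1 \<le> n \<Longrightarrow> (\<integral>\<omega>. (Z n \<omega>)\<^sup>2 \<partial>M) \<le> c"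
    and V: "weak_L1_limit M Z V" and W: "square_integrable M W"
  shows "(\<lambda>n. \<integral>\<omega>. Z n \<omega> * W \<omega> \<partial>M) \<longlonglongrightarrow> (\<integral>\<omega>. V \<omega> * W \<omega> \<partial>M)"
proof (rule LIMSEQ_I)
  fix r :: real assume r: "0 < r"
  have sqV: "square_integrable M V" by (rule square_integrable_weak_limit[OF Z V])
  have [measurable]: "W \<in> borel_measurable M" and iW: "integrable M (\<lambda>\<omega>. (W \<omega>)\<^sup>2)"
    using W by (auto simp: square_integrable_def)
  define C where "C = 2 * c + 2 * (\<integral>\<omega>. (V \<omega>)\<^sup>2 \<partial>M)"
  have sqU: "square_integrable M (\<lambda>\<omega>. Z n \<omega> - V \<omega>)" if "1 \<le> n" for n
    by (intro square_integrable_diff Z that sqV)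
  have U2: "(\<integral>\<omega>. (Z n \<omega> - V \<omega>)\<^sup>2 \<partial>M) \<le> C" if n: "1 \<le> n" for n
  proof -
    have i: "integrable M (\<lambda>\<omega>. (Z n \<omega>)\<^sup>2)" "integrable M (\<lambda>\<omega>. (V \<omega>)\<^sup>2)"
      using Z(1)[OF n] sqV by (auto simp: square_integrable_def)
    have "(\<integral>\<omega>. (Z n \<omega> - V \<omega>)\<^sup>2 \<partial>M) \<le> (\<integral>\<omega>. 2 * (Z n \<omega>)\<^sup>2 + 2 * (V \<omega>)\<^sup>2 \<partial>M)"
    proof (rule integral_mono)
      show "(a - b)\<^sup>2 \<le> 2 * a\<^sup>2 + 2 * b\<^sup>2" for a b :: real
        using zero_le_power2[of "a + b"] by (simp add: power2_eq_square algebra_simps)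
    qed (use sqU[OF n] i in \<open>auto simp: square_integrable_def\<close>)
    also have "\<dots> \<le> C" using i Z(2)[OF n] by (simp add: C_def)
    finally show ?thesis .
  qed
  have "0 \<le> (\<integral>\<omega>. (Z 1 \<omega> - V \<omega>)\<^sup>2 \<partial>M)" by simp
  then have C0: "0 \<le> C" using U2[of 1] by linarith
  let ?c = "\<lambda>i \<omega>. max (- real i) (min (real i) (W \<omega>))"
  have "(\<lambda>i. \<integral>\<omega>. (W \<omega> - ?c i \<omega>)\<^sup>2 \<partial>M) \<longlonglongrightarrow> (\<integral>\<omega>. (W \<omega> - W \<omega>)\<^sup>2 \<partial>M)"
  proof (rule integral_dominated_convergence[OF _ _ iW])
    show "AE \<omega> in M. (\<lambda>i. (W \<omega> - ?c i \<omega>)\<^sup>2) \<longlonglongrightarrow> (W \<omega> - W \<omega>)\<^sup>2"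
      by (intro AE_I2 tendsto_intros clip_tendsto)
    show "AE \<omega> in M. norm ((W \<omega> - ?c i \<omega>)\<^sup>2) \<le> (W \<omega>)\<^sup>2" for i
      using abs_clip_le(3)[of "real i"] by (auto intro!: AE_I2 simp: abs_le_square_iff[symmetric])
  qed auto
  then have "(\<lambda>i. sqrt C * sqrt (\<integral>\<omega>. (W \<omega> - ?c i \<omega>)\<^sup>2 \<partial>M)) \<longlonglongrightarrow> sqrt C * sqrt (\<integral>\<omega>. (W \<omega> - W \<omega>)\<^sup>2 \<partial>M)"
    by (intro tendsto_intros)
  then have "(\<lambda>i. sqrt C * sqrt (\<integral>\<omega>. (W \<omega> - ?c i \<omega>)\<^sup>2 \<partial>M)) \<longlonglongrightarrow> 0" by simp
  from LIMSEQ_D[OF this, of "r / 2"] r C0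
  obtain i where i: "sqrt C * sqrt (\<integral>\<omega>. (W \<omega> - ?c i \<omega>)\<^sup>2 \<partial>M) < r / 2" by fastforce
  define B where "B = ?c i"
  have [measurable]: "B \<in> borel_measurable M" unfolding B_def by measurable
  have B_le: "\<bar>B \<omega>\<bar> \<le> real i" for \<omega> unfolding B_def by (rule abs_clip_le) simp
  have sqB: "square_integrable M B"
    using integrable_const_bound[of "\<lambda>\<omega>. (B \<omega>)\<^sup>2" "(real i)\<^sup>2"] B_le power2_le_iff_abs_le[of "real i"]
    by (simp add: square_integrable_def)
  have sqWB: "square_integrable M (\<lambda>\<omega>. W \<omega> - B \<omega>)" by (rule square_integrable_diff[OF W sqB])
  have "bounded (B ` space M)" using B_le by (auto simp: bounded_iff intro!: exI[of _ "real i"])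
  then have "(\<lambda>n. \<integral>\<omega>. Z n \<omega> * B \<omega> \<partial>M) \<longlonglongrightarrow> (\<integral>\<omega>. V \<omega> * B \<omega> \<partial>M)"
    using V by (simp add: weak_L1_limit_def)
  from LIMSEQ_D[OF this, of "r / 2"] r obtain n0 where
    n0: "\<And>n. n \<ge> n0 \<Longrightarrow> \<bar>(\<integral>\<omega>. Z n \<omega> * B \<omega> \<partial>M) - (\<integral>\<omega>. V \<omega> * B \<omega> \<partial>M)\<bar> < r / 2" by auto
  have "norm ((\<integral>\<omega>. Z n \<omega> * W \<omega> \<partial>M) - (\<integral>\<omega>. V \<omega> * W \<omega> \<partial>M)) < r" if n: "n \<ge> max n0 1" for n
  proof -
    have n1: "1 \<le> n" "n0 \<le> n" using n by auto
    note ints = square_integrable_mult[OF Z(1)[OF n1(1)] sqB] square_integrable_mult[OF sqV sqB]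
      square_integrable_mult[OF Z(1)[OF n1(1)] W] square_integrable_mult[OF sqV W]
    have "(\<integral>\<omega>. (Z n \<omega> - V \<omega>) * (W \<omega> - B \<omega>) \<partial>M) =
        (\<integral>\<omega>. Z n \<omega> * W \<omega> - V \<omega> * W \<omega> - (Z n \<omega> * B \<omega> - V \<omega> * B \<omega>) \<partial>M)"
      by (simp add: algebra_simps)
    also have "\<dots> = (\<integral>\<omega>. Z n \<omega> * W \<omega> \<partial>M) - (\<integral>\<omega>. V \<omega> * W \<omega> \<partial>M) - ((\<integral>\<omega>. Z n \<omega> * B \<omega> \<partial>M) - (\<integral>\<omega>. V \<omega> * B \<omega> \<partial>M))"
      using ints by simp
    finally have eq: "(\<integral>\<omega>. (Z n \<omega> - V \<omega>) * (W \<omega> - B \<omega>) \<partial>M) = \<dots>" .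
    have "\<bar>\<integral>\<omega>. (Z n \<omega> - V \<omega>) * (W \<omega> - B \<omega>) \<partial>M\<bar> \<le>
        sqrt (\<integral>\<omega>. (Z n \<omega> - V \<omega>)\<^sup>2 \<partial>M) * sqrt (\<integral>\<omega>. (W \<omega> - B \<omega>)\<^sup>2 \<partial>M)"
      by (rule Cauchy_Schwarz_integral[OF sqU[OF n1(1)] sqWB])
    also have "\<dots> \<le> sqrt C * sqrt (\<integral>\<omega>. (W \<omega> - B \<omega>)\<^sup>2 \<partial>M)"
      using U2[OF n1(1)] by (intro mult_right_mono real_sqrt_le_mono) auto
    also have "\<dots> < r / 2" using i by (simp add: B_def)
    finally show ?thesis using n0[OF n1(2)] unfolding eq real_norm_def by linarith
  qed
  then show "\<exists>no. \<forall>n\<ge>no. norm ((\<integral>\<omega>. Z n \<omega> * W \<omega> \<partial>M) - (\<integral>\<omega>. V \<omega> * W \<omega> \<partial>M)) < r" by blast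
qed

text \<open>For an event of the past at time \<open>k\<close>, the integral of Y_j over it is the
  same for all j > k, and it tends to 0 by the weak limit. So it is 0 from the start, and the next
  value has conditional mean 0.\<close>

lemma (in prob_space) centred_cid_martingale_differences:
  assumes Y: "cid M borel Y" and sq: "integrable M (\<lambda>\<omega>. (Y 1 \<omega>)\<^sup>2)" and V: "weak_L1_limit M Y (\<lambda>_. 0)"
  shows "martingale_differences M (past_sigma M borel Y) (\<lambda>k. Y (Suc k))"
proof -
  interpret Y: cid_process M borel Y by unfold_locales (rule Y)
  show ?thesis
  proof unfold_locales
    show "subalgebra M (Y.G k)" for k by (rule Y.subalgebra_G)
    show "subalgebra (Y.G l) (Y.G k)" if "k \<le> l" for k l by (rule past_sigma_mono[OF that])
    show "Y (Suc j) \<in> borel_measurable (Y.G k)" if "j < k" for j k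
      using that by (intro measurable_past_sigma Y.Y_measurable) auto
    show "square_integrable M (Y (Suc k))" for k
      using Y.same_law_integral(2)[of "\<lambda>x. x\<^sup>2" "Suc k"] sq Y.Y_measurable[of "Suc k"]
      by (simp add: square_integrable_def)
    show "distr M borel (Y (Suc k)) = distr M borel (Y (Suc 0))" for k
      using Y.same_law[of "Suc k"] by simp
    fix k B assume B: "B \<in> borel_measurable (Y.G k)" "integrable M (\<lambda>\<omega>. B \<omega> * Y (Suc k) \<omega>)"
    interpret finite_measure_subalgebra M "Y.G k" by unfold_locales (rule Y.subalgebra_G)
    have Yi: "integrable M (Y (Suc j))" for j using V by (simp add: weak_L1_limit_def)
    have [measurable]: "B \<in> borel_measurable M" by (rule measurable_from_subalg[OF Y.subalgebra_G B(1)])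
    have "AE \<omega> in M. real_cond_exp M (Y.G k) (Y (Suc k)) \<omega> = 0"
    proof (rule real_cond_exp_charact)
      fix A assume A: "A \<in> sets (Y.G k)"
      then have [measurable]: "A \<in> sets M" using Y.subalgebra_G by (auto simp: subalgebra_def)
      have AF: "indicator A \<in> borel_measurable (Y.G k)" using A by simp
      have const: "(\<integral>\<omega>. Y j \<omega> * indicator A \<omega> \<partial>M) = (\<integral>\<omega>. indicator A \<omega> * Y (Suc k) \<omega> \<partial>M)" if "k < j" for j
        unfolding mult.commute[of "Y j _"]
        by (rule Y.integral_cid[of "\<lambda>x. x" "indicator A" k 1]) (use Yi[of 0] AF that in \<open>auto simp: indicator_def\<close>)
      have ev: "\<forall>\<^sub>F j in sequentially. (\<integral>\<omega>. Y j \<omega> * indicator A \<omega> \<partial>M) = (\<integral>\<omega>. indicator A \<omega> * Y (Suc k) \<omega> \<partial>M)"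
        by (rule eventually_mono[OF eventually_gt_at_top[of k] const])
      have "bounded (indicat_real A ` space M)"
        by (auto simp: bounded_iff indicator_def intro!: exI[of _ 1])
      then have lim: "(\<lambda>j. \<integral>\<omega>. Y j \<omega> * indicator A \<omega> \<partial>M) \<longlonglongrightarrow> 0"
        using V by (simp add: weak_L1_limit_def)
      have "(\<integral>\<omega>. indicator A \<omega> * Y (Suc k) \<omega> \<partial>M) = 0"
        by (rule LIMSEQ_unique[OF tendsto_eventually[OF ev] lim])
      then show "(\<integral>\<omega>\<in>A. Y (Suc k) \<omega> \<partial>M) = (\<integral>\<omega>\<in>A. 0 \<partial>M)"
        by (simp add: set_lebesgue_integral_def)
    qed (use Yi in auto)
    then have "(\<integral>\<omega>. B \<omega> * real_cond_exp M (Y.G k) (Y (Suc k)) \<omega> \<partial>M) = (\<integral>\<omega>. 0 \<partial>M)"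
      by (intro integral_cong_AE) auto
    then show "(\<integral>\<omega>. B \<omega> * Y (Suc k) \<omega> \<partial>M) = 0"
      using real_cond_exp_intg(2)[OF B(2) B(1)] Yi by simp
  qed
qed

text \<open>The test function is the indicator of the event where \<open>V\<close> is
  negative.\<close>

lemma (in prob_space) weak_L1_limit_nonneg:
  assumes "weak_L1_limit M Z V" "\<And>n \<omega>. 0 \<le> Z n \<omega>"
  shows "AE \<omega> in M. 0 \<le> V \<omega>"
proof -
  have iV: "integrable M V" using assms by (simp add: weak_L1_limit_def)
  then have [measurable]: "V \<in> borel_measurable M" by (rule borel_measurable_integrable)
  define B :: "'a \<Rightarrow> real" where "B \<omega> = (if V \<omega> < 0 then 1 else 0)" for \<omega>
  have [measurable]: "B \<in> borel_measurable M" unfolding B_def[abs_def] by measurable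
  have "bounded (B ` space M)" by (auto simp: bounded_iff B_def intro!: exI[of _ 1])
  then have "(\<lambda>n. \<integral>\<omega>. Z n \<omega> * B \<omega> \<partial>M) \<longlonglongrightarrow> (\<integral>\<omega>. V \<omega> * B \<omega> \<partial>M)"
    using assms by (simp add: weak_L1_limit_def)
  then have "0 \<le> (\<integral>\<omega>. V \<omega> * B \<omega> \<partial>M)"
    by (rule LIMSEQ_le_const) (auto intro!: integral_nonneg_AE AE_I2 simp: assms B_def)
  moreover have "(\<integral>\<omega>. V \<omega> * B \<omega> \<partial>M) = - (\<integral>\<omega>. max 0 (- V \<omega>) \<partial>M)"
    unfolding Bochner_Integration.integral_minus[symmetric]
    by (rule Bochner_Integration.integral_cong) (auto simp: B_def)
  moreover have "0 \<le> (\<integral>\<omega>. max 0 (- V \<omega>) \<partial>M)" by simp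
  ultimately have "(\<integral>\<omega>. max 0 (- V \<omega>) \<partial>M) = 0" by linarith
  then have "AE \<omega> in M. max 0 (- V \<omega>) = 0"
    using iV by (subst (asm) integral_nonneg_eq_0_iff_AE) auto
  then show ?thesis by eventually_elim (simp add: max_def split: if_splits)
qed

text \<open>A weak limit of squares is nonnegative only almost everywhere, whereas
  \<open>stable_central_limit\<close> wants this at every point; the positive part repairs it on a
  null set.\<close>

theorem (in prob_space) cid_stable_central_limit:
  assumes Y: "cid M borel Y" and V: "weak_L1_limit M Y (\<lambda>_. 0)"
    and L: "weak_L1_limit M (\<lambda>n \<omega>. (Y n \<omega>)\<^sup>2) L" and H: "H \<in> sets M"
  shows "(\<lambda>n. \<integral>\<omega>. indicator H \<omega> * iexp (t / sqrt (real n) * (\<Sum>k<n. Y (Suc k) \<omega>)) \<partial>M) \<longlonglongrightarrow>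
    complex_of_real (\<integral>\<omega>. indicator H \<omega> * exp (- (t\<^sup>2 * max 0 (L \<omega>) / 2)) \<partial>M)"
proof -
  interpret Y: cid_process M borel Y by unfold_locales (rule Y)
  have sq: "integrable M (\<lambda>\<omega>. (Y 1 \<omega>)\<^sup>2)" and iL: "integrable M L" using L by (auto simp: weak_L1_limit_def)
  interpret martingale_differences M Y.G "\<lambda>k. Y (Suc k)"
    by (rule centred_cid_martingale_differences[OF Y sq V])
  have pos: "AE \<omega> in M. 0 \<le> L \<omega>" by (rule weak_L1_limit_nonneg[OF L]) simp
  have "(\<integral>\<omega>. \<bar>(\<Sum>k<n. (Y (Suc k) \<omega>)\<^sup>2) / real n - max 0 (L \<omega>)\<bar> \<partial>M) =
      (\<integral>\<omega>. \<bar>(\<Sum>k<n. (Y (Suc k) \<omega>)\<^sup>2) / real n - L \<omega>\<bar> \<partial>M)" for n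
    using pos iL by (intro integral_cong_AE) (auto elim!: eventually_mono)
  then have "(\<lambda>n. \<integral>\<omega>. \<bar>(\<Sum>k<n. (Y (Suc k) \<omega>)\<^sup>2) / real n - max 0 (L \<omega>)\<bar> \<partial>M) \<longlonglongrightarrow> 0"
    using Y.L1_law_of_large_numbers[of "\<lambda>x. x\<^sup>2" L] sq L by simp
  then show ?thesis
    using iL by (intro stable_central_limit H) auto
qed

section \<open>From characteristic functions to stable convergence\<close>

text \<open>The positive part covers the dummy values too: for \<open>c\<close> at most 0 the law is
  the point mass at 0, with characteristic function 1.\<close>

lemma char_normal_law: "char (normal_law c) t = complex_of_real (exp (- (t\<^sup>2 * max 0 c / 2)))"
proof (cases "0 < c")
  case True
  interpret S: prob_space std_normal_distribution
    by (rule prob_space_normal_density) simp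
  have "distributed std_normal_distribution lborel (\<lambda>x. x) std_normal_density"
    by (auto simp: distributed_def distr_id2)
  from S.normal_density_affine[OF this, of "sqrt c" 0] True
  have "distr std_normal_distribution lborel (\<lambda>x. sqrt c * x) = density lborel (normal_density 0 (sqrt c))"
    by (simp add: distributed_def)
  then have "normal_law c = distr std_normal_distribution lborel (\<lambda>x. sqrt c * x)"
    using True by (simp add: normal_law_def)
  then have "char (normal_law c) t = (CLINT x|std_normal_distribution. iexp (t * (sqrt c * x)))"
    by (simp add: char_def integral_distr)
  also have "\<dots> = char std_normal_distribution (t * sqrt c)"
    by (simp add: char_def mult.assoc)
  finally show ?thesis using True by (simp add: char_std_normal_distribution power_mult_distrib)
next
  case False
  then show ?thesis
    by (simp add: normal_law_def char_def integral_return)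
qed

lemma char_normal_mixture:
  assumes "prob_space U" and L: "L \<in> borel_measurable U"
  shows "char (U \<bind> (\<lambda>\<omega>. normal_law (L \<omega>))) t = complex_of_real (\<integral>\<omega>. exp (- (t\<^sup>2 * max 0 (L \<omega>) / 2)) \<partial>U)"
    and "real_distribution (U \<bind> (\<lambda>\<omega>. normal_law (L \<omega>)))"
proof -
  interpret prob_space U by fact
  let ?N = "\<lambda>\<omega>. normal_law (L \<omega>)"
  have N: "?N \<in> measurable U (subprob_algebra borel)"
    using measurable_compose[OF L measurable_normal_law] .
  have N1: "AE \<omega> in U. emeasure (?N \<omega>) (space (?N \<omega>)) \<le> ennreal 1"
    by (simp add: prob_space.emeasure_space_1[OF prob_space_normal_law])
  have sets: "sets (U \<bind> ?N) = sets borel"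
    by (rule sets_bind[OF _ not_empty]) simp
  have "prob_space (U \<bind> ?N)"
    by (rule prob_space_bind[OF _ N]) (simp add: prob_space_normal_law)
  with sets show rd: "real_distribution (U \<bind> ?N)"
    by (simp add: real_distribution_def real_distribution_axioms_def)
  \<comment> \<open>Cosine and sine are bounded real functions, whose integrals against the mixture
    are iterated integrals by \<open>integral_bind\<close>.\<close>
  have Re_Im_char: "Re (char R t) = (\<integral>x. cos (t * x) \<partial>R)" "Im (char R t) = (\<integral>x. sin (t * x) \<partial>R)"
    if "real_distribution R" for R
  proof -
    interpret R: real_distribution R by fact
    have "integrable R (\<lambda>x. iexp (t * x))"
      by (rule R.integrable_const_bound[of _ 1]) auto
    then show "Re (char R t) = (\<integral>x. cos (t * x) \<partial>R)" "Im (char R t) = (\<integral>x. sin (t * x) \<partial>R)"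
      unfolding char_def by (simp_all add: Re_exp Im_exp flip: integral_Re integral_Im)
  qed
  have rn: "real_distribution (normal_law c)" for c
    by (simp add: real_distribution_def real_distribution_axioms_def prob_space_normal_law)
  have "(\<integral>x. cos (t * x) \<partial>(U \<bind> ?N)) = (\<integral>\<omega>. \<integral>x. cos (t * x) \<partial>?N \<omega> \<partial>U)"
    by (rule integral_bind[OF _ _ N finite_measure_axioms N1, of _ 1]) auto
  moreover have "(\<integral>x. sin (t * x) \<partial>(U \<bind> ?N)) = (\<integral>\<omega>. \<integral>x. sin (t * x) \<partial>?N \<omega> \<partial>U)"
    by (rule integral_bind[OF _ _ N finite_measure_axioms N1, of _ 1]) auto
  ultimately show "char (U \<bind> ?N) t = complex_of_real (\<integral>\<omega>. exp (- (t\<^sup>2 * max 0 (L \<omega>) / 2)) \<partial>U)"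
    by (simp add: complex_eq_iff Re_Im_char[OF rd] Re_Im_char[OF rn, symmetric] char_normal_law)
qed

lemma (in finite_measure) integral_uniform_measure:
  fixes g :: "'a \<Rightarrow> 'b::{banach, second_countable_topology}"
  assumes H: "H \<in> sets M" "0 < measure M H" and g: "g \<in> borel_measurable M"
  shows "(\<integral>\<omega>. g \<omega> \<partial>uniform_measure M H) = (1 / measure M H) *\<^sub>R (\<integral>\<omega>. indicator H \<omega> *\<^sub>R g \<omega> \<partial>M)"
proof -
  have "indicator H \<omega> / emeasure M H = ennreal (indicator H \<omega> / measure M H)" for \<omega>
    using H(2) by (simp add: emeasure_eq_measure divide_ennreal flip: ennreal_indicator)
  then have "(\<integral>\<omega>. g \<omega> \<partial>uniform_measure M H) = (\<integral>\<omega>. (indicator H \<omega> / measure M H) *\<^sub>R g \<omega> \<partial>M)"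
    unfolding uniform_measure_def using H g by (simp add: integral_density)
  also have "\<dots> = (\<integral>\<omega>. (1 / measure M H) *\<^sub>R (indicator H \<omega> *\<^sub>R g \<omega>) \<partial>M)"
    by (rule Bochner_Integration.integral_cong) (auto simp: divide_inverse mult.commute)
  also have "\<dots> = (1 / measure M H) *\<^sub>R (\<integral>\<omega>. indicator H \<omega> *\<^sub>R g \<omega> \<partial>M)"
    by (rule integral_scaleR_right)
  finally show ?thesis .
qed

text \<open>After division by the probability of \<open>H\<close>, the hypothesis is convergence of
  characteristic functions under P(. | H), and Levy's continuity theorem applies to each
  \<open>H\<close> separately.\<close>

lemma (in prob_space) stably_converges_normalI:
  assumes Z: "\<And>n. Z n \<in> borel_measurable M" and L: "L \<in> borel_measurable M" "AE \<omega> in M. 0 \<le> L \<omega>"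
    and lim: "\<And>H t. H \<in> sets M \<Longrightarrow> (\<lambda>n. \<integral>\<omega>. indicator H \<omega> * iexp (t * Z n \<omega>) \<partial>M) \<longlonglongrightarrow>
      complex_of_real (\<integral>\<omega>. indicator H \<omega> * exp (- (t\<^sup>2 * max 0 (L \<omega>) / 2)) \<partial>M)"
  shows "stably_converges_normal M Z L"
  unfolding stably_converges_normal_def
proof (intro conjI allI ballI impI Z L)
  fix H assume H: "H \<in> sets M" "0 < measure M H"
  note [measurable] = Z L(1)
  let ?U = "uniform_measure M H"
  interpret U: prob_space ?U
    using H by (intro prob_space_uniform_measure) (auto simp: emeasure_eq_measure)
  have LU: "L \<in> borel_measurable ?U" using L by simp
  have ZU: "Z n \<in> borel_measurable ?U" for n using Z by simp
  show "weak_conv_m (\<lambda>n. distr ?U borel (Z n)) (?U \<bind> (\<lambda>\<omega>. normal_law (L \<omega>)))"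
  proof (rule levy_continuity)
    show "real_distribution (distr ?U borel (Z n))" for n
      by (rule U.real_distribution_distr[OF ZU])
    show "real_distribution (?U \<bind> (\<lambda>\<omega>. normal_law (L \<omega>)))"
      by (rule char_normal_mixture(2)[OF U.prob_space_axioms LU])
    fix t
    have "char (distr ?U borel (Z n)) t = (1 / measure M H) *\<^sub>R (\<integral>\<omega>. indicator H \<omega> * iexp (t * Z n \<omega>) \<partial>M)" for n
    proof -
      have "char (distr ?U borel (Z n)) t = (\<integral>\<omega>. iexp (t * Z n \<omega>) \<partial>?U)"
        unfolding char_def by (rule integral_distr[OF ZU]) measurable
      also have "\<dots> = (1 / measure M H) *\<^sub>R (\<integral>\<omega>. indicator H \<omega> *\<^sub>R iexp (t * Z n \<omega>) \<partial>M)"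
        by (rule integral_uniform_measure[OF H]) measurable
      finally show ?thesis by (simp add: scaleR_conv_of_real of_real_indicator)
    qed
    moreover have "char (?U \<bind> (\<lambda>\<omega>. normal_law (L \<omega>))) t =
        (1 / measure M H) *\<^sub>R complex_of_real (\<integral>\<omega>. indicator H \<omega> * exp (- (t\<^sup>2 * max 0 (L \<omega>) / 2)) \<partial>M)"
      unfolding char_normal_mixture(1)[OF U.prob_space_axioms LU]
      by (subst integral_uniform_measure[OF H]) (auto simp: scaleR_conv_of_real)
    ultimately show "(\<lambda>n. char (distr ?U borel (Z n)) t) \<longlonglongrightarrow> char (?U \<bind> (\<lambda>\<omega>. normal_law (L \<omega>))) t"
      using tendsto_scaleR[OF tendsto_const lim[OF H(1), of t], of "1 / measure M H"] by simp
  qed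
qed

section \<open>Transfer from the shifted sums to the original ones\<close>

lemma cmod_iexp_diff_le: "cmod (iexp a - iexp b) \<le> \<bar>a - b\<bar>"
proof -
  have "iexp a - iexp b = iexp b * (iexp (a - b) - 1)"
    by (simp add: algebra_simps flip: exp_add)
  then have "cmod (iexp a - iexp b) = cmod (iexp (a - b) - 1)" by (simp add: norm_mult)
  also have "\<dots> \<le> \<bar>a - b\<bar>" using iexp_approx1[of "a - b" 0] by simp
  finally show ?thesis .
qed

lemma (in prob_space) iexp_limit_transfer:
  assumes [measurable]: "H \<in> sets M"
    and S: "\<And>n. integrable M (S n)" and W: "\<And>n. integrable M (W n)"
    and d: "(\<lambda>n. \<integral>\<omega>. \<bar>W n \<omega> - S n \<omega>\<bar> \<partial>M) \<longlonglongrightarrow> 0"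
    and lim: "(\<lambda>n. \<integral>\<omega>. indicator H \<omega> * iexp (t * S n \<omega>) \<partial>M) \<longlonglongrightarrow> l"
  shows "(\<lambda>n. \<integral>\<omega>. indicator H \<omega> * iexp (t * W n \<omega>) \<partial>M) \<longlonglongrightarrow> l"
proof -
  have Sm [measurable]: "S n \<in> borel_measurable M" and Wm [measurable]: "W n \<in> borel_measurable M" for n
    using S W by (auto intro: borel_measurable_integrable)
  have i: "integrable M (\<lambda>\<omega>. indicator H \<omega> * iexp (t * R \<omega>))" if [measurable]: "R \<in> borel_measurable M" for R
    by (rule integrable_const_bound[of _ 1]) (auto simp: norm_mult indicator_def)
  have le: "cmod ((\<integral>\<omega>. indicator H \<omega> * iexp (t * W n \<omega>) \<partial>M) - (\<integral>\<omega>. indicator H \<omega> * iexp (t * S n \<omega>) \<partial>M)) \<le>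
      \<bar>t\<bar> * (\<integral>\<omega>. \<bar>W n \<omega> - S n \<omega>\<bar> \<partial>M)" for n
  proof -
    have "cmod ((\<integral>\<omega>. indicator H \<omega> * iexp (t * W n \<omega>) \<partial>M) - (\<integral>\<omega>. indicator H \<omega> * iexp (t * S n \<omega>) \<partial>M)) =
        cmod (\<integral>\<omega>. indicator H \<omega> * iexp (t * W n \<omega>) - indicator H \<omega> * iexp (t * S n \<omega>) \<partial>M)"
      by (simp only: Bochner_Integration.integral_diff[OF i[OF Wm] i[OF Sm]])
    also have "\<dots> \<le> (\<integral>\<omega>. cmod (indicator H \<omega> * iexp (t * W n \<omega>) - indicator H \<omega> * iexp (t * S n \<omega>)) \<partial>M)"
      by (rule integral_norm_bound)
    also have "\<dots> \<le> (\<integral>\<omega>. \<bar>t\<bar> * \<bar>W n \<omega> - S n \<omega>\<bar> \<partial>M)"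
    proof (rule integral_mono)
      show "integrable M (\<lambda>\<omega>. cmod (indicator H \<omega> * iexp (t * W n \<omega>) - indicator H \<omega> * iexp (t * S n \<omega>)))"
        by (intro integrable_norm Bochner_Integration.integrable_diff i) measurable
      show "integrable M (\<lambda>\<omega>. \<bar>t\<bar> * \<bar>W n \<omega> - S n \<omega>\<bar>)" using S W by simp
      show "cmod (indicator H \<omega> * iexp (t * W n \<omega>) - indicator H \<omega> * iexp (t * S n \<omega>)) \<le> \<bar>t\<bar> * \<bar>W n \<omega> - S n \<omega>\<bar>" for \<omega>
        using cmod_iexp_diff_le[of "t * W n \<omega>" "t * S n \<omega>"]
        by (auto simp: indicator_def abs_mult simp flip: right_diff_distrib)
    qed
    finally show ?thesis by simp
  qed
  have "(\<lambda>n. \<bar>t\<bar> * (\<integral>\<omega>. \<bar>W n \<omega> - S n \<omega>\<bar> \<partial>M)) \<longlonglongrightarrow> 0"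
    using tendsto_mult_right_zero[OF d] .
  then have "(\<lambda>n. (\<integral>\<omega>. indicator H \<omega> * iexp (t * W n \<omega>) \<partial>M) - (\<integral>\<omega>. indicator H \<omega> * iexp (t * S n \<omega>) \<partial>M)) \<longlonglongrightarrow> 0"
    by (rule Lim_null_comparison[OF always_eventually[OF allI[OF le]]])
  from tendsto_add[OF this lim] show ?thesis by simp
qed

text \<open>Both windows of length \<open>n\<close> are completed to the range from 1 to n + m, one
  at its end and the other at its beginning. This also covers m > n, where the windows are
  disjoint.\<close>

lemma abs_sum_shift_diff_le:
  fixes a :: "nat \<Rightarrow> real"
  shows "\<bar>(\<Sum>i=1..n. a i) - (\<Sum>k<n. a (Suc k + m))\<bar> \<le> (\<Sum>i=1..m. \<bar>a i\<bar>) + (\<Sum>i=n+1..n+m. \<bar>a i\<bar>)"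
proof -
  have "(\<Sum>k<n. a (Suc k + m)) = (\<Sum>i=m+1..m+n. a i)"
    by (rule sum.reindex_bij_witness[of _ "\<lambda>i. i - m - 1" "\<lambda>k. Suc k + m"]) auto
  moreover have "(\<Sum>i=1..m+n. a i) = (\<Sum>i=1..m. a i) + (\<Sum>i=m+1..m+n. a i)"
    "(\<Sum>i=1..n+m. a i) = (\<Sum>i=1..n. a i) + (\<Sum>i=n+1..n+m. a i)"
    by (rule sum.ub_add_nat; simp)+
  ultimately have "(\<Sum>i=1..n. a i) - (\<Sum>k<n. a (Suc k + m)) = (\<Sum>i=1..m. a i) - (\<Sum>i=n+1..n+m. a i)"
    by (simp add: add.commute)
  also have "\<bar>\<dots>\<bar> \<le> \<bar>\<Sum>i=1..m. a i\<bar> + \<bar>\<Sum>i=n+1..n+m. a i\<bar>" by (rule abs_triangle_ineq4)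
  also have "\<dots> \<le> (\<Sum>i=1..m. \<bar>a i\<bar>) + (\<Sum>i=n+1..n+m. \<bar>a i\<bar>)"
    by (intro add_mono sum_abs)
  finally show ?thesis .
qed

theorem theorem3p1:
  fixes M :: "'a measure" and N :: "'b measure" and X :: "nat \<Rightarrow> 'a \<Rightarrow> 'b"
    and f :: "'b \<Rightarrow> real" and V_f V_f2 :: "'a \<Rightarrow> real" and m :: nat
  assumes "prob_space M"
    and "cid M N X"
    and "f \<in> class_H M N X"
    and "(\<lambda>x. (f x)\<^sup>2) \<in> class_H M N X"
    and "weak_L1_limit M (\<lambda>n \<omega>. f (X n \<omega>)) V_f"
    and "weak_L1_limit M (\<lambda>n \<omega>. (f (X n \<omega>))\<^sup>2) V_f2"
    and "cid M borel (\<lambda>n \<omega>. f (X (n + m) \<omega>) - V_f \<omega>)"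
  shows "stably_converges_normal M
           (\<lambda>n \<omega>. 1 / sqrt (real n) * ((\<Sum>i=1..n. f (X i \<omega>)) - real n * V_f \<omega>))
           (\<lambda>\<omega>. V_f2 \<omega> - (V_f \<omega>)\<^sup>2)"
proof -
  interpret prob_space M by fact
  interpret X: cid_process M N X by unfold_locales fact
  have fm: "f \<in> borel_measurable N" and f1: "integrable M (\<lambda>\<omega>. f (X 1 \<omega>))"
    and f2: "integrable M (\<lambda>\<omega>. (f (X 1 \<omega>))\<^sup>2)"
    using assms(3,4) by (auto simp: class_H_def)
  have fi: "integrable M (\<lambda>\<omega>. f (X n \<omega>))" if "1 \<le> n" for n
    using X.same_law_integral(2)[OF fm that] f1 by simp
  have fm2: "(\<lambda>x. (f x)\<^sup>2) \<in> borel_measurable N" using fm by measurable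
  have sqf: "square_integrable M (\<lambda>\<omega>. f (X n \<omega>))" if "1 \<le> n" for n
    using X.same_law_integral(2)[OF fm2 that] f2 fi[OF that] by (auto simp: square_integrable_def)
  define c where "c = (\<integral>\<omega>. (f (X 1 \<omega>))\<^sup>2 \<partial>M)"
  have fc: "(\<integral>\<omega>. (f (X n \<omega>))\<^sup>2 \<partial>M) \<le> c" if "1 \<le> n" for n
    using X.same_law_integral(1)[OF fm2 that] by (simp add: c_def)
  \<comment> \<open>The second moments of f(X_n) all equal \<open>c\<close>, so the weak limit
    inherits square integrability.\<close>
  have sqV: "square_integrable M V_f"
    by (rule square_integrable_weak_limit[OF sqf fc assms(5)])
  have iV: "integrable M V_f" "integrable M V_f2" "integrable M (\<lambda>\<omega>. (V_f \<omega>)\<^sup>2)"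
    using assms(5,6) sqV by (auto simp: weak_L1_limit_def square_integrable_def)
  note [measurable] = borel_measurable_integrable[OF iV(1)] borel_measurable_integrable[OF iV(2)]
  define Y where "Y n \<omega> = f (X (n + m) \<omega>) - V_f \<omega>" for n \<omega>
  have cidY: "cid M borel Y" using assms(7) by (simp add: Y_def[abs_def])
  have sqY: "square_integrable M (Y n)" if "1 \<le> n" for n
    unfolding Y_def[abs_def] using that by (intro square_integrable_diff sqf sqV) simp
  have iY: "integrable M (Y n)" if "1 \<le> n" for n
    by (rule integrable_of_square_integrable[OF sqY[OF that]])
  have shift: "(\<lambda>n. \<integral>\<omega>. f (X (n + m) \<omega>) * B \<omega> \<partial>M) \<longlonglongrightarrow> (\<integral>\<omega>. V_f \<omega> * B \<omega> \<partial>M)"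
    "(\<lambda>n. \<integral>\<omega>. (f (X (n + m) \<omega>))\<^sup>2 * B \<omega> \<partial>M) \<longlonglongrightarrow> (\<integral>\<omega>. V_f2 \<omega> * B \<omega> \<partial>M)"
    if "B \<in> borel_measurable M" "bounded (B ` space M)" for B :: "'a \<Rightarrow> real"
    using assms(5,6) that by (auto simp: weak_L1_limit_def intro: LIMSEQ_ignore_initial_segment)
  have integrable_times: "integrable M (\<lambda>\<omega>. q \<omega> * B \<omega>)"
    if q: "integrable M q" and [measurable]: "B \<in> borel_measurable M" and B: "bounded (B ` space M)" for q B :: "'a \<Rightarrow> real"
  proof -
    obtain b where b: "\<And>\<omega>. \<omega> \<in> space M \<Longrightarrow> \<bar>B \<omega>\<bar> \<le> b" using B by (auto simp: bounded_iff)
    show ?thesis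
    proof (rule Bochner_Integration.integrable_bound)
      show "integrable M (\<lambda>\<omega>. q \<omega> * b)" using q by simp
      show "AE \<omega> in M. norm (q \<omega> * B \<omega>) \<le> norm (q \<omega> * b)"
        using b by (auto simp: abs_mult intro!: AE_I2 mult_left_mono intro: order_trans[OF _ abs_ge_self])
    qed (use borel_measurable_integrable[OF q] in measurable)
  qed
  have weakY: "weak_L1_limit M Y (\<lambda>_. 0)"
    unfolding weak_L1_limit_def
  proof (intro conjI allI ballI impI iY)
    fix B :: "'a \<Rightarrow> real" assume B: "B \<in> borel_measurable M" "bounded (B ` space M)"
    have "\<forall>\<^sub>F n in sequentially. (\<integral>\<omega>. f (X (n + m) \<omega>) * B \<omega> \<partial>M) - (\<integral>\<omega>. V_f \<omega> * B \<omega> \<partial>M) = (\<integral>\<omega>. Y n \<omega> * B \<omega> \<partial>M)"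
      using eventually_ge_at_top[of 1]
    proof eventually_elim
      case (elim n)
      then show ?case
        using integrable_times[OF fi[of "n + m"] B] integrable_times[OF iV(1) B] by (simp add: Y_def left_diff_distrib)
    qed
    moreover have "(\<lambda>n. (\<integral>\<omega>. f (X (n + m) \<omega>) * B \<omega> \<partial>M) - (\<integral>\<omega>. V_f \<omega> * B \<omega> \<partial>M)) \<longlonglongrightarrow> 0"
      using tendsto_diff[OF shift(1)[OF B] tendsto_const[of "\<integral>\<omega>. V_f \<omega> * B \<omega> \<partial>M"]] by simp
    ultimately show "(\<lambda>n. \<integral>\<omega>. Y n \<omega> * B \<omega> \<partial>M) \<longlonglongrightarrow> (\<integral>\<omega>. 0 * B \<omega> \<partial>M)"
      by (simp add: Lim_transform_eventually)
  qed simp_all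
  let ?L = "\<lambda>\<omega>. V_f2 \<omega> - (V_f \<omega>)\<^sup>2"
  \<comment> \<open>Expanding (f(X_(n+m)) - V_f)^2, the three terms have weak limits V_f2, -2 V_f^2
    and V_f^2.\<close>
  have weakY2: "weak_L1_limit M (\<lambda>n \<omega>. (Y n \<omega>)\<^sup>2) ?L"
    unfolding weak_L1_limit_def
  proof (intro conjI allI ballI impI)
    show "integrable M (\<lambda>\<omega>. (Y n \<omega>)\<^sup>2)" if "1 \<le> n" for n
      using sqY[OF that] by (simp add: square_integrable_def)
    show "integrable M ?L" using iV by simp
    fix B :: "'a \<Rightarrow> real" assume B: "B \<in> borel_measurable M" "bounded (B ` space M)"
    then obtain b where b: "\<And>\<omega>. \<omega> \<in> space M \<Longrightarrow> \<bar>B \<omega>\<bar> \<le> b" by (auto simp: bounded_iff)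
    have sqVB: "square_integrable M (\<lambda>\<omega>. V_f \<omega> * B \<omega>)"
      by (rule square_integrable_bounded_mult[OF sqV B(1) b])
    \<comment> \<open>The multiplier V_f B need not be bounded, so the definition of the weak limit
      does not cover it; the extension to square-integrable multipliers does.\<close>
    have cross: "(\<lambda>n. \<integral>\<omega>. f (X (n + m) \<omega>) * (V_f \<omega> * B \<omega>) \<partial>M) \<longlonglongrightarrow> (\<integral>\<omega>. V_f \<omega> * (V_f \<omega> * B \<omega>) \<partial>M)"
      by (rule LIMSEQ_ignore_initial_segment[OF weak_L1_limit_square_integrable_multiplier[OF sqf fc assms(5) sqVB]])
    have iVVB: "integrable M (\<lambda>\<omega>. V_f \<omega> * (V_f \<omega> * B \<omega>))" by (rule square_integrable_mult[OF sqV sqVB])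
    have "\<forall>\<^sub>F n in sequentially. (\<integral>\<omega>. (f (X (n + m) \<omega>))\<^sup>2 * B \<omega> \<partial>M) -
        2 * (\<integral>\<omega>. f (X (n + m) \<omega>) * (V_f \<omega> * B \<omega>) \<partial>M) + (\<integral>\<omega>. V_f \<omega> * (V_f \<omega> * B \<omega>) \<partial>M) = (\<integral>\<omega>. (Y n \<omega>)\<^sup>2 * B \<omega> \<partial>M)"
      using eventually_ge_at_top[of 1]
    proof eventually_elim
      case (elim n)
      then have 1: "1 \<le> n + m" by simp
      have f2': "integrable M (\<lambda>\<omega>. (f (X (n + m) \<omega>))\<^sup>2)" using sqf[OF 1] by (simp add: square_integrable_def)
      have "(\<integral>\<omega>. (Y n \<omega>)\<^sup>2 * B \<omega> \<partial>M) = (\<integral>\<omega>. (f (X (n + m) \<omega>))\<^sup>2 * B \<omega> - 2 * (f (X (n + m) \<omega>) * (V_f \<omega> * B \<omega>)) +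
          V_f \<omega> * (V_f \<omega> * B \<omega>) \<partial>M)"
        by (rule Bochner_Integration.integral_cong) (auto simp: Y_def power2_eq_square algebra_simps)
      then show ?case
        using integrable_times[OF f2' B] square_integrable_mult[OF sqf[OF 1] sqVB] iVVB by simp
    qed
    moreover have "(\<lambda>n. (\<integral>\<omega>. (f (X (n + m) \<omega>))\<^sup>2 * B \<omega> \<partial>M) -
        2 * (\<integral>\<omega>. f (X (n + m) \<omega>) * (V_f \<omega> * B \<omega>) \<partial>M) + (\<integral>\<omega>. V_f \<omega> * (V_f \<omega> * B \<omega>) \<partial>M)) \<longlonglongrightarrow>
        (\<integral>\<omega>. V_f2 \<omega> * B \<omega> \<partial>M) - 2 * (\<integral>\<omega>. V_f \<omega> * (V_f \<omega> * B \<omega>) \<partial>M) + (\<integral>\<omega>. V_f \<omega> * (V_f \<omega> * B \<omega>) \<partial>M)"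
      by (intro tendsto_intros cross shift(2)[OF B])
    moreover have "(\<integral>\<omega>. ?L \<omega> * B \<omega> \<partial>M) = (\<integral>\<omega>. V_f2 \<omega> * B \<omega> - V_f \<omega> * (V_f \<omega> * B \<omega>) \<partial>M)"
      by (simp add: power2_eq_square algebra_simps)
    ultimately show "(\<lambda>n. \<integral>\<omega>. (Y n \<omega>)\<^sup>2 * B \<omega> \<partial>M) \<longlonglongrightarrow> (\<integral>\<omega>. ?L \<omega> * B \<omega> \<partial>M)"
      using integrable_times[OF iV(2) B] iVVB by (simp add: Lim_transform_eventually)
  qed
  define W where "W n \<omega> = 1 / sqrt (real n) * ((\<Sum>i=1..n. f (X i \<omega>)) - real n * V_f \<omega>)" for n \<omega>
  define S where "S n \<omega> = 1 / sqrt (real n) * (\<Sum>k<n. Y (Suc k) \<omega>)" for n \<omega>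
  have iW: "integrable M (W n)" for n
    unfolding W_def[abs_def] using fi iV(1)
    by (intro integrable_mult_right Bochner_Integration.integrable_diff Bochner_Integration.integrable_sum) auto
  have iS: "integrable M (S n)" for n
    unfolding S_def[abs_def] using iY
    by (intro integrable_mult_right Bochner_Integration.integrable_sum) auto
  define K where "K = (\<integral>\<omega>. \<bar>f (X 1 \<omega>)\<bar> \<partial>M)"
  have fK: "(\<integral>\<omega>. \<bar>f (X n \<omega>)\<bar> \<partial>M) = K" if "1 \<le> n" for n
    using X.same_law_integral(1)[of "\<lambda>x. \<bar>f x\<bar>", OF _ that] fm by (simp add: K_def)
  \<comment> \<open>The terms n V_f cancel in W_n - S_n. What remains is at most \<open>m\<close>
    terms at each end, each of L1 norm \<open>K\<close>; for \<open>n = 0\<close> both sides are 0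
    by division by zero.\<close>
  have WS: "(\<integral>\<omega>. \<bar>W n \<omega> - S n \<omega>\<bar> \<partial>M) \<le> 2 * real m * K * inverse (sqrt (real n))" for n
  proof -
    let ?R = "\<lambda>\<omega>. (\<Sum>i=1..m. \<bar>f (X i \<omega>)\<bar>) + (\<Sum>i=n+1..n+m. \<bar>f (X i \<omega>)\<bar>)"
    have iR: "integrable M ?R"
      using fi by (intro Bochner_Integration.integrable_add Bochner_Integration.integrable_sum integrable_abs) auto
    have "(\<integral>\<omega>. \<bar>W n \<omega> - S n \<omega>\<bar> \<partial>M) \<le> (\<integral>\<omega>. inverse (sqrt (real n)) * ?R \<omega> \<partial>M)"
    proof (rule integral_mono)
      fix \<omega>
      have "W n \<omega> - S n \<omega> = inverse (sqrt (real n)) * ((\<Sum>i=1..n. f (X i \<omega>)) - (\<Sum>k<n. f (X (Suc k + m) \<omega>)))"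
        by (simp add: W_def S_def Y_def sum_subtractf divide_inverse algebra_simps)
      then show "\<bar>W n \<omega> - S n \<omega>\<bar> \<le> inverse (sqrt (real n)) * ?R \<omega>"
        using abs_sum_shift_diff_le[of "\<lambda>i. f (X i \<omega>)" n m] by (simp add: abs_mult mult_left_mono)
    qed (use iW iS iR in auto)
    also have "\<dots> = inverse (sqrt (real n)) * ((\<Sum>i=1..m. \<integral>\<omega>. \<bar>f (X i \<omega>)\<bar> \<partial>M) + (\<Sum>i=n+1..n+m. \<integral>\<omega>. \<bar>f (X i \<omega>)\<bar> \<partial>M))"
    proof -
      have *: "integrable M (\<lambda>\<omega>. \<bar>f (X i \<omega>)\<bar>)" if "i \<in> {j..k}" "1 \<le> j" for i j k
        using fi[of i] that by simp
      have i1: "integrable M (\<lambda>\<omega>. \<Sum>i=j..k. \<bar>f (X i \<omega>)\<bar>)"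
        and i2: "(\<integral>\<omega>. (\<Sum>i=j..k. \<bar>f (X i \<omega>)\<bar>) \<partial>M) = (\<Sum>i=j..k. \<integral>\<omega>. \<bar>f (X i \<omega>)\<bar> \<partial>M)"
        if "1 \<le> j" for j k
        using that by (auto intro!: Bochner_Integration.integrable_sum Bochner_Integration.integral_sum intro: *)
      show ?thesis
        using i1[of 1 m] i1[of "n + 1" "n + m"] i2[of 1 m] i2[of "n + 1" "n + m"] by simp
    qed
    also have "(\<Sum>i=1..m. \<integral>\<omega>. \<bar>f (X i \<omega>)\<bar> \<partial>M) = (\<Sum>i=1..m. K)" by (intro sum.cong refl fK) auto
    also have "(\<Sum>i=n+1..n+m. \<integral>\<omega>. \<bar>f (X i \<omega>)\<bar> \<partial>M) = (\<Sum>i=n+1..n+m. K)" by (intro sum.cong refl fK) auto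
    finally show ?thesis by (simp add: algebra_simps)
  qed
  have "(\<lambda>n. 2 * real m * K * inverse (sqrt (real n))) \<longlonglongrightarrow> 0"
    by (intro tendsto_mult_right_zero tendsto_inverse_0_at_top
        filterlim_compose[OF sqrt_at_top filterlim_real_sequentially])
  then have WS0: "(\<lambda>n. \<integral>\<omega>. \<bar>W n \<omega> - S n \<omega>\<bar> \<partial>M) \<longlonglongrightarrow> 0"
    by (rule Lim_null_comparison[rotated]) (use WS in \<open>auto intro!: always_eventually\<close>)
  have "stably_converges_normal M W ?L"
  proof (rule stably_converges_normalI)
    show "W n \<in> borel_measurable M" for n using iW by (rule borel_measurable_integrable)
    show "AE \<omega> in M. 0 \<le> ?L \<omega>" by (rule weak_L1_limit_nonneg[OF weakY2]) simp
    fix H t assume H: "H \<in> sets M"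
    have "(\<lambda>n. \<integral>\<omega>. indicator H \<omega> * iexp (t * S n \<omega>) \<partial>M) \<longlonglongrightarrow>
        complex_of_real (\<integral>\<omega>. indicator H \<omega> * exp (- (t\<^sup>2 * max 0 (?L \<omega>) / 2)) \<partial>M)"
      using cid_stable_central_limit[OF cidY weakY weakY2 H, of t] by (simp add: S_def)
    then show "(\<lambda>n. \<integral>\<omega>. indicator H \<omega> * iexp (t * W n \<omega>) \<partial>M) \<longlonglongrightarrow>
        complex_of_real (\<integral>\<omega>. indicator H \<omega> * exp (- (t\<^sup>2 * max 0 (?L \<omega>) / 2)) \<partial>M)"
      by (rule iexp_limit_transfer[OF H iS iW WS0])
  qed measurable
  then show ?thesis by (simp add: W_def[abs_def])
qed

end
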